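(* Fix an integer $p\ge3$, let $\lambda=\lambda_p=2\cos(\pi/p)$, and let $k$ be an odd positive integer. Let $F$ be an entire automorphic integral of weight $2k$ on $G_p$ with zero constant term and Hecke-symmetric rational period function $q=q^*+c_0q_0$, where $q^*(z)=\sum_{\ell=1}^L d_\ell\sum_{\alpha\in\mathcal Z_{\mathcal A_\ell}}Q_\alpha(z)^{-k}$ with hyperbolic classes $\mathcal A_\ell=-\mathcal A_\ell$ of discriminant $D_\ell$, and $q_0$ has poles only at $0$. Let $R(s)$ be the remainder term of the associated Dirichlet series, i.e. the meromorphic function with $\Phi(2k-s)+\Phi(s)=R(s)$, where $\Phi(s)=\int_0^\infty F(iy)y^s\frac{dy}{y}$ (continued meromorphically); regard $R$ as the linear combination $R=-\sum_{\ell=1}^L d_\ell D_\ell^{-k/2}\sum_{\alpha\in\mathcal Z_{\mathcal A_\ell}} R(s;\alpha,\alpha')$, which equals the remainder term for $0<\operatorname{Re}s<2k$. Then $$R+\rho(R)+\rho^2(R)+\cdots+\rho^{p-1}(R)=0.$$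
   Context: $S=\begin{pmatrix}1&\lambda\\0&1\end{pmatrix}$, $T=\begin{pmatrix}0&-1\\1&0\end{pmatrix}$, $G_p=\langle S,T\rangle/\{\pm I\}$ acting by linear fractional transformations, and $U=ST=\begin{pmatrix}\lambda&-1\\1&0\end{pmatrix}$. An entire automorphic integral of weight $2k$ on $G_p$ with rational period function $q$ is $F$ holomorphic on the upper half-plane, $F(z)=\sum_{n\ge0}a_ne^{2\pi inz/\lambda}$, with $z^{-2k}F(-1/z)=F(z)+q(z)$ and $q$ rational. Hyperbolic elements have $|\text{trace}|>2$; primitive means not a proper power in $G_p$. A hyperbolic fixed point is a real number fixed by a hyperbolic element of $G_p$; its Hecke conjugate $\alpha'$ is the other fixed point of its stabilizer. A $\lambda$-BQF is $[A,B,C]$ with $A,B,C\in\mathbb Z[\lambda]$, $Q(x,y)=Ax^2+Bxy+Cy^2$, discriminant $B^2-4AC$, with $G_p$-action $(Q\circ M)(x,y)=Q(ax+by,cx+dy)$ and resulting equivalence classes. For a hyperbolic fixed point $\alpha$, $M_\alpha=\begin{pmatrix}a&b\\c&d\end{pmatrix}$ (with $a+d>0$) is the unique primitive hyperbolic element of positive trace with $\alpha=\frac{a-d+\sqrt{(a+d)^2-4}}{2c}$, $Q_\alpha=[c,d-a,-b]$, $Q_\alpha(z)=Q_\alpha(z,1)$; these are the hyperbolic forms, and a class is hyperbolic if it consists of them. For hyperbolic $Q=[A,B,C]$ of discriminant $D$, $\alpha_Q=\frac{-B+\sqrt D}{2A}$, and $Q$ is simple if $A>0>C$; $-\mathcal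 A=\{[-A,-B,-C]:[A,B,C]\in\mathcal A\}$, $\mathcal Z_{\mathcal A}=\{\alpha_Q:Q\in\mathcal A\text{ simple}\}$. For nonzero reals $a,b$ and $0<\operatorname{Re}s<2k$, $R(s;a,b)=(a-b)^k\int_0^\infty\frac{y^s}{(iy-a)^k(iy-b)^k}\frac{dy}{y}$. The map $\rho$ is defined on such expressions by $\rho(R(s;a,b))=-R(2k-s;a-\lambda,b-\lambda)$ (this function equals $R(s;U^{-1}a,U^{-1}b)$, so $\rho$ again yields expressions of the same form) and extended by linearity to finite linear combinations; $\rho$ has order $p$. *)

theory Defs
  imports "HOL-Complex_Analysis.Complex_Analysis" "HOL-Library.Poly_Mapping"
begin

subsection \<open>Hecke groups\<close>

definition hecke_lambda :: "nat \<Rightarrow> real" where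
  "hecke_lambda p = 2 * cos (pi / real p)"

definition hecke_S :: "nat \<Rightarrow> real^2^2" where
  "hecke_S p = vector [vector [1, hecke_lambda p], vector [0, 1]]"

definition hecke_T :: "real^2^2" where
  "hecke_T = vector [vector [0, -1], vector [1, 0]]"

definition hecke_U :: "nat \<Rightarrow> real^2^2" where
  "hecke_U p = hecke_S p ** hecke_T"

text \<open>The matrix group generated by \<open>S\<close> and \<open>T\<close>.  Elements of \<open>G\<^sub>p\<close> are
  matrices of this group up to sign (it contains \<open>- I = T\<^sup>2\<close>), so statements about
  elements of \<open>G\<^sub>p\<close> are phrased for matrices, up to sign where the sign matters.\<close>

inductive_set hecke_group :: "nat \<Rightarrow> (real^2^2) set" for p :: nat where
  one: "mat 1 \<in> hecke_group p"
| S: "hecke_S p \<in> hecke_group p"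
| T: "hecke_T \<in> hecke_group p"
| mult: "M \<in> hecke_group p \<Longrightarrow> N \<in> hecke_group p \<Longrightarrow> M ** N \<in> hecke_group p"
| inv: "M \<in> hecke_group p \<Longrightarrow> matrix_inv M \<in> hecke_group p"

definition hyperbolic :: "real^2^2 \<Rightarrow> bool" where
  "hyperbolic M \<longleftrightarrow> \<bar>trace M\<bar> > 2"

definition matpow :: "real^2^2 \<Rightarrow> nat \<Rightarrow> real^2^2" where
  "matpow M n = (((**) M) ^^ n) (mat 1)"

text \<open>Not a proper power in \<open>G\<^sub>p\<close>, i.e. up to sign.\<close>

definition primitive :: "nat \<Rightarrow> real^2^2 \<Rightarrow> bool" where
  "primitive p M \<longleftrightarrow>
     (\<forall>N\<in>hecke_group p. \<forall>n\<ge>2. M \<noteq> matpow N n \<and> M \<noteq> - matpow N n)"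

definition moebius :: "real^2^2 \<Rightarrow> real \<Rightarrow> real" where
  "moebius M x = (M$1$1 * x + M$1$2) / (M$2$1 * x + M$2$2)"

text \<open>The first conjunct says that \<open>x\<close> is not mapped to \<open>\<infinity>\<close>.\<close>

definition moebius_fixes :: "real^2^2 \<Rightarrow> real \<Rightarrow> bool" where
  "moebius_fixes M x \<longleftrightarrow> M$2$1 * x + M$2$2 \<noteq> 0 \<and> moebius M x = x"

definition hyperbolic_fixed_point :: "nat \<Rightarrow> real \<Rightarrow> bool" where
  "hyperbolic_fixed_point p \<alpha> \<longleftrightarrow>
     (\<exists>M\<in>hecke_group p. hyperbolic M \<and> moebius_fixes M \<alpha>)"

text \<open>The fixed point other than \<open>\<alpha>\<close> of the stabilizer of \<open>\<alpha>\<close>.\<close>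

definition hecke_conj :: "nat \<Rightarrow> real \<Rightarrow> real" where
  "hecke_conj p \<alpha> = (THE \<beta>. \<beta> \<noteq> \<alpha> \<and>
     (\<forall>M\<in>hecke_group p. moebius_fixes M \<alpha> \<longrightarrow> moebius_fixes M \<beta>))"


subsection \<open>Binary quadratic forms over \<open>\<int>[\<lambda>]\<close>\<close>

text \<open>The triple \<open>(A, B, C)\<close> is the form \<open>[A, B, C]\<close>.\<close>

type_synonym bqf = "real \<times> real \<times> real"

definition Z_lambda :: "nat \<Rightarrow> real set" where
  "Z_lambda p = range (\<lambda>f :: int poly. poly (map_poly of_int f) (hecke_lambda p))"

definition lambda_bqf :: "nat \<Rightarrow> bqf \<Rightarrow> bool" where
  "lambda_bqf p = (\<lambda>(A, B, C). A \<in> Z_lambda p \<and> B \<in> Z_lambda p \<and> C \<in> Z_lambda p)"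

definition bqf_eval :: "bqf \<Rightarrow> complex \<Rightarrow> complex \<Rightarrow> complex" where
  "bqf_eval = (\<lambda>(A, B, C) x y.
     of_real A * x\<^sup>2 + of_real B * x * y + of_real C * y\<^sup>2)"

definition bqf_disc :: "bqf \<Rightarrow> real" where
  "bqf_disc = (\<lambda>(A, B, C). B\<^sup>2 - 4 * A * C)"

text \<open>\<open>(Q \<circ> M)(x, y) = Q(ax + by, cx + dy)\<close>, written out in coefficients;
  see \<open>bqf_eval_act\<close> below.\<close>

definition bqf_act :: "bqf \<Rightarrow> real^2^2 \<Rightarrow> bqf" where
  "bqf_act = (\<lambda>(A, B, C) M. let a = M$1$1; b = M$1$2; c = M$2$1; d = M$2$2 in
     (A * a\<^sup>2 + B * a * c + C * c\<^sup>2,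
      2 * A * a * b + B * (a * d + b * c) + 2 * C * c * d,
      A * b\<^sup>2 + B * b * d + C * d\<^sup>2))"

lemma bqf_eval_act:
  "bqf_eval (bqf_act Q M) x y =
     bqf_eval Q (of_real (M$1$1) * x + of_real (M$1$2) * y)
                (of_real (M$2$1) * x + of_real (M$2$2) * y)"
  by (cases Q) (simp add: bqf_eval_def bqf_act_def Let_def algebra_simps power2_eq_square)

definition bqf_class :: "nat \<Rightarrow> bqf \<Rightarrow> bqf set" where
  "bqf_class p Q = bqf_act Q ` hecke_group p"

definition M_of :: "nat \<Rightarrow> real \<Rightarrow> real^2^2" where
  "M_of p \<alpha> = (THE M. M \<in> hecke_group p \<and> hyperbolic M \<and> primitive p M \<and> trace M > 0 \<and>
     \<alpha> = (M$1$1 - M$2$2 + sqrt ((M$1$1 + M$2$2)\<^sup>2 - 4)) / (2 * M$2$1))"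

definition Q_of :: "nat \<Rightarrow> real \<Rightarrow> bqf" where
  "Q_of p \<alpha> = (let M = M_of p \<alpha> in (M$2$1, M$2$2 - M$1$1, - M$1$2))"

definition hyperbolic_form :: "nat \<Rightarrow> bqf \<Rightarrow> bool" where
  "hyperbolic_form p Q \<longleftrightarrow> (\<exists>\<alpha>. hyperbolic_fixed_point p \<alpha> \<and> Q = Q_of p \<alpha>)"

definition hyperbolic_class :: "nat \<Rightarrow> bqf set \<Rightarrow> bool" where
  "hyperbolic_class p \<A> \<longleftrightarrow>
     (\<exists>Q. lambda_bqf p Q \<and> \<A> = bqf_class p Q) \<and> (\<forall>Q\<in>\<A>. hyperbolic_form p Q)"

definition alpha_of :: "bqf \<Rightarrow> real" where
  "alpha_of Q = (case Q of (A, B, C) \<Rightarrow> (- B + sqrt (bqf_disc Q)) / (2 * A))"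

definition bqf_simple :: "bqf \<Rightarrow> bool" where
  "bqf_simple = (\<lambda>(A, B, C). A > 0 \<and> 0 > C)"

definition Z_set :: "bqf set \<Rightarrow> real set" where
  "Z_set \<A> = alpha_of ` {Q \<in> \<A>. bqf_simple Q}"


subsection \<open>Automorphic integrals with rational period functions\<close>

text \<open>A rational function in lowest terms; division by zero gives the value \<open>0\<close> at its poles.\<close>

definition rational_function :: "(complex \<Rightarrow> complex) \<Rightarrow> bool" where
  "rational_function q \<longleftrightarrow>
     (\<exists>P N. N \<noteq> 0 \<and> coprime P N \<and> q = (\<lambda>z. poly P z / poly N z))"

text \<open>\<open>a\<close> is the sequence of Fourier coefficients of \<open>F\<close>; the weight is \<open>2k\<close>.\<close>

definition entire_automorphic_integral ::
  "nat \<Rightarrow> nat \<Rightarrow> (complex \<Rightarrow> complex) \<Rightarrow> (nat \<Rightarrow> complex) \<Rightarrow> (complex \<Rightarrow> complex) \<Rightarrow> bool" where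
  "entire_automorphic_integral p k F a q \<longleftrightarrow>
     F holomorphic_on {z. Im z > 0} \<and>
     (\<forall>z. Im z > 0 \<longrightarrow>
        (\<lambda>n. a n * exp (2 * of_real pi * \<i> * of_nat n * z / of_real (hecke_lambda p))) sums F z) \<and>
     rational_function q \<and>
     (\<forall>z. Im z > 0 \<longrightarrow> F (- 1 / z) / z ^ (2 * k) = F z + q z)"

text \<open>The set of nonzero poles is closed under Hecke conjugation.\<close>

definition hecke_symmetric :: "nat \<Rightarrow> (complex \<Rightarrow> complex) \<Rightarrow> bool" where
  "hecke_symmetric p q \<longleftrightarrow>
     (\<forall>\<alpha> :: real. \<alpha> \<noteq> 0 \<and> is_pole q (of_real \<alpha>) \<longrightarrow> is_pole q (of_real (hecke_conj p \<alpha>)))"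

definition q_star ::
  "nat \<Rightarrow> nat \<Rightarrow> nat \<Rightarrow> (nat \<Rightarrow> complex) \<Rightarrow> (nat \<Rightarrow> bqf set) \<Rightarrow> complex \<Rightarrow> complex" where
  "q_star p k L d \<A> z =
     (\<Sum>l=1..L. d l * (\<Sum>\<alpha>\<in>Z_set (\<A> l). 1 / bqf_eval (Q_of p \<alpha>) z 1 ^ k))"


subsection \<open>The remainder term\<close>

text \<open>\<open>\<Phi>\<close> is the meromorphic continuation of \<open>\<integral>\<^sub>0\<^sup>\<infinity> F(iy) y\<^sup>s dy/y\<close>, an integral that
  converges in some right half-plane.\<close>

definition mellin_continuation :: "(complex \<Rightarrow> complex) \<Rightarrow> (complex \<Rightarrow> complex) \<Rightarrow> bool" where
  "mellin_continuation F \<Phi> \<longleftrightarrow>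
     \<Phi> nicely_meromorphic_on UNIV \<and>
     (\<exists>\<sigma>::real. \<forall>s. Re s > \<sigma> \<longrightarrow>
        set_integrable lborel {0<..} (\<lambda>y::real. F (\<i> * of_real y) * of_real y powr s / of_real y) \<and>
        \<Phi> s = set_lebesgue_integral lborel {0<..}
                (\<lambda>y::real. F (\<i> * of_real y) * of_real y powr s / of_real y))"

definition remainder_term :: "nat \<Rightarrow> (complex \<Rightarrow> complex) \<Rightarrow> (complex \<Rightarrow> complex) \<Rightarrow> bool" where
  "remainder_term k \<Phi> R \<longleftrightarrow>
     R nicely_meromorphic_on UNIV \<and>
     (\<forall>s. \<not> is_pole \<Phi> s \<and> \<not> is_pole \<Phi> (of_nat (2 * k) - s) \<longrightarrow>
        \<Phi> (of_nat (2 * k) - s) + \<Phi> s = R s)"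

definition hecke_R :: "nat \<Rightarrow> complex \<Rightarrow> real \<Rightarrow> real \<Rightarrow> complex" where
  "hecke_R k s a b = of_real (a - b) ^ k *
     set_lebesgue_integral lborel {0<..} (\<lambda>y::real.
       of_real y powr s / ((\<i> * of_real y - of_real a) ^ k * (\<i> * of_real y - of_real b) ^ k)
         / of_real y)"


subsection \<open>Linear combinations of the functions \<open>R(s; a, b)\<close> and the map \<open>\<rho>\<close>\<close>

text \<open>A formal linear combination; the basis element \<open>(a, b)\<close> stands for the expression
  \<open>R(s; a, b)\<close>, and \<open>R_eval\<close> is the function of \<open>s\<close> denoted by the combination.\<close>

type_synonym R_comb = "(real \<times> real) \<Rightarrow>\<^sub>0 complex"

definition R_eval :: "nat \<Rightarrow> R_comb \<Rightarrow> complex \<Rightarrow> complex" where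
  "R_eval k X s = (\<Sum>(a, b)\<in>Poly_Mapping.keys X. Poly_Mapping.lookup X (a, b) * hecke_R k s a b)"

text \<open>\<open>\<rho>(R(s; a, b)) = - R(2k - s; a - \<lambda>, b - \<lambda>)\<close>, which as an expression of the same form is
  \<open>R(s; U\<^sup>-\<^sup>1a, U\<^sup>-\<^sup>1b)\<close>; the agreement is \<open>R_eval_rho_single\<close> below.\<close>

definition rho :: "nat \<Rightarrow> R_comb \<Rightarrow> R_comb" where
  "rho p X = (\<Sum>(a, b)\<in>Poly_Mapping.keys X.
     Poly_Mapping.single
       (moebius (matrix_inv (hecke_U p)) a, moebius (matrix_inv (hecke_U p)) b)
       (Poly_Mapping.lookup X (a, b)))"

definition R_remainder ::
  "nat \<Rightarrow> nat \<Rightarrow> nat \<Rightarrow> (nat \<Rightarrow> complex) \<Rightarrow> (nat \<Rightarrow> real) \<Rightarrow> (nat \<Rightarrow> bqf set) \<Rightarrow> R_comb" where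
  "R_remainder p k L d D \<A> =
     - (\<Sum>l=1..L. \<Sum>\<alpha>\<in>Z_set (\<A> l).
          Poly_Mapping.single (\<alpha>, hecke_conj p \<alpha>) (d l * of_real (D l powr (- (real k / 2)))))"

lemma R_eval_single: "R_eval k (Poly_Mapping.single (a, b) c) s = c * hecke_R k s a b"
  by (cases "c = 0") (simp_all add: R_eval_def)

lemma R_eval_superset:
  assumes "finite K" "Poly_Mapping.keys X \<subseteq> K"
  shows "R_eval k X s = (\<Sum>(a, b)\<in>K. Poly_Mapping.lookup X (a, b) * hecke_R k s a b)"
  unfolding R_eval_def
  by (rule sum.mono_neutral_left) (use assms in \<open>auto simp: in_keys_iff\<close>)

lemma R_eval_add: "R_eval k (X + Y) s = R_eval k X s + R_eval k Y s"
proof -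
  let ?K = "Poly_Mapping.keys X \<union> Poly_Mapping.keys Y"
  have sub: "Poly_Mapping.keys (X + Y) \<subseteq> ?K"
    by (rule Poly_Mapping.keys_add)
  show ?thesis
    by (subst (1 2 3) R_eval_superset[of ?K])
       (use sub in \<open>auto simp: lookup_add algebra_simps sum.distrib[symmetric] intro!: sum.cong\<close>)
qed

lemma rho_superset:
  assumes "finite K" "Poly_Mapping.keys X \<subseteq> K"
  shows "rho p X = (\<Sum>(a, b)\<in>K. Poly_Mapping.single
       (moebius (matrix_inv (hecke_U p)) a, moebius (matrix_inv (hecke_U p)) b)
       (Poly_Mapping.lookup X (a, b)))"
  unfolding rho_def
  by (rule sum.mono_neutral_left) (use assms in \<open>auto simp: in_keys_iff\<close>)

lemma rho_add: "rho p (X + Y) = rho p X + rho p Y"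
proof -
  let ?K = "Poly_Mapping.keys X \<union> Poly_Mapping.keys Y"
  have sub: "Poly_Mapping.keys (X + Y) \<subseteq> ?K"
    by (rule Poly_Mapping.keys_add)
  show ?thesis
    by (subst (1 2 3) rho_superset[of ?K])
       (use sub in \<open>auto simp: lookup_add single_add sum.distrib[symmetric] intro!: sum.cong\<close>)
qed

lemma rho_single:
  "rho p (Poly_Mapping.single (a, b) c) = Poly_Mapping.single
     (moebius (matrix_inv (hecke_U p)) a, moebius (matrix_inv (hecke_U p)) b) c"
  by (cases "c = 0") (simp_all add: rho_def)

lemma hecke_U_eq: "hecke_U p = vector [vector [hecke_lambda p, -1], vector [1, 0]]"
  unfolding hecke_U_def hecke_S_def hecke_T_def
  by (simp add: vec_eq_iff forall_2 matrix_matrix_mult_def sum_2)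

lemma matrix_inv_hecke_U:
  "matrix_inv (hecke_U p) = vector [vector [0, 1], vector [-1, hecke_lambda p]]"
proof -
  let ?V = "vector [vector [0, 1], vector [-1, hecke_lambda p]] :: real^2^2"
  have UV: "hecke_U p ** ?V = mat 1" and VU: "?V ** hecke_U p = mat 1"
    unfolding hecke_U_eq
    by (simp_all add: vec_eq_iff forall_2 matrix_matrix_mult_def sum_2 mat_def)
  hence "matrix_inv (hecke_U p) ** hecke_U p = mat 1"
    unfolding matrix_inv_def by (rule someI2[of _ ?V, OF conjI]) auto
  hence "matrix_inv (hecke_U p) ** hecke_U p ** ?V = ?V" by simp
  thus ?thesis by (simp add: matrix_mul_assoc[symmetric] UV)
qed

lemma moebius_inv_hecke_U: "moebius (matrix_inv (hecke_U p)) x = - 1 / (x - hecke_lambda p)"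
  by (simp add: moebius_def matrix_inv_hecke_U minus_divide_left [symmetric]
        divide_minus_right [symmetric] del: divide_minus_right)

lemma integral_inversion:
  fixes f :: "real \<Rightarrow> complex"
  assumes f [measurable]: "f \<in> borel_measurable borel"
  shows "set_lebesgue_integral lborel {0<..} f =
         set_lebesgue_integral lborel {0<..} (\<lambda>y. f (1 / y) /\<^sub>R y\<^sup>2)"
proof -
  let ?g = "\<lambda>y. f (1 / y) /\<^sub>R y\<^sup>2"
  let ?h = "\<lambda>y::real. \<bar>- (1 / y\<^sup>2)\<bar> *\<^sub>R f (1 / y)"
  have gh: "?h = ?g"
    by (auto simp: fun_eq_iff divide_inverse)
  have img: "(\<lambda>y::real. 1 / y) ` {0<..} = {0<..}"
    by (force simp: image_iff intro!: bexI[of _ "1 / _"])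
  have der: "((\<lambda>y::real. 1 / y) has_field_derivative - (1 / x\<^sup>2)) (at x within {0<..})"
    if "x \<in> {0<..}" for x
    using that by (auto intro!: derivative_eq_intros simp: power2_eq_square)
  have inj: "inj_on (\<lambda>y::real. 1 / y) {0<..}"
    by (auto simp: inj_on_def)
  have meas: "{0::real<..} \<in> sets lebesgue" by simp
  have iff: "f absolutely_integrable_on {0<..} \<longleftrightarrow> ?g absolutely_integrable_on {0<..}"
    using absolutely_integrable_change_of_variables_real[OF meas der inj, of f]
    unfolding img gh .
  have borel: "set_integrable lborel {0<..} u \<longleftrightarrow> u absolutely_integrable_on {0<..}"
    if [measurable]: "u \<in> borel_measurable borel" for u :: "real \<Rightarrow> complex"
    unfolding set_integrable_def by (rule integrable_completion[symmetric]) measurable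
  have g: "?g \<in> borel_measurable borel" by measurable
  show ?thesis
  proof (cases "set_integrable lborel {0<..} f")
    case True
    hence fa: "f absolutely_integrable_on {0<..}" by (simp add: borel f)
    hence ga: "?g absolutely_integrable_on {0<..}" using iff by simp
    have "integral {0<..} ?g = integral {0<..} f"
      using has_absolute_integral_change_of_variables_real[OF meas der inj, of f "integral {0<..} f"] fa
      unfolding img gh by blast
    thus ?thesis
      using True ga borel[OF g] by (simp add: set_borel_integral_eq_integral)
  next
    case False
    hence "\<not> set_integrable lborel {0<..} ?g"
      using iff borel[OF f] borel[OF g] by simp
    thus ?thesis using False
      unfolding set_integrable_def set_lebesgue_integral_def
      by (simp add: not_integrable_integral_eq)
  qed
qed

lemma hecke_R_reflect:
  assumes "a \<noteq> 0" "b \<noteq> 0" "odd k"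
  shows "hecke_R k s (- 1 / a) (- 1 / b) = - hecke_R k (of_nat (2 * k) - s) a b"
proof -
  let ?f = "\<lambda>s a b (y::real). of_real y powr s /
     ((\<i> * of_real y - of_real a) ^ k * (\<i> * of_real y - of_real b) ^ k) / (of_real y :: complex)"
  have meas: "?f s a b \<in> borel_measurable borel" for s a b
    by measurable
  have eq: "?f (of_nat (2 * k) - s) a b (1 / y) /\<^sub>R y\<^sup>2 =
      - (1 / of_real (a * b) ^ k) * ?f s (- 1 / a) (- 1 / b) y" if y: "y > 0" for y
  proof -
    have pw: "of_real (1 / y) powr (of_nat (2 * k) - s) =
        of_real y powr s / (of_real y :: complex) ^ (2 * k)"
    proof -
      have "of_real (1 / y) powr (of_nat (2 * k) - s) =
          exp ((of_nat (2 * k) - s) * of_real (ln (1 / y)))"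
        using y by (simp add: powr_def Ln_of_real[symmetric] del: of_real_divide)
      also have "\<dots> = exp (s * of_real (ln y) - of_nat (2 * k) * of_real (ln y))"
        using y by (simp add: ln_div algebra_simps)
      also have "\<dots> = exp (s * of_real (ln y)) / exp (of_real (ln y)) ^ (2 * k)"
        by (simp only: exp_diff exp_of_nat_mult)
      also have "exp (of_real (ln y)) = (of_real y :: complex)"
        using y by (simp add: exp_of_real)
      also have "exp (s * of_real (ln y)) = of_real y powr s"
        using y by (simp add: powr_def Ln_of_real)
      finally show ?thesis .
    qed
    have lin: "\<i> * of_real (1 / y) - of_real c =
        (\<i> * of_real c / of_real y) * (\<i> * of_real y - of_real (- 1 / c))" if "c \<noteq> 0" for c
      using that y by (simp add: field_simps)
    have sq: "(\<i> * of_real a / of_real y) ^ k * (\<i> * of_real b / of_real y) ^ k =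
        - (of_real (a * b) ^ k / (of_real y :: complex) ^ (2 * k))"
    proof -
      have "(\<i> * of_real a / of_real y) ^ k * (\<i> * of_real b / of_real y) ^ k =
          (- 1 * (of_real (a * b) / (of_real y :: complex) ^ 2)) ^ k"
        by (simp add: power_mult_distrib[symmetric] power2_eq_square algebra_simps)
      also have "\<dots> = - ((of_real (a * b) / (of_real y :: complex) ^ 2) ^ k)"
        using assms(3) by (simp only: power_mult_distrib) simp
      finally show ?thesis
        by (simp add: power_divide power_mult)
    qed
    define X where
      "X = (\<i> * of_real y - of_real (- 1 / a)) ^ k * (\<i> * of_real y - of_real (- 1 / b)) ^ k"
    define P where "P = (of_real (a * b) :: complex) ^ k"
    define Y where "Y = (of_real y :: complex) ^ (2 * k)"
    have nz: "P \<noteq> 0" "Y \<noteq> 0"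
      using assms y by (auto simp: P_def Y_def)
    have den: "(\<i> * of_real (1 / y) - of_real a) ^ k * (\<i> * of_real (1 / y) - of_real b) ^ k =
        - (P / Y) * X"
      unfolding lin[OF assms(1)] lin[OF assms(2)] P_def Y_def X_def sq[symmetric] power_mult_distrib
      by (simp only: mult_ac)
    show ?thesis
      unfolding pw den X_def[symmetric] P_def[symmetric] Y_def[symmetric] using y nz
      by (simp add: scaleR_conv_of_real divide_simps power2_eq_square)
  qed
  have "set_lebesgue_integral lborel {0<..} (?f (of_nat (2 * k) - s) a b) =
      set_lebesgue_integral lborel {0<..}
        (\<lambda>y. - (1 / of_real (a * b) ^ k) * ?f s (- 1 / a) (- 1 / b) y)"
    unfolding integral_inversion[OF meas]
    by (rule set_lebesgue_integral_cong) (use eq in auto)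
  also have "\<dots> = - (1 / of_real (a * b) ^ k) *
      set_lebesgue_integral lborel {0<..} (?f s (- 1 / a) (- 1 / b))"
    by (rule set_integral_mult_right)
  finally have I: "set_lebesgue_integral lborel {0<..} (?f (of_nat (2 * k) - s) a b) = \<dots>" .
  have "of_real (- 1 / a - - 1 / b) = (of_real (a - b) / of_real (a * b) :: complex)"
    using assms by (simp add: field_simps)
  hence "of_real (- 1 / a - - 1 / b) ^ k = (of_real (a - b) ^ k / of_real (a * b) ^ k :: complex)"
    by (simp only: power_divide)
  thus ?thesis
    unfolding hecke_R_def I by simp
qed

lemma R_eval_rho_single:
  assumes "a \<noteq> hecke_lambda p" "b \<noteq> hecke_lambda p" "odd k"
  shows "R_eval k (rho p (Poly_Mapping.single (a, b) c)) s =
         c * (- hecke_R k (of_nat (2 * k) - s) (a - hecke_lambda p) (b - hecke_lambda p))"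
  unfolding rho_single R_eval_single moebius_inv_hecke_U
  by (subst hecke_R_reflect) (use assms in auto)

end

theory Submission
  imports Defs
begin

text \<open>
  Write \<open>s\<^sub>j = sin (j\<pi>/p) / sin (\<pi>/p)\<close>. The matrices \<open>- U\<^sup>j T\<close> with \<open>0 < j < p\<close> have entries
  \<open>s\<^sub>j\<close>, \<open>s\<^sub>j\<^sub>+\<^sub>1\<close>, \<open>s\<^sub>j\<^sub>-\<^sub>1\<close>, all of them \<open>0\<close> or at least \<open>1\<close>, and multiplying by one of them increases the
  sum of the entries by at least \<open>1\<close>. Since every group element is, up to sign,
  \<open>T\<^sup>\<epsilon>\<close> times such a product times a power of \<open>U\<close>, the Hecke group is discrete. Hence stabilizers of
  hyperbolic fixed points are infinite cyclic up to sign, which makes \<open>M\<^sub>\<alpha>\<close>, \<open>Q\<^sub>\<alpha>\<close> and the Hecke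
  conjugate well defined, and no form of a hyperbolic class has a vanishing outer coefficient.

  The map \<open>\<rho>\<close> acts on the root pair of a form \<open>Q\<close> as \<open>Q \<mapsto> Q \<circ> U\<close>. Going through
  \<open>Q, Q \<circ> U, Q \<circ> U\<^sup>2, \<dots>\<close> from a simple form \<open>Q\<close>, the first form \<open>Q \<circ> U\<^sup>j\<close> with negative leading
  coefficient is the negative of a simple form of the class \<open>- \<A> = \<A>\<close>. This permutes the simple forms, and as
  \<open>R(s; b, a) = - R(s; a, b)\<close> for odd \<open>k\<close> it changes the sign of the sum over a \<open>U\<close>-orbit; so the total is zero.

  The formula for the remainder term is Riemann's argument: splitting the Mellin integral at \<open>1\<close> and
  using the transformation law expresses \<open>\<Phi>\<close> on \<open>Re s > 0\<close> by holomorphic tail integrals and a rational function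
  coming from \<open>c\<^sub>0 q\<^sub>0\<close>, whose contributions at \<open>s\<close> and \<open>2k - s\<close> cancel.
\<close>



no_notation fps_nth (infixl "$" 75) \<comment> \<open>makes \<open>$\<close> ambiguous otherwise\<close>

subsection \<open>Discreteness of the Hecke groups\<close>

definition mat2 :: "real \<Rightarrow> real \<Rightarrow> real \<Rightarrow> real \<Rightarrow> real^2^2" where
  "mat2 a b c d = vector [vector [a, b], vector [c, d]]"

lemma mat2_nth [simp]: "mat2 a b c d $ 1 $ 1 = a" "mat2 a b c d $ 1 $ 2 = b"
  "mat2 a b c d $ 2 $ 1 = c" "mat2 a b c d $ 2 $ 2 = d"
  by (simp_all add: mat2_def)

lemma mat2_eq_iff [simp]: "mat2 a b c d = mat2 a' b' c' d' \<longleftrightarrow> a = a' \<and> b = b' \<and> c = c' \<and> d = d'"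
  by (metis mat2_nth)

lemma mat2_collapse: "mat2 (M$1$1) (M$1$2) (M$2$1) (M$2$2) = M"
  by (simp add: vec_eq_iff forall_2)

lemma mat2_cases: obtains a b c d where "M = mat2 a b c d"
  by (metis mat2_collapse)

lemma mat2_mult [simp]:
  "mat2 a b c d ** mat2 a' b' c' d' = mat2 (a*a'+b*c') (a*b'+b*d') (c*a'+d*c') (c*b'+d*d')"
  by (simp add: vec_eq_iff forall_2 matrix_matrix_mult_def sum_2)

lemma mat2_one: "mat 1 = mat2 1 0 0 1"
  by (simp add: vec_eq_iff forall_2 mat_def)

lemma mat2_uminus [simp]: "- mat2 a b c d = mat2 (-a) (-b) (-c) (-d)"
  by (simp add: vec_eq_iff forall_2)

lemma det_mat2 [simp]: "det (mat2 a b c d) = a * d - b * c"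
  by (simp add: det_2)

lemma trace_mat2 [simp]: "trace (mat2 a b c d) = a + d"
  by (simp add: trace_def sum_2)

lemma matrix_inv_unique_mat2:
  fixes M N :: "real^2^2"
  assumes "M ** N = mat 1" shows "matrix_inv M = N"
proof -
  have 1: "N ** M = mat 1" using assms matrix_left_right_inverse by blast
  have "matrix_inv M ** M = mat 1"
    unfolding matrix_inv_def by (rule someI2[of _ N]) (use assms 1 in auto)
  hence "matrix_inv M ** M ** N = N" by simp
  thus ?thesis by (simp add: matrix_mul_assoc[symmetric] assms)
qed

lemma matrix_inv_mat2: "a * d - b * c = 1 \<Longrightarrow> matrix_inv (mat2 a b c d) = mat2 d (-b) (-c) a"
  by (rule matrix_inv_unique_mat2) (simp add: mat2_one algebra_simps)

lemma hecke_S_mat2: "hecke_S p = mat2 1 (hecke_lambda p) 0 1"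
  and hecke_T_mat2: "hecke_T = mat2 0 (-1) 1 0"
  and hecke_U_mat2: "hecke_U p = mat2 (hecke_lambda p) (-1) 1 0"
  by (simp_all add: hecke_S_def hecke_T_def hecke_U_eq mat2_def)

lemma det_hecke: "M \<in> hecke_group p \<Longrightarrow> det M = 1"
proof (induction rule: hecke_group.induct)
  case (inv M)
  obtain a b c d where M: "M = mat2 a b c d" by (rule mat2_cases)
  show ?case using inv by (simp add: M matrix_inv_mat2 algebra_simps)
qed (simp_all add: hecke_S_mat2 hecke_T_mat2 det_mul)

lemma hecke_uminus: "M \<in> hecke_group p \<Longrightarrow> - M \<in> hecke_group p"
proof -
  assume M: "M \<in> hecke_group p"
  have "(hecke_T ** hecke_T) ** M \<in> hecke_group p"
    by (intro hecke_group.intros M)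
  moreover have "(hecke_T ** hecke_T) ** M = - M"
    by (rule mat2_cases[of M]) (simp add: hecke_T_mat2)
  ultimately show ?thesis by simp
qed

lemma hecke_U_in: "hecke_U p \<in> hecke_group p"
  unfolding hecke_U_def by (intro hecke_group.intros)

text \<open>For an integer \<open>x = j\<close> \<ge> 1 this is the Chebyshev polynomial of the
  second kind of degree \<open>j - 1\<close> at \<lambda>/2. The argument is real so that the index
  \<open>j - 1\<close> in the matrices below means -1, not 0, at \<open>j = 0\<close>.\<close>

definition sin_ratio :: "nat \<Rightarrow> real \<Rightarrow> real" where
  "sin_ratio p x = sin (x * pi / real p) / sin (pi / real p)"

lemma mult_uminus_mat:
  fixes M N :: "real^2^2"
  shows "M ** (- N) = - (M ** N)" "(- M) ** N = - (M ** N)"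
  by (rule mat2_cases[of M], rule mat2_cases[of N], simp)+

text \<open>The gap between 0 and 1 is what forces growth: this set is closed under sums and
  products, so nonzero entries of products of such matrices stay at least 1.\<close>

definition zero_or_ge1 :: "real \<Rightarrow> bool" where "zero_or_ge1 x \<longleftrightarrow> x = 0 \<or> x \<ge> 1"

lemma zero_or_ge1_intros:
  "zero_or_ge1 x \<Longrightarrow> zero_or_ge1 y \<Longrightarrow> zero_or_ge1 (x + y)"
  "zero_or_ge1 x \<Longrightarrow> zero_or_ge1 y \<Longrightarrow> zero_or_ge1 (x * y)"
  using mult_mono[of 1 x 1 y] by (auto simp: zero_or_ge1_def)

definition bounded_entries :: "real \<Rightarrow> real^2^2 \<Rightarrow> bool" where
  "bounded_entries K M \<longleftrightarrow> (\<forall>i j. \<bar>M$i$j\<bar> \<le> K)"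

lemma bounded_entries_mult:
  assumes "bounded_entries K M" "bounded_entries L N"
  shows "bounded_entries (2 * (K * L)) (M ** N)"
  unfolding bounded_entries_def
proof (intro allI)
  fix i j
  have K: "0 \<le> K" using assms(1) abs_ge_zero order_trans unfolding bounded_entries_def by blast
  have *: "\<bar>M$i$m * N$m$j\<bar> \<le> K * L" for m
    using assms K unfolding abs_mult bounded_entries_def by (intro mult_mono) auto
  have "\<bar>(M ** N)$i$j\<bar> = \<bar>M$i$1 * N$1$j + M$i$2 * N$2$j\<bar>"
    by (simp add: matrix_matrix_mult_def sum_2)
  also have "\<dots> \<le> 2 * (K * L)" using *[of 1] *[of 2] by linarith
  finally show "\<bar>(M ** N)$i$j\<bar> \<le> 2 * (K * L)" .
qed

lemma bounded_entries_uminus: "bounded_entries K (- M) \<longleftrightarrow> bounded_entries K M"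
  by (simp add: bounded_entries_def)

section \<open>Powers of \<open>U\<close> and normal forms of group elements\<close>

context
  fixes p :: nat
  assumes p3: "p \<ge> 3"
begin

lemma sin_pi_p_pos: "sin (pi / real p) > 0"
  using p3 by (intro sin_gt_zero) (auto simp: field_simps)

lemma sin_ratio_0 [simp]: "sin_ratio p 0 = 0"
  and sin_ratio_1 [simp]: "sin_ratio p 1 = 1"
  and sin_ratio_p [simp]: "sin_ratio p (real p) = 0"
  using sin_pi_p_pos p3 by (auto simp: sin_ratio_def)

lemma sin_ratio_minus: "sin_ratio p (- x) = - sin_ratio p x"
  by (simp add: sin_ratio_def)

lemma sin_ratio_plus_p: "sin_ratio p (x + real p) = - sin_ratio p x"
proof -
  have "(x + real p) * pi / real p = x * pi / real p + pi"
    using p3 by (simp add: field_simps)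
  thus ?thesis by (simp add: sin_ratio_def)
qed

text \<open>Sum-to-product formula with step pi/p. This three-term recurrence is why multiplication
  by \<open>U\<close> just shifts the index in \<open>U_power\<close>.\<close>

lemma sin_ratio_rec: "hecke_lambda p * sin_ratio p x = sin_ratio p (x + 1) + sin_ratio p (x - 1)"
proof -
  have "sin ((x + 1) * pi / real p) + sin ((x - 1) * pi / real p)
     = 2 * sin (x * pi / real p) * cos (pi / real p)"
    by (simp add: add_divide_distrib diff_divide_distrib algebra_simps sin_add sin_diff)
  thus ?thesis
    by (simp add: sin_ratio_def hecke_lambda_def add_divide_distrib[symmetric] mult_ac)
qed

text \<open>Sine increases up to pi/2 and is symmetric about it, so on [pi/p, pi - pi/p] it is
  smallest at the two end points.\<close>

lemma sin_ratio_ge_1: "1 \<le> x \<Longrightarrow> x \<le> real p - 1 \<Longrightarrow> sin_ratio p x \<ge> 1"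
proof -
  have *: "sin (pi / real p) \<le> sin y" if "pi / real p \<le> y" "y \<le> pi / 2" for y
  proof -
    have "0 \<le> pi / real p" by simp
    hence "- (pi / 2) \<le> pi / real p" using pi_gt_zero by linarith
    thus ?thesis using that by (intro sin_monotone_2pi_le) auto
  qed
  assume x: "1 \<le> x" "x \<le> real p - 1"
  have "sin (pi / real p) \<le> sin (x * pi / real p)"
  proof (cases "x * pi / real p \<le> pi / 2")
    case True
    thus ?thesis using x p3 by (intro *) (auto simp: field_simps)
  next
    case False
    have "pi - x * pi / real p = (real p - x) * pi / real p"
      using p3 by (simp add: field_simps)
    moreover have "pi / real p \<le> (real p - x) * pi / real p"
      using x p3 by (simp add: divide_right_mono)
    ultimately have "pi / real p \<le> pi - x * pi / real p" by simp
    moreover have "pi - x * pi / real p \<le> pi / 2" using False by linarith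
    ultimately have "sin (pi / real p) \<le> sin (pi - x * pi / real p)" by (rule *)
    thus ?thesis by simp
  qed
  thus ?thesis using sin_pi_p_pos by (simp add: sin_ratio_def)
qed

lemma hecke_lambda_ge_1: "hecke_lambda p \<ge> 1"
proof -
  have "sin_ratio p 2 = hecke_lambda p" using sin_ratio_rec[of 1] by simp
  thus ?thesis using sin_ratio_ge_1[of 2] p3 by simp
qed

lemma sin_ratio_bound: "\<bar>sin_ratio p x\<bar> \<le> 1 / sin (pi / real p)"
  using sin_pi_p_pos by (simp add: sin_ratio_def divide_right_mono)

text \<open>The closed form of \<open>U^j\<close>, by \<open>U_power_0\<close> and
  \<open>U_power_Suc\<close>.\<close>

definition U_power :: "nat \<Rightarrow> real^2^2" where
  "U_power j = mat2 (sin_ratio p (real j + 1)) (- sin_ratio p (real j)) (sin_ratio p (real j)) (- sin_ratio p (real j - 1))"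

text \<open>\<open>V_mat j = - (U\<^sup>j T)\<close>; see \<open>U_power_T\<close>.\<close>

definition V_mat :: "nat \<Rightarrow> real^2^2" where
  "V_mat j = mat2 (sin_ratio p (real j)) (sin_ratio p (real j + 1)) (sin_ratio p (real j - 1)) (sin_ratio p (real j))"

lemma U_power_0: "U_power 0 = mat 1"
  using sin_ratio_minus[of 1] by (simp add: U_power_def mat2_one)

lemma U_power_Suc: "U_power j ** hecke_U p = U_power (Suc j)"
  using sin_ratio_rec[of "real j + 1"] sin_ratio_rec[of "real j"]
  by (simp add: U_power_def hecke_U_mat2 algebra_simps)

lemma U_power_p: "U_power p = - mat 1"
  using sin_ratio_plus_p[of 1] sin_ratio_plus_p[of 0] sin_ratio_plus_p[of "- 1"] sin_ratio_minus[of 1]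
  by (simp add: U_power_def mat2_one add.commute)

lemma U_power_T: "U_power j ** hecke_T = - V_mat j"
  by (simp add: U_power_def hecke_T_mat2 V_mat_def)

text \<open>Words grow by one letter on the right, so that \<open>normal_form\<close> can be
  followed letter by letter. \<open>S\<close> and the inverses are recovered from
  \<open>S = - U T\<close>, \<open>U^-1 = - U^(p-1)\<close> and \<open>T^-1 = - T\<close>.\<close>

inductive_set TU_words :: "(real^2^2) set" where
  one: "mat 1 \<in> TU_words"
| U: "M \<in> TU_words \<Longrightarrow> M ** hecke_U p \<in> TU_words"
| T: "M \<in> TU_words \<Longrightarrow> M ** hecke_T \<in> TU_words"
| uminus: "M \<in> TU_words \<Longrightarrow> - M \<in> TU_words"

lemma TU_words_mult: "N \<in> TU_words \<Longrightarrow> M \<in> TU_words \<Longrightarrow> M ** N \<in> TU_words"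
  by (induction rule: TU_words.induct)
     (auto simp: matrix_mul_assoc mult_uminus_mat intro: TU_words.intros)

lemma TU_words_U_power: "U_power j \<in> TU_words"
proof (induction j)
  case 0 show ?case by (simp add: U_power_0 TU_words.one)
next
  case (Suc j) thus ?case by (metis U_power_Suc TU_words.U)
qed

text \<open>The determinant is carried through the induction because it makes
  \<open>matrix_inv M\<close> a genuine inverse of \<open>M\<close>.\<close>

lemma TU_words_inv: "M \<in> TU_words \<Longrightarrow> det M = 1 \<and> matrix_inv M \<in> TU_words"
proof (induction rule: TU_words.induct)
  case one
  show ?case by (simp add: matrix_inv_unique_mat2[of "mat 1" "mat 1"] TU_words.one)
next
  case (U M)
  obtain a b c d where M: "M = mat2 a b c d" by (rule mat2_cases)
  have Mi: "M ** matrix_inv M = mat 1" using U by (simp add: M matrix_inv_mat2 mat2_one algebra_simps)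
  have "hecke_U p ** (- U_power (p - 1)) = mat 1"
  proof -
    have "U_power (p - 1) ** hecke_U p = - mat 1" using U_power_Suc[of "p - 1"] p3 by (simp add: U_power_p)
    hence "(- U_power (p - 1)) ** hecke_U p = mat 1" by (simp add: mult_uminus_mat)
    thus ?thesis using matrix_left_right_inverse by blast
  qed
  hence "(M ** hecke_U p) ** (- U_power (p - 1) ** matrix_inv M) = mat 1"
    by (metis Mi matrix_mul_assoc matrix_mul_rid)
  hence "matrix_inv (M ** hecke_U p) = - U_power (p - 1) ** matrix_inv M" by (rule matrix_inv_unique_mat2)
  moreover have "- U_power (p - 1) ** matrix_inv M \<in> TU_words"
    using U by (intro TU_words_mult TU_words.uminus TU_words_U_power) auto
  ultimately show ?case using U by (simp add: det_mul hecke_U_mat2)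
next
  case (T M)
  obtain a b c d where M: "M = mat2 a b c d" by (rule mat2_cases)
  have Mi: "M ** matrix_inv M = mat 1" using T by (simp add: M matrix_inv_mat2 mat2_one algebra_simps)
  have "hecke_T ** (- hecke_T) = mat 1" by (simp add: hecke_T_mat2 mat2_one)
  hence "(M ** hecke_T) ** (- hecke_T ** matrix_inv M) = mat 1"
    by (metis Mi matrix_mul_assoc matrix_mul_rid)
  hence "matrix_inv (M ** hecke_T) = - hecke_T ** matrix_inv M" by (rule matrix_inv_unique_mat2)
  moreover have "- hecke_T ** matrix_inv M \<in> TU_words"
    using T TU_words.T[OF TU_words.one] by (intro TU_words_mult TU_words.uminus) auto
  ultimately show ?case using T by (simp add: det_mul hecke_T_mat2)
next
  case (uminus M)
  obtain a b c d where M: "M = mat2 a b c d" by (rule mat2_cases)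
  have "matrix_inv (- M) = - matrix_inv M"
    using uminus by (simp add: M matrix_inv_mat2)
  thus ?case using uminus by (auto simp: M intro: TU_words.uminus)
qed

lemma hecke_subset_TU_words: "M \<in> hecke_group p \<Longrightarrow> M \<in> TU_words"
proof (induction rule: hecke_group.induct)
  case S
  have "- (mat 1 ** hecke_U p ** hecke_T) \<in> TU_words" by (intro TU_words.intros)
  thus ?case by (simp add: hecke_S_mat2 hecke_U_mat2 hecke_T_mat2)
next
  case T
  show ?case using TU_words.T[OF TU_words.one] by simp
qed (auto intro: TU_words.one TU_words_mult simp: TU_words_inv)

text \<open>The index counts the factors; it is the word length that the entries will bound.\<close>

inductive V_products :: "nat \<Rightarrow> real^2^2 \<Rightarrow> bool" where
  base: "V_products 0 (mat 1)"
| step: "V_products n W \<Longrightarrow> 1 \<le> j \<Longrightarrow> j < p \<Longrightarrow> V_products (Suc n) (W ** V_mat j)"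

text \<open>Modulo sign, \<open>T\<close> has order 2 and \<open>U\<close> has order
  \<open>p\<close>. This is the alternating form of a word in them, with each block
  \<open>U^j T\<close> written as \<open>- V_mat j\<close>, an optional leading \<open>T\<close> and
  a trailing power of \<open>U\<close>.\<close>

definition normal_form :: "real^2^2 \<Rightarrow> bool" where
  "normal_form M \<longleftrightarrow> (\<exists>A n W i. (A = mat 1 \<or> A = hecke_T) \<and> V_products n W \<and> i < p \<and>
     (M = A ** W ** U_power i \<or> M = - (A ** W ** U_power i)))"

lemma normal_formI:
  "A = mat 1 \<or> A = hecke_T \<Longrightarrow> V_products n W \<Longrightarrow> i < p \<Longrightarrow>
   M = A ** W ** U_power i \<or> M = - (A ** W ** U_power i) \<Longrightarrow> normal_form M"
  unfolding normal_form_def by blast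

lemma normal_form_uminus: "normal_form M \<Longrightarrow> normal_form (- M)"
  unfolding normal_form_def by (metis add.inverse_inverse)

lemma normal_form_U:
  assumes "normal_form M" shows "normal_form (M ** hecke_U p)"
proof -
  from assms obtain A n W i where *: "A = mat 1 \<or> A = hecke_T" "V_products n W" "i < p"
    "M = A ** W ** U_power i \<or> M = - (A ** W ** U_power i)" unfolding normal_form_def by blast
  have eq: "A ** W ** U_power i ** hecke_U p = A ** W ** U_power (Suc i)"
    by (simp add: matrix_mul_assoc[symmetric] U_power_Suc)
  show ?thesis
  proof (cases "Suc i < p")
    case True
    thus ?thesis using * eq by (intro normal_formI[of A n W "Suc i"]) (auto simp: mult_uminus_mat)
  next
    case False
    \<comment> \<open>The trailing exponent has reached \<open>p\<close>: \<open>U^p = - 1\<close>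
      resets it to 0 at the cost of a sign.\<close>
    hence "Suc i = p" using *(3) by simp
    hence "A ** W ** U_power i ** hecke_U p = - (A ** W ** U_power 0)"
      unfolding eq by (simp add: U_power_p U_power_0 mult_uminus_mat)
    thus ?thesis using * p3 by (intro normal_formI[of A n W 0]) (auto simp: mult_uminus_mat)
  qed
qed

text \<open>Three cases: a trailing \<open>U^i\<close> with \<open>i > 0\<close> becomes a new
  factor; after exponent 0 a last factor \<open>V_mat j\<close> turns back into \<open>U^j\<close>;
  and if there is no factor, \<open>T\<close> meets the leading block.\<close>

lemma normal_form_T:
  assumes "normal_form M" shows "normal_form (M ** hecke_T)"
proof -
  from assms obtain A n W i where *: "A = mat 1 \<or> A = hecke_T" "V_products n W" "i < p"
    "M = A ** W ** U_power i \<or> M = - (A ** W ** U_power i)" unfolding normal_form_def by blast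
  have "normal_form (A ** W ** U_power i ** hecke_T)"
  proof (cases "i = 0")
    case False
    have "A ** W ** U_power i ** hecke_T = - (A ** (W ** V_mat i) ** U_power 0)"
      by (simp add: matrix_mul_assoc[symmetric] U_power_T mult_uminus_mat U_power_0)
    thus ?thesis using * False p3
      by (intro normal_formI[of A "Suc n" "W ** V_mat i" 0]) (auto intro: V_products.step)
  next
    case True
    from *(2) show ?thesis
    proof cases
      case base
      have TT: "hecke_T ** hecke_T = - mat 1" by (simp add: hecke_T_mat2 mat2_one)
      have "A ** W ** U_power i ** hecke_T = A ** hecke_T" using True base by (simp add: U_power_0)
      moreover have "normal_form (A ** hecke_T)"
        using *(1)
      proof
        assume "A = mat 1"
        thus ?thesis using p3 by (intro normal_formI[of hecke_T 0 "mat 1" 0]) (auto simp: U_power_0 intro: V_products.base)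
      next
        assume "A = hecke_T"
        thus ?thesis using p3 TT by (intro normal_formI[of "mat 1" 0 "mat 1" 0]) (auto simp: U_power_0 intro: V_products.base)
      qed
      ultimately show ?thesis by simp
    next
      case (step m W' j)
      have "V_mat j ** hecke_T = U_power j"
        by (simp add: V_mat_def U_power_def hecke_T_mat2)
      hence "A ** W ** U_power i ** hecke_T = A ** W' ** U_power j"
        using True step by (simp add: U_power_0 matrix_mul_assoc[symmetric])
      thus ?thesis using * step by (intro normal_formI[of A m W' j]) auto
    qed
  qed
  thus ?thesis using *(4) normal_form_uminus by (auto simp: mult_uminus_mat)
qed

lemma hecke_normal_form: "M \<in> hecke_group p \<Longrightarrow> normal_form M"
proof (drule hecke_subset_TU_words, induction rule: TU_words.induct)
  case one
  show ?case using p3 by (intro normal_formI[of "mat 1" 0 "mat 1" 0]) (auto simp: U_power_0 intro: V_products.base)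
qed (auto intro: normal_form_U normal_form_T normal_form_uminus)

text \<open>The upper right entry can vanish only at \<open>j = p - 1\<close> and the lower left one
  only at \<open>j = 1\<close>; \<open>p\<close> \<ge> 3 keeps these apart.\<close>

lemma V_mat_entries:
  assumes "1 \<le> j" "j < p"
  obtains x y z where "V_mat j = mat2 x y z x" "x \<ge> 1" "zero_or_ge1 y" "zero_or_ge1 z" "y \<ge> 1 \<or> z \<ge> 1"
proof
  show "V_mat j = mat2 (sin_ratio p (real j)) (sin_ratio p (real j + 1)) (sin_ratio p (real j - 1)) (sin_ratio p (real j))"
    by (simp add: V_mat_def)
  show "sin_ratio p (real j) \<ge> 1" using assms by (intro sin_ratio_ge_1) auto
  have *: "Suc j = p \<or> sin_ratio p (real j + 1) \<ge> 1" "j = 1 \<or> sin_ratio p (real j - 1) \<ge> 1"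
    using assms by (auto intro!: sin_ratio_ge_1)
  have **: "Suc j = p \<Longrightarrow> sin_ratio p (real j + 1) = 0" using sin_ratio_p by (metis of_nat_Suc add.commute)
  have "j = 1 \<Longrightarrow> sin_ratio p (real j - 1) = 0" by simp
  thus "zero_or_ge1 (sin_ratio p (real j + 1))" "zero_or_ge1 (sin_ratio p (real j - 1))"
    using * ** unfolding zero_or_ge1_def by blast+
  show "sin_ratio p (real j + 1) \<ge> 1 \<or> sin_ratio p (real j - 1) \<ge> 1"
    using * p3 by linarith
qed

text \<open>Appending \<open>V_mat j\<close> turns the entry sum into
  \<open>(a+b+c+d) x + (a+c) y + (b+d) z\<close>. The first summand keeps the old sum since
  \<open>x\<close> is at least 1; the rest adds at least 1, as the determinant rules out a zero
  column.\<close>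

lemma V_products_entries:
  "V_products n W \<Longrightarrow> zero_or_ge1 (W$1$1) \<and> zero_or_ge1 (W$1$2) \<and> zero_or_ge1 (W$2$1) \<and> zero_or_ge1 (W$2$2)
     \<and> det W = 1 \<and> real n \<le> W$1$1 + W$1$2 + W$2$1 + W$2$2"
proof (induction rule: V_products.induct)
  case base
  show ?case unfolding mat2_one mat2_nth det_mat2 zero_or_ge1_def by auto
next
  case (step n W j)
  obtain x y z where V: "V_mat j = mat2 x y z x" "x \<ge> 1" "zero_or_ge1 y" "zero_or_ge1 z" "y \<ge> 1 \<or> z \<ge> 1"
    using V_mat_entries[OF step.hyps(2,3)] .
  obtain a b c d where W: "W = mat2 a b c d" by (rule mat2_cases)
  from step.IH have e: "zero_or_ge1 a" "zero_or_ge1 b" "zero_or_ge1 c" "zero_or_ge1 d"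
    and dt: "a * d - b * c = 1" and n: "real n \<le> a + b + c + d" unfolding W mat2_nth det_mat2 by blast+
  have xx: "zero_or_ge1 x" using V(2) by (simp add: zero_or_ge1_def)
  have nz: "\<not> (a = 0 \<and> c = 0)" "\<not> (b = 0 \<and> d = 0)" using dt by auto
  have ac: "a + c \<ge> 1" "b + d \<ge> 1" using e nz unfolding zero_or_ge1_def by argo+
  have pos: "a \<ge> 0" "b \<ge> 0" "c \<ge> 0" "d \<ge> 0" "y \<ge> 0" "z \<ge> 0"
    using e V(3,4) unfolding zero_or_ge1_def by argo+
  have 1: "(a + b + c + d) * 1 \<le> (a + b + c + d) * x"
    using V(2) pos by (intro mult_left_mono) linarith+
  have 2: "(a + c) * y + (b + d) * z \<ge> 1"
    using V(5)
  proof
    assume "y \<ge> 1"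
    hence "1 * 1 \<le> (a + c) * y" using ac by (intro mult_mono) auto
    moreover have "0 \<le> (b + d) * z" using pos by simp
    ultimately show ?thesis by simp
  next
    assume "z \<ge> 1"
    hence "1 * 1 \<le> (b + d) * z" using ac by (intro mult_mono) auto
    moreover have "0 \<le> (a + c) * y" using pos by simp
    ultimately show ?thesis by simp
  qed
  have dV: "det (V_mat j) = 1"
  proof -
    have "det (U_power j) = 1" using TU_words_inv[OF TU_words_U_power] by simp
    hence "det (U_power j ** hecke_T) = 1" by (simp add: det_mul hecke_T_mat2)
    thus ?thesis by (simp add: U_power_T V(1))
  qed
  have s: "real (Suc n) \<le> (a*x+b*z) + (a*y+b*x) + (c*x+d*z) + (c*y+d*x)"
    using 1 2 n by (simp add: algebra_simps)
  have d: "det (W ** V_mat j) = 1" using step.IH dV by (simp add: det_mul)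
  have e': "zero_or_ge1 (a*x+b*z)" "zero_or_ge1 (a*y+b*x)" "zero_or_ge1 (c*x+d*z)" "zero_or_ge1 (c*y+d*x)"
    by (intro zero_or_ge1_intros e xx V(3,4))+
  have WV: "W ** V_mat j = mat2 (a*x+b*z) (a*y+b*x) (c*x+d*z) (c*y+d*x)" by (simp add: W V(1))
  show ?case
    using s d e' unfolding WV by (simp only: mat2_nth simp_thms)
qed

lemma finite_V_products: "finite {W. V_products n W}"
proof (induction n)
  case 0
  have "{W. V_products 0 W} \<subseteq> {mat 1}" by (auto elim: V_products.cases)
  thus ?case using finite_subset by blast
next
  case (Suc n)
  have "{W. V_products (Suc n) W} \<subseteq> (\<lambda>(W, j). W ** V_mat j) ` ({W. V_products n W} \<times> {..<p})"
    by (auto elim!: V_products.cases[of "Suc n"])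
  thus ?case using Suc finite_subset by blast
qed

text \<open>A bound on \<open>M\<close> bounds its factor \<open>W\<close>, whose entry sum is at
  least the number of its factors; so only finitely many normal forms remain.\<close>

theorem hecke_discrete: "finite {M \<in> hecke_group p. bounded_entries K M}"
proof -
  define c where "c = 1 / sin (pi / real p)"
  \<comment> \<open>Two products, by the inverse of \<open>A\<close> with entries at most 1 and by a
    power of \<open>U\<close> with entries at most \<open>c\<close>, bring a factor 2 each; 4 counts
    the entries of \<open>W\<close>.\<close>
  define N where "N = nat \<lfloor>4 * (2 * (2 * (1 * K) * c))\<rfloor>"
  let ?X = "(\<Union>n\<le>N. {W. V_products n W})"
  let ?f = "\<lambda>A W i. A ** W ** U_power i"
  have c: "bounded_entries c (U_power i)" for i
    unfolding bounded_entries_def c_def forall_2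
    using sin_ratio_bound by (simp add: U_power_def)
  have "{M \<in> hecke_group p. bounded_entries K M} \<subseteq>
     (\<lambda>(A, W, i). ?f A W i) ` ({mat 1, hecke_T} \<times> ?X \<times> {..<p}) \<union>
     (\<lambda>(A, W, i). - ?f A W i) ` ({mat 1, hecke_T} \<times> ?X \<times> {..<p})" (is "_ \<subseteq> ?R")
  proof safe
    fix M assume M: "M \<in> hecke_group p" "bounded_entries K M"
    obtain A n W i where *: "A = mat 1 \<or> A = hecke_T" "V_products n W" "i < p"
      "M = A ** W ** U_power i \<or> M = - (A ** W ** U_power i)"
      using hecke_normal_form[OF M(1)] unfolding normal_form_def by blast
    have bd: "bounded_entries K (?f A W i)" using *(4) M(2) by (auto simp: bounded_entries_uminus)
    define Ai where "Ai = (if A = mat 1 then mat 1 else - hecke_T)"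
    have Ai: "Ai ** A = mat 1" using *(1) by (auto simp: Ai_def hecke_T_mat2 mat2_one)
    have bAi: "bounded_entries 1 Ai"
      by (auto simp: Ai_def bounded_entries_def forall_2 hecke_T_mat2 mat2_one)
    have UU: "U_power i ** U_power j = U_power (i + j)" for j
      by (induction j) (simp_all add: U_power_0 U_power_Suc[symmetric] matrix_mul_assoc)
    have "Ai ** ?f A W i ** U_power (p - i) = (Ai ** A) ** W ** (U_power i ** U_power (p - i))"
      by (simp add: matrix_mul_assoc)
    also have "\<dots> = - W" using *(3) by (simp add: Ai UU U_power_p mult_uminus_mat)
    finally have "bounded_entries (2 * (2 * (1 * K) * c)) (- W)"
      using bounded_entries_mult[OF bounded_entries_mult[OF bAi bd] c] by metis
    hence W: "bounded_entries (2 * (2 * (1 * K) * c)) W" by (simp add: bounded_entries_uminus)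
    have "real n \<le> W$1$1 + W$1$2 + W$2$1 + W$2$2" using V_products_entries *(2) by blast
    also have "\<dots> \<le> 4 * (2 * (2 * (1 * K) * c))"
      using W unfolding bounded_entries_def forall_2 by linarith
    finally have "n \<le> N" unfolding N_def by linarith
    hence mem: "(A, W, i) \<in> {mat 1, hecke_T} \<times> ?X \<times> {..<p}" using * by auto
    assume n: "M \<notin> (\<lambda>(A, W, i). - ?f A W i) ` ({mat 1, hecke_T} \<times> ?X \<times> {..<p})"
    have "M \<noteq> - ?f A W i"
      using n imageI[OF mem, of "\<lambda>(A, W, i). - ?f A W i"] by (metis case_prod_conv)
    hence "M = ?f A W i" using *(4) by blast
    thus "M \<in> (\<lambda>(A, W, i). ?f A W i) ` ({mat 1, hecke_T} \<times> ?X \<times> {..<p})"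
      using imageI[OF mem, of "\<lambda>(A, W, i). ?f A W i"] by (metis case_prod_conv)
  qed
  moreover have "finite ?R" using finite_V_products by simp
  ultimately show ?thesis using finite_subset by blast
qed

end

section \<open>Discrete groups of real matrices\<close>

definition discrete_group :: "(real^2^2) set \<Rightarrow> bool" where
  "discrete_group \<Gamma> \<longleftrightarrow> (\<forall>M\<in>\<Gamma>. \<forall>N\<in>\<Gamma>. M ** N \<in> \<Gamma>) \<and> (\<forall>M\<in>\<Gamma>. det M = 1 \<and> matrix_inv M \<in> \<Gamma>) \<and>
     (\<forall>K. finite {M \<in> \<Gamma>. bounded_entries K M})"

lemma discrete_groupD:
  assumes "discrete_group \<Gamma>"
  shows "M \<in> \<Gamma> \<Longrightarrow> N \<in> \<Gamma> \<Longrightarrow> M ** N \<in> \<Gamma>" "M \<in> \<Gamma> \<Longrightarrow> det M = 1" "M \<in> \<Gamma> \<Longrightarrow> matrix_inv M \<in> \<Gamma>"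
    "finite {M \<in> \<Gamma>. bounded_entries K M}"
  using assms by (auto simp: discrete_group_def)

lemma discrete_group_hecke: "p \<ge> 3 \<Longrightarrow> discrete_group (hecke_group p)"
  unfolding discrete_group_def using hecke_discrete det_hecke by (auto intro: hecke_group.intros)

lemma ex_bounded_entries: "\<exists>K. bounded_entries K M"
proof -
  obtain a b c d where M: "M = mat2 a b c d" by (rule mat2_cases)
  show ?thesis
    by (rule exI[of _ "\<bar>a\<bar> + \<bar>b\<bar> + \<bar>c\<bar> + \<bar>d\<bar>"]) (simp add: M bounded_entries_def forall_2)
qed

lemma conj_mult:
  fixes P R X Y :: "real^2^2"
  assumes "R ** P = mat 1"
  shows "(P ** X ** R) ** (P ** Y ** R) = P ** (X ** Y) ** R"
proof -
  have "(P ** X ** R) ** (P ** Y ** R) = P ** X ** (R ** P) ** Y ** R"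
    by (simp add: matrix_mul_assoc)
  thus ?thesis by (simp add: assms matrix_mul_assoc)
qed

lemma conj_cancel:
  fixes P R X :: "real^2^2"
  assumes "R ** P = mat 1"
  shows "R ** (P ** X ** R) ** P = X"
  by (metis assms matrix_mul_assoc matrix_mul_lid matrix_mul_rid)

text \<open>Conjugation is multiplicative, keeps determinants whatever \<open>det P\<close> is, and
  enlarges entries by at most a constant factor. It allows a hyperbolic element to be made
  diagonal.\<close>

lemma discrete_group_conj:
  assumes \<Gamma>: "discrete_group \<Gamma>" and PR: "P ** R = mat 1"
  shows "discrete_group {X. P ** X ** R \<in> \<Gamma>}"
proof -
  have RP: "R ** P = mat 1" using PR matrix_left_right_inverse by blast
  have dt: "det P * det R = 1" using PR by (metis det_I det_mul)
  show ?thesis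
    unfolding discrete_group_def
  proof (intro conjI ballI allI)
    fix X Y assume "X \<in> {X. P ** X ** R \<in> \<Gamma>}" "Y \<in> {X. P ** X ** R \<in> \<Gamma>}"
    thus "X ** Y \<in> {X. P ** X ** R \<in> \<Gamma>}"
      using discrete_groupD(1)[OF \<Gamma>] conj_mult[OF RP] by (metis mem_Collect_eq)
  next
    fix X assume X: "X \<in> {X. P ** X ** R \<in> \<Gamma>}"
    hence "det (P ** X ** R) = 1" using discrete_groupD(2)[OF \<Gamma>] by blast
    hence "(det P * det R) * det X = 1" by (simp add: det_mul mult_ac)
    thus dX: "det X = 1" using dt by simp
    have iX: "X ** matrix_inv X = mat 1"
    proof -
      obtain a b c d where "X = mat2 a b c d" by (rule mat2_cases)
      thus ?thesis using dX by (simp add: matrix_inv_mat2 mat2_one algebra_simps)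
    qed
    have "(P ** X ** R) ** (P ** matrix_inv X ** R) = mat 1"
      by (simp add: conj_mult[OF RP] iX PR)
    hence "matrix_inv (P ** X ** R) = P ** matrix_inv X ** R" by (rule matrix_inv_unique_mat2)
    thus "matrix_inv X \<in> {X. P ** X ** R \<in> \<Gamma>}" using X discrete_groupD(3)[OF \<Gamma>] by force
  next
    fix K
    obtain k1 k2 where k: "bounded_entries k1 P" "bounded_entries k2 R"
      using ex_bounded_entries by meson
    define L where "L = 2 * (2 * (k1 * K) * k2)"
    have "{X \<in> {X. P ** X ** R \<in> \<Gamma>}. bounded_entries K X} \<subseteq>
       (\<lambda>M. R ** M ** P) ` {M \<in> \<Gamma>. bounded_entries L M}"
    proof
      fix X assume X: "X \<in> {X \<in> {X. P ** X ** R \<in> \<Gamma>}. bounded_entries K X}"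
      hence "bounded_entries L (P ** X ** R)"
        unfolding L_def by (intro bounded_entries_mult k) auto
      thus "X \<in> (\<lambda>M. R ** M ** P) ` {M \<in> \<Gamma>. bounded_entries L M}"
        using X conj_cancel[OF RP, of X] by (intro image_eqI[of _ _ "P ** X ** R"]) auto
    qed
    thus "finite {X \<in> {X. P ** X ** R \<in> \<Gamma>}. bounded_entries K X}"
      using discrete_groupD(4)[OF \<Gamma>] finite_subset by blast
  qed
qed

text \<open>Conjugating the unipotent part by powers of the diagonal matrix contracts it to the identity.\<close>

lemma discrete_group_no_unipotent:
  assumes \<Gamma>: "discrete_group \<Gamma>" and D: "mat2 t 0 0 u \<in> \<Gamma>" and N: "mat2 n x 0 m \<in> \<Gamma>" and t: "\<bar>t\<bar> \<noteq> 1"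
  shows "x = 0"
proof -
  \<comment> \<open>The contracting case; otherwise the inverse diagonal matrix, with
    \<open>u = 1 / t\<close>, takes over the role.\<close>
  have main: "x = 0" if D: "mat2 t 0 0 u \<in> \<Gamma>" and t: "\<bar>t\<bar> < 1" for t u
  proof (rule ccontr)
    assume x: "x \<noteq> 0"
    have tu: "t * u = 1" using discrete_groupD(2)[OF \<Gamma> D] by simp
    hence t0: "t \<noteq> 0" by auto
    have D': "mat2 u 0 0 t \<in> \<Gamma>" using discrete_groupD(3)[OF \<Gamma> D] tu by (simp add: matrix_inv_mat2)
    define K where "K = \<bar>n\<bar> + \<bar>x\<bar> + \<bar>m\<bar>"
    \<comment> \<open>\<open>f j\<close> is the conjugate of \<open>mat2 n x 0 m\<close> by the
      \<open>j\<close>-th power of the diagonal matrix. For nonzero \<open>x\<close> these are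
      distinct group elements with a common bound, which discreteness forbids.\<close>
    define f where "f = (\<lambda>j::nat. mat2 n ((t * t) ^ j * x) 0 m)"
    have f: "f j \<in> \<Gamma>" for j
    proof (induction j)
      case 0 thus ?case using N by (simp add: f_def)
    next
      case (Suc j)
      have "mat2 t 0 0 u ** f j ** mat2 u 0 0 t \<in> \<Gamma>"
        using discrete_groupD(1)[OF \<Gamma>] D D' Suc by blast
      moreover have "mat2 t 0 0 u ** f j ** mat2 u 0 0 t = f (Suc j)"
        using tu by (simp add: f_def algebra_simps)
      ultimately show ?case by simp
    qed
    have tt: "0 < t * t" "t * t < 1"
      using t t0 by (auto simp: abs_square_less_1 power2_eq_square[symmetric] zero_less_mult_iff)
    have "bounded_entries K (f j)" for j
    proof -
      have "(t * t) ^ j \<le> 1" using tt by (intro power_le_one) auto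
      hence "(t * t) ^ j * \<bar>x\<bar> \<le> 1 * \<bar>x\<bar>" by (intro mult_right_mono) auto
      thus ?thesis using tt by (simp add: f_def K_def bounded_entries_def forall_2 abs_mult power_abs)
    qed
    hence "range f \<subseteq> {M \<in> \<Gamma>. bounded_entries K M}" using f by auto
    hence "finite (range f)" using discrete_groupD(4)[OF \<Gamma>] finite_subset by blast
    moreover have "inj f"
    proof (rule injI)
      fix i j assume "f i = f j"
      hence "(t * t) ^ i = (t * t) ^ j" using x by (simp add: f_def)
      thus "i = j" using tt by (metis power_inject_exp' less_irrefl linorder_neqE_nat power_strict_decreasing)
    qed
    ultimately show False using finite_imageD by blast
  qed
  have tu: "t * u = 1" using discrete_groupD(2)[OF \<Gamma> D] by simp
  show ?thesis
  proof (cases "\<bar>t\<bar> < 1")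
    case True thus ?thesis using main D by blast
  next
    case False
    have "\<bar>t\<bar> * \<bar>u\<bar> = 1" using tu by (metis abs_mult abs_one)
    moreover have "\<bar>t\<bar> * 1 \<le> \<bar>t\<bar> * \<bar>u\<bar>" if "\<bar>u\<bar> \<ge> 1"
      using that by (intro mult_left_mono) auto
    ultimately have "\<bar>u\<bar> < 1" using False t by force
    moreover have "mat2 u 0 0 t \<in> \<Gamma>" using discrete_groupD(3)[OF \<Gamma> D] tu by (simp add: matrix_inv_mat2)
    ultimately show ?thesis using main by blast
  qed
qed

subsection \<open>Stabilizers of hyperbolic fixed points\<close>

text \<open>The columns are homogeneous coordinates of the fixed points. As a Moebius map it sends
  infinity to \<alpha> and 0 to \<beta>, so conjugation makes the stabilizer of \<alpha> upper
  triangular.\<close>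

definition fix_basis :: "real \<Rightarrow> real \<Rightarrow> real^2^2" where
  "fix_basis \<alpha> \<beta> = mat2 \<alpha> \<beta> 1 1"

definition fix_basis_inv :: "real \<Rightarrow> real \<Rightarrow> real^2^2" where
  "fix_basis_inv \<alpha> \<beta> = mat2 (1 / (\<alpha> - \<beta>)) (- \<beta> / (\<alpha> - \<beta>)) (- 1 / (\<alpha> - \<beta>)) (\<alpha> / (\<alpha> - \<beta>))"

lemma fixPR: "\<alpha> \<noteq> \<beta> \<Longrightarrow> fix_basis \<alpha> \<beta> ** fix_basis_inv \<alpha> \<beta> = mat 1"
  and fixRP: "\<alpha> \<noteq> \<beta> \<Longrightarrow> fix_basis_inv \<alpha> \<beta> ** fix_basis \<alpha> \<beta> = mat 1"
  by (simp_all add: fix_basis_def fix_basis_inv_def mat2_one diff_divide_distrib[symmetric] add_divide_distrib[symmetric])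

lemma conj_cancel_fix:
  assumes "\<alpha> \<noteq> \<beta>" shows "fix_basis \<alpha> \<beta> ** (fix_basis_inv \<alpha> \<beta> ** M ** fix_basis \<alpha> \<beta>) ** fix_basis_inv \<alpha> \<beta> = M"
  using conj_cancel[of "fix_basis \<alpha> \<beta>" "fix_basis_inv \<alpha> \<beta>" M] fixPR[OF assms] by simp

text \<open>The fixed point equation with its denominator cleared: (x, 1) is an eigenvector of
  \<open>M\<close>.\<close>

definition fixes_root :: "real^2^2 \<Rightarrow> real \<Rightarrow> bool" where
  "fixes_root M x \<longleftrightarrow> M$1$1 * x + M$1$2 = x * (M$2$1 * x + M$2$2)"

lemma fixes_root_mat2: "fixes_root (mat2 a b c d) x \<longleftrightarrow> a * x + b = x * (c * x + d)"
  by (simp add: fixes_root_def)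

text \<open>If the denominator vanished at a solution of the cleared equation, so would the
  numerator, and the matrix would be singular.\<close>

lemma moebius_fixes_iff:
  assumes "det M = 1" shows "moebius_fixes M x \<longleftrightarrow> fixes_root M x"
proof -
  obtain a b c d where M: "M = mat2 a b c d" by (rule mat2_cases)
  have "c * x + d \<noteq> 0" if "a * x + b = x * (c * x + d)"
  proof
    assume 0: "c * x + d = 0"
    hence "b = - a * x" "d = - c * x" using that by auto
    hence "a * d - b * c = 0" by simp
    thus False using assms by (simp add: M)
  qed
  thus ?thesis
    by (auto simp: M moebius_fixes_def moebius_def fixes_root_mat2 field_simps)
qed

text \<open>The first basis vector is an eigenvector with eigenvalue
  \<open>c * \<alpha> + d\<close>, which gives the first column. Determinant and trace are
  conjugation invariants, and the upper right entry measures whether (\<beta>, 1) is an eigenvector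
  too.\<close>

lemma conj_fix:
  assumes ab: "\<alpha> \<noteq> \<beta>" and det: "a * d - b * c = 1" and fx: "fixes_root (mat2 a b c d) \<alpha>"
  defines "X \<equiv> fix_basis_inv \<alpha> \<beta> ** mat2 a b c d ** fix_basis \<alpha> \<beta>"
  shows "X = mat2 (c * \<alpha> + d) (X$1$2) 0 (X$2$2)" and "(c * \<alpha> + d) * X$2$2 = 1"
    and "c * \<alpha> + d + X$2$2 = a + d" and "X$1$2 = 0 \<longleftrightarrow> fixes_root (mat2 a b c d) \<beta>"
proof -
  have X: "X = mat2 (((a * \<alpha> + b) - \<beta> * (c * \<alpha> + d)) / (\<alpha> - \<beta>)) (((a * \<beta> + b) - \<beta> * (c * \<beta> + d)) / (\<alpha> - \<beta>))
     ((\<alpha> * (c * \<alpha> + d) - (a * \<alpha> + b)) / (\<alpha> - \<beta>)) ((\<alpha> * (c * \<beta> + d) - (a * \<beta> + b)) / (\<alpha> - \<beta>))"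
    by (simp add: X_def fix_basis_def fix_basis_inv_def divide_inverse algebra_simps)
  have f: "a * \<alpha> + b = \<alpha> * (c * \<alpha> + d)" using fx by (simp add: fixes_root_mat2)
  have 1: "X$1$1 = c * \<alpha> + d" unfolding X mat2_nth f using ab by (simp add: field_simps)
  have 2: "X$2$1 = 0" unfolding X mat2_nth f by simp
  show 3: "X = mat2 (c * \<alpha> + d) (X$1$2) 0 (X$2$2)" using mat2_collapse[of X] 1 2 by simp
  have "det X = det (fix_basis_inv \<alpha> \<beta>) * det (fix_basis \<alpha> \<beta>)" using det by (simp add: X_def det_mul)
  also have "\<dots> = 1" using fixRP[OF ab] by (metis det_I det_mul)
  finally have "det X = 1" .
  thus "(c * \<alpha> + d) * X$2$2 = 1" by (subst (asm) 3) simp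
  have "((a * \<alpha> + b) - \<beta> * (c * \<alpha> + d)) + (\<alpha> * (c * \<beta> + d) - (a * \<beta> + b)) = (a + d) * (\<alpha> - \<beta>)"
    by (simp add: algebra_simps)
  hence "X$1$1 + X$2$2 = a + d" unfolding X mat2_nth add_divide_distrib[symmetric] using ab by simp
  thus "c * \<alpha> + d + X$2$2 = a + d" by (simp add: 1)
  show "X$1$2 = 0 \<longleftrightarrow> fixes_root (mat2 a b c d) \<beta>" using ab by (simp add: X fixes_root_mat2)
qed

section \<open>Fixed points of hyperbolic elements and their stabilizers\<close>

context
  fixes p :: nat
  assumes p3: "p \<ge> 3"
begin

text \<open>With \<open>c = 0\<close> the element would fix the cusp at infinity, as
  \<open>S\<close> does. A translation makes it diagonal and leaves \<open>S\<close> unchanged, so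
  \<open>discrete_group_no_unipotent\<close> would give \<lambda> = 0.\<close>

lemma hyperbolic_lower_left:
  assumes M: "mat2 a b c d \<in> hecke_group p" and h: "\<bar>a + d\<bar> > 2"
  shows "c \<noteq> 0"
proof
  assume c: "c = 0"
  have ad: "a * d = 1" using det_hecke[OF M] c by simp
  have neq: "a \<noteq> d"
  proof
    assume "a = d"
    hence "\<bar>a\<bar> * \<bar>a\<bar> = 1" using ad by (simp add: abs_mult_self_eq)
    moreover have "1 * 1 < \<bar>a\<bar> * \<bar>a\<bar>" using h \<open>a = d\<close> by (intro mult_strict_mono) auto
    ultimately show False by simp
  qed
  \<comment> \<open>The finite fixed point of \<open>z \<mapsto> (a z + b) / d\<close>; moving it to
    0 diagonalizes the matrix.\<close>
  define s where "s = b / (d - a)"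
  let ?P = "mat2 1 s 0 1" and ?R = "mat2 1 (-s) 0 1"
  have PR: "?P ** ?R = mat 1" by (simp add: mat2_one)
  let ?\<Gamma> = "{X. ?P ** X ** ?R \<in> hecke_group p}"
  have \<Gamma>: "discrete_group ?\<Gamma>" by (intro discrete_group_conj discrete_group_hecke p3 PR)
  have "s * (d - a) = b" using neq by (simp add: s_def)
  hence "?P ** mat2 a 0 0 d ** ?R = mat2 a b c d" by (simp add: c algebra_simps)
  hence 1: "mat2 a 0 0 d \<in> ?\<Gamma>" using M by simp
  have "?P ** mat2 1 (hecke_lambda p) 0 1 ** ?R = hecke_S p" by (simp add: hecke_S_mat2)
  hence 2: "mat2 1 (hecke_lambda p) 0 1 \<in> ?\<Gamma>" using hecke_group.S by (metis mem_Collect_eq)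
  have 3: "\<bar>a\<bar> \<noteq> 1"
  proof
    assume a: "\<bar>a\<bar> = 1"
    hence "\<bar>d\<bar> = 1" using ad by (metis abs_mult abs_one mult_1)
    thus False using a h by linarith
  qed
  have "hecke_lambda p = 0" by (rule discrete_group_no_unipotent[OF \<Gamma> 1 2 3])
  thus False using hecke_lambda_ge_1[OF p3] by simp
qed

text \<open>Up to sign, conjugation by \<open>T\<close> exchanges the cusps 0 and infinity, and with
  them the off-diagonal entries.\<close>

lemma hyperbolic_upper_right:
  assumes M: "mat2 a b c d \<in> hecke_group p" and h: "\<bar>a + d\<bar> > 2"
  shows "b \<noteq> 0"
proof -
  have "hecke_T ** mat2 a b c d ** hecke_T \<in> hecke_group p" by (intro hecke_group.intros M)
  hence "mat2 (-d) c b (-a) \<in> hecke_group p" by (simp add: hecke_T_mat2)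
  thus ?thesis by (rule hyperbolic_lower_left) (use h in auto)
qed

definition hyperbolic_pair :: "real \<Rightarrow> real \<Rightarrow> bool" where
  "hyperbolic_pair \<alpha> \<beta> \<longleftrightarrow> \<alpha> \<noteq> \<beta> \<and> (\<exists>M\<in>hecke_group p. hyperbolic M \<and> fixes_root M \<alpha> \<and> fixes_root M \<beta>)"

lemma hyperbolic_pair_exists:
  assumes "hyperbolic_fixed_point p \<alpha>" shows "\<exists>\<beta>. hyperbolic_pair \<alpha> \<beta>"
proof -
  obtain M where M: "M \<in> hecke_group p" "hyperbolic M" "moebius_fixes M \<alpha>"
    using assms unfolding hyperbolic_fixed_point_def by blast
  obtain a b c d where Mk: "M = mat2 a b c d" by (rule mat2_cases)
  have det: "a * d - b * c = 1" using det_hecke[OF M(1)] by (simp add: Mk)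
  have h: "\<bar>a + d\<bar> > 2" using M(2) by (simp add: hyperbolic_def Mk)
  have f: "a * \<alpha> + b = \<alpha> * (c * \<alpha> + d)"
    using M(3) moebius_fixes_iff[OF det_hecke[OF M(1)]] by (simp add: Mk fixes_root_mat2)
  have c: "c \<noteq> 0" using hyperbolic_lower_left M(1) h unfolding Mk by blast
  \<comment> \<open>Vieta: the fixed points are the roots of
    \<open>c x^2 + (d - a) x - b\<close>.\<close>
  define \<beta> where "\<beta> = (a - d) / c - \<alpha>"
  have cb: "c * \<beta> = a - d - c * \<alpha>" using c by (simp add: \<beta>_def field_simps)
  \<comment> \<open>A double root would make the discriminant \<open>(a + d)^2 - 4\<close>
    vanish.\<close>
  have "\<alpha> \<noteq> \<beta>"
  proof
    assume "\<alpha> = \<beta>"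
    hence 2: "2 * (c * \<alpha>) = a - d" using cb by (metis add.commute diff_add_cancel mult_2)
    have "c * (a * \<alpha> + b) = c * (\<alpha> * (c * \<alpha> + d))" using f by simp
    hence "a * (c * \<alpha>) + b * c = (c * \<alpha>) * (c * \<alpha>) + d * (c * \<alpha>)" by (simp add: algebra_simps)
    hence "4 * (b * c) = 4 * ((c * \<alpha>) * (c * \<alpha>) + d * (c * \<alpha>) - a * (c * \<alpha>))" by simp
    also have "\<dots> = (2 * (c * \<alpha>)) * (2 * (c * \<alpha>)) + 2 * d * (2 * (c * \<alpha>)) - 2 * a * (2 * (c * \<alpha>))"
      by (simp add: algebra_simps)
    also have "\<dots> = - ((a - d) * (a - d))" unfolding 2 by (simp add: algebra_simps)
    finally have "(a + d) * (a + d) = 4" using det by (simp add: algebra_simps)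
    moreover have "2 * 2 < \<bar>a + d\<bar> * \<bar>a + d\<bar>" using h by (intro mult_strict_mono) auto
    ultimately show False by (simp add: abs_mult_self_eq)
  qed
  moreover have "a * \<beta> + b = \<beta> * (c * \<beta> + d)"
  proof -
    have "\<beta> * (c * \<beta> + d) = \<beta> * (a - c * \<alpha>)" by (simp add: cb)
    also have "\<dots> = a * \<beta> - \<alpha> * (c * \<beta>)" by (simp add: algebra_simps)
    also have "\<dots> = a * \<beta> + b" using f unfolding cb by (simp add: algebra_simps)
    finally show ?thesis by simp
  qed
  ultimately show ?thesis using M(1,2) f unfolding hyperbolic_pair_def Mk by (metis fixes_root_mat2)
qed

text \<open>The fixed point equation is a genuine quadratic because the lower left entry is
  nonzero.\<close>

lemma fixes_at_most_two:
  assumes M: "M \<in> hecke_group p" "hyperbolic M" and f: "fixes_root M x" "fixes_root M y" "fixes_root M z"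
    and n: "x \<noteq> y" "x \<noteq> z"
  shows "y = z"
proof -
  obtain a b c d where Mk: "M = mat2 a b c d" by (rule mat2_cases)
  have c: "c \<noteq> 0" using hyperbolic_lower_left M unfolding Mk hyperbolic_def by auto
  have "(x - y) * (c * (x + y) + d - a) = 0" "(x - z) * (c * (x + z) + d - a) = 0"
    using f by (simp_all add: Mk fixes_root_mat2 algebra_simps)
  hence "c * (x + y) = c * (x + z)" using n by auto
  thus ?thesis using c by simp
qed

lemma hyperbolic_pair_diag:
  assumes h: "hyperbolic_pair \<alpha> \<beta>"
  defines "\<Gamma> \<equiv> {X. fix_basis \<alpha> \<beta> ** X ** fix_basis_inv \<alpha> \<beta> \<in> hecke_group p}"
  shows "discrete_group \<Gamma>" and "\<exists>t u. mat2 t 0 0 u \<in> \<Gamma> \<and> \<bar>t\<bar> \<noteq> 1"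
proof -
  have ab: "\<alpha> \<noteq> \<beta>" using h by (simp add: hyperbolic_pair_def)
  show "discrete_group \<Gamma>" unfolding \<Gamma>_def by (intro discrete_group_conj discrete_group_hecke p3 fixPR ab)
  obtain M where M: "M \<in> hecke_group p" "hyperbolic M" "fixes_root M \<alpha>" "fixes_root M \<beta>"
    using h unfolding hyperbolic_pair_def by blast
  obtain a b c d where Mk: "M = mat2 a b c d" by (rule mat2_cases)
  have det: "a * d - b * c = 1" using det_hecke[OF M(1)] by (simp add: Mk)
  define X where "X = fix_basis_inv \<alpha> \<beta> ** mat2 a b c d ** fix_basis \<alpha> \<beta>"
  note * = conj_fix[OF ab det M(3)[unfolded Mk], folded X_def]
  have X: "X = mat2 (c * \<alpha> + d) 0 0 (X$2$2)" using *(1,4) M(4) by (simp add: Mk)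
  have "X \<in> \<Gamma>" using M(1) conj_cancel_fix[OF ab] by (simp add: \<Gamma>_def X_def Mk)
  \<comment> \<open>The other eigenvalue is the reciprocal, so absolute value 1 would bound the
    trace by 2.\<close>
  moreover have "\<bar>c * \<alpha> + d\<bar> \<noteq> 1"
  proof
    assume 1: "\<bar>c * \<alpha> + d\<bar> = 1"
    hence "\<bar>X$2$2\<bar> = 1" using *(2) by (metis abs_mult abs_one mult_1)
    thus False using 1 *(3) M(2) by (simp add: hyperbolic_def Mk)
  qed
  ultimately show "\<exists>t u. mat2 t 0 0 u \<in> \<Gamma> \<and> \<bar>t\<bar> \<noteq> 1" using X by metis
qed

text \<open>In the basis of \<alpha> and \<beta>, an element fixing only \<alpha> would be
  triangular with a nonzero corner, next to a diagonal element with eigenvalues of absolute value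
  other than 1; \<open>discrete_group_no_unipotent\<close> excludes that.\<close>

lemma hyperbolic_pair_stabilizer:
  assumes h: "hyperbolic_pair \<alpha> \<beta>" and N: "N \<in> hecke_group p" "fixes_root N \<alpha>"
  shows "fixes_root N \<beta>"
proof -
  have ab: "\<alpha> \<noteq> \<beta>" using h by (simp add: hyperbolic_pair_def)
  obtain t u where tu: "fix_basis \<alpha> \<beta> ** mat2 t 0 0 u ** fix_basis_inv \<alpha> \<beta> \<in> hecke_group p" "\<bar>t\<bar> \<noteq> 1"
    using hyperbolic_pair_diag(2)[OF h] by blast
  obtain a b c d where Nk: "N = mat2 a b c d" by (rule mat2_cases)
  have det: "a * d - b * c = 1" using det_hecke[OF N(1)] by (simp add: Nk)
  define X where "X = fix_basis_inv \<alpha> \<beta> ** mat2 a b c d ** fix_basis \<alpha> \<beta>"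
  note * = conj_fix[OF ab det N(2)[unfolded Nk], folded X_def]
  have X: "X \<in> {X. fix_basis \<alpha> \<beta> ** X ** fix_basis_inv \<alpha> \<beta> \<in> hecke_group p}"
    using N(1) conj_cancel_fix[OF ab] by (simp add: X_def Nk)
  have "X$1$2 = 0"
  proof (rule discrete_group_no_unipotent[OF hyperbolic_pair_diag(1)[OF h] _ _ tu(2)])
    show "mat2 t 0 0 u \<in> {X. fix_basis \<alpha> \<beta> ** X ** fix_basis_inv \<alpha> \<beta> \<in> hecke_group p}" using tu(1) by simp
    show "mat2 (c * \<alpha> + d) (X$1$2) 0 (X$2$2) \<in> {X. fix_basis \<alpha> \<beta> ** X ** fix_basis_inv \<alpha> \<beta> \<in> hecke_group p}"
      using X *(1) by simp
  qed
  thus ?thesis using *(4) by (simp add: Nk)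
qed

lemma hecke_conj_hyperbolic_pair:
  assumes h: "hyperbolic_pair \<alpha> \<beta>" shows "hecke_conj p \<alpha> = \<beta>"
  unfolding hecke_conj_def
proof (rule the_equality)
  have mf: "moebius_fixes M x \<longleftrightarrow> fixes_root M x" if "M \<in> hecke_group p" for M x
    using that det_hecke moebius_fixes_iff by blast
  show "\<beta> \<noteq> \<alpha> \<and> (\<forall>M\<in>hecke_group p. moebius_fixes M \<alpha> \<longrightarrow> moebius_fixes M \<beta>)"
    using h hyperbolic_pair_stabilizer[OF h] mf by (auto simp: hyperbolic_pair_def)
  fix \<gamma> assume g: "\<gamma> \<noteq> \<alpha> \<and> (\<forall>M\<in>hecke_group p. moebius_fixes M \<alpha> \<longrightarrow> moebius_fixes M \<gamma>)"
  obtain M where M: "M \<in> hecke_group p" "hyperbolic M" "fixes_root M \<alpha>" "fixes_root M \<beta>"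
    using h unfolding hyperbolic_pair_def by blast
  hence "fixes_root M \<gamma>" using g mf by blast
  thus "\<gamma> = \<beta>" using fixes_at_most_two[OF M(1,2,3)] M(4) g h by (metis hyperbolic_pair_def)
qed

text \<open>The matrix with eigenvectors (\<alpha>, 1), (\<beta>, 1) and eigenvalues
  \<open>t\<close>, \<open>1 / t\<close>. It is multiplicative and injective in \<open>t\<close>, so
  the stabilizer can be studied as a set of real numbers.\<close>

definition stab_mat :: "real \<Rightarrow> real \<Rightarrow> real \<Rightarrow> real^2^2" where
  "stab_mat \<alpha> \<beta> t = fix_basis \<alpha> \<beta> ** mat2 t 0 0 (1 / t) ** fix_basis_inv \<alpha> \<beta>"

lemma stab_mat_mat2:
  "stab_mat \<alpha> \<beta> t = mat2 ((\<alpha> * t - \<beta> / t) / (\<alpha> - \<beta>)) (- (\<alpha> * \<beta> * (t - 1 / t)) / (\<alpha> - \<beta>))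
     ((t - 1 / t) / (\<alpha> - \<beta>)) ((\<alpha> / t - \<beta> * t) / (\<alpha> - \<beta>))"
  by (simp add: stab_mat_def fix_basis_def fix_basis_inv_def divide_inverse algebra_simps)

lemma stab_mat_mult:
  assumes "\<alpha> \<noteq> \<beta>" shows "stab_mat \<alpha> \<beta> s ** stab_mat \<alpha> \<beta> t = stab_mat \<alpha> \<beta> (s * t)"
  unfolding stab_mat_def by (simp add: conj_mult fixRP assms)

lemma stab_mat_1: "\<alpha> \<noteq> \<beta> \<Longrightarrow> stab_mat \<alpha> \<beta> 1 = mat 1"
  by (simp add: stab_mat_def mat2_one[symmetric] fixPR)

lemma stab_mat_inj:
  assumes "\<alpha> \<noteq> \<beta>" "stab_mat \<alpha> \<beta> s = stab_mat \<alpha> \<beta> t" shows "s = t"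
proof -
  have "mat2 s 0 0 (1 / s) = mat2 t 0 0 (1 / t)"
    using assms conj_cancel[OF fixRP] unfolding stab_mat_def by metis
  thus ?thesis by simp
qed

lemma stab_mat_uminus: "- stab_mat \<alpha> \<beta> t = stab_mat \<alpha> \<beta> (- t)"
  by (simp add: stab_mat_mat2 divide_inverse algebra_simps)

lemma matpow_stab_mat: "\<alpha> \<noteq> \<beta> \<Longrightarrow> matpow (stab_mat \<alpha> \<beta> t) n = stab_mat \<alpha> \<beta> (t ^ n)"
  by (induction n) (simp_all add: matpow_def stab_mat_1 stab_mat_mult)

lemma matpow_commute: "N ** matpow N n = matpow N n ** N"
proof (induction n)
  case (Suc n)
  have "matpow N (Suc n) = N ** matpow N n" by (simp add: matpow_def)
  thus ?case using Suc by (metis matrix_mul_assoc)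
qed (simp add: matpow_def)

lemma stab_mat_inverse:
  assumes "\<alpha> \<noteq> \<beta>" "t \<noteq> 0" "stab_mat \<alpha> \<beta> t \<in> hecke_group p"
  shows "stab_mat \<alpha> \<beta> (1 / t) \<in> hecke_group p"
proof -
  have "stab_mat \<alpha> \<beta> t ** stab_mat \<alpha> \<beta> (1 / t) = mat 1" using assms by (simp add: stab_mat_mult stab_mat_1)
  hence "matrix_inv (stab_mat \<alpha> \<beta> t) = stab_mat \<alpha> \<beta> (1 / t)" by (rule matrix_inv_unique_mat2)
  thus ?thesis using hecke_group.inv[OF assms(3)] by simp
qed

text \<open>A matrix commuting with a diagonal one with distinct entries is diagonal. Thus roots of
  a stabilizer element lie in the same one-parameter family.\<close>

lemma commutes_stab_mat:
  assumes ab: "\<alpha> \<noteq> \<beta>" and t: "t > 1" and c: "N ** stab_mat \<alpha> \<beta> t = stab_mat \<alpha> \<beta> t ** N" and d: "det N = 1"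
  obtains w where "N = stab_mat \<alpha> \<beta> w"
proof -
  define X where "X = fix_basis_inv \<alpha> \<beta> ** N ** fix_basis \<alpha> \<beta>"
  have N: "N = fix_basis \<alpha> \<beta> ** X ** fix_basis_inv \<alpha> \<beta>" using conj_cancel_fix[OF ab] by (simp add: X_def)
  obtain w x y z where X: "X = mat2 w x y z" by (rule mat2_cases)
  have "fix_basis \<alpha> \<beta> ** (X ** mat2 t 0 0 (1 / t)) ** fix_basis_inv \<alpha> \<beta> = fix_basis \<alpha> \<beta> ** (mat2 t 0 0 (1 / t) ** X) ** fix_basis_inv \<alpha> \<beta>"
    using c unfolding N stab_mat_def by (simp add: conj_mult fixRP ab)
  hence "X ** mat2 t 0 0 (1 / t) = mat2 t 0 0 (1 / t) ** X"
    using conj_cancel[OF fixRP[OF ab]] by metis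
  hence "x * (1 / t) = t * x" "y * t = 1 / t * y" by (simp_all add: X)
  hence "x * (t - 1 / t) = 0" "y * (t - 1 / t) = 0" by (simp_all add: algebra_simps)
  moreover have "1 / t < t" using t by (meson less_trans divide_less_eq_1_pos zero_less_one)
  ultimately have xy: "x = 0" "y = 0" by auto
  have "det X = det (fix_basis_inv \<alpha> \<beta>) * det (fix_basis \<alpha> \<beta>)" using d by (simp add: X_def det_mul)
  also have "\<dots> = 1" using fixRP[OF ab] by (metis det_I det_mul)
  finally have "w * z = 1" by (simp add: X xy)
  hence "w \<noteq> 0" "z = 1 / w" by (auto simp: eq_divide_eq mult.commute)
  hence "N = stab_mat \<alpha> \<beta> w" by (simp add: N X xy stab_mat_def)
  thus ?thesis by (rule that)
qed

text \<open>The root in the definition of \<open>M_of\<close>. For hyperbolic group elements of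
  positive trace, the sign of the square root picks the attracting fixed point, whose eigenvalue
  exceeds 1.\<close>

definition alpha_mat :: "real^2^2 \<Rightarrow> real" where
  "alpha_mat M = (M$1$1 - M$2$2 + sqrt ((M$1$1 + M$2$2)\<^sup>2 - 4)) / (2 * M$2$1)"

lemma stab_mat_props:
  assumes ab: "\<alpha> \<noteq> \<beta>" and t: "t > 1"
  shows "trace (stab_mat \<alpha> \<beta> t) = t + 1 / t" "t + 1 / t > 2" "alpha_mat (stab_mat \<alpha> \<beta> t) = \<alpha>"
proof -
  show tr: "trace (stab_mat \<alpha> \<beta> t) = t + 1 / t"
  proof -
    have "(\<alpha> * t - \<beta> / t) + (\<alpha> / t - \<beta> * t) = (\<alpha> - \<beta>) * (t + 1 / t)" by (simp add: algebra_simps diff_divide_distrib)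
    thus ?thesis using ab by (simp add: stab_mat_mat2 add_divide_distrib[symmetric])
  qed
  have u: "1 / t < t" using t by (meson less_trans divide_less_eq_1_pos zero_less_one)
  have "(t - 1) * (t - 1) > 0" using t by simp
  thus "t + 1 / t > 2" using t by (simp add: field_simps)
  define v where "v = t - 1 / t"
  have v: "v > 0" using u by (simp add: v_def)
  have "(t + 1 / t)\<^sup>2 - 4 = v\<^sup>2" using t by (simp add: v_def power2_eq_square field_simps)
  hence sq: "sqrt ((t + 1 / t)\<^sup>2 - 4) = v" using v by simp
  have d: "(stab_mat \<alpha> \<beta> t)$1$1 - (stab_mat \<alpha> \<beta> t)$2$2 = (\<alpha> + \<beta>) * v / (\<alpha> - \<beta>)"
  proof -
    have "(\<alpha> * t - \<beta> / t) - (\<alpha> / t - \<beta> * t) = (\<alpha> + \<beta>) * v"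
      by (simp add: v_def algebra_simps add_divide_distrib)
    thus ?thesis by (simp add: stab_mat_mat2 diff_divide_distrib[symmetric])
  qed
  have s: "(stab_mat \<alpha> \<beta> t)$1$1 + (stab_mat \<alpha> \<beta> t)$2$2 = t + 1 / t" using tr by (simp add: trace_def sum_2)
  have c: "(stab_mat \<alpha> \<beta> t)$2$1 = v / (\<alpha> - \<beta>)" by (simp add: stab_mat_mat2 v_def)
  have "(\<alpha> + \<beta>) * v / (\<alpha> - \<beta>) + v = 2 * \<alpha> * v / (\<alpha> - \<beta>)" using ab by (simp add: field_simps)
  thus "alpha_mat (stab_mat \<alpha> \<beta> t) = \<alpha>" unfolding alpha_mat_def s d c sq using ab v by simp
qed

lemma alpha_mat_stab_mat:
  assumes h: "hyperbolic_pair \<alpha> \<beta>" and M: "M \<in> hecke_group p" "hyperbolic M" "trace M > 0" "\<alpha> = alpha_mat M"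
  obtains t where "t > 1" "M = stab_mat \<alpha> \<beta> t"
proof -
  have ab: "\<alpha> \<noteq> \<beta>" using h by (simp add: hyperbolic_pair_def)
  obtain a b c d where Mk: "M = mat2 a b c d" by (rule mat2_cases)
  have det: "a * d - b * c = 1" using det_hecke[OF M(1)] by (simp add: Mk)
  have tr: "a + d > 2" using M(2,3) by (simp add: hyperbolic_def Mk)
  have c: "c \<noteq> 0" using hyperbolic_lower_left M(1,2) unfolding Mk hyperbolic_def by auto
  define v where "v = sqrt ((a + d)\<^sup>2 - 4)"
  have "2\<^sup>2 < (a + d)\<^sup>2" using tr by (intro power_strict_mono) auto
  hence v: "v > 0" "v * v = (a + d) * (a + d) - 4" by (simp_all add: v_def power2_eq_square)
  have al: "2 * (c * \<alpha>) = a - d + v" using c M(4) by (simp add: Mk alpha_mat_def v_def)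
  \<comment> \<open>Completing the square: \<open>4 * c\<close> times the fixed point equation is a
    polynomial in \<open>2 * (c * \<alpha>)\<close>, into which \<open>al\<close> is
    inserted.\<close>
  have "4 * (c * (\<alpha> * (c * \<alpha> + d) - (a * \<alpha> + b))) =
      (2 * (c * \<alpha>)) * (2 * (c * \<alpha>)) + 2 * (d - a) * (2 * (c * \<alpha>)) - 4 * (b * c)"
    by (simp add: algebra_simps)
  also have "\<dots> = v * v - (a - d) * (a - d) - 4 * (b * c)" unfolding al by (simp add: algebra_simps)
  also have "\<dots> = 4 * (a * d - b * c - 1)" unfolding v(2) by (simp add: algebra_simps)
  finally have f: "fixes_root (mat2 a b c d) \<alpha>" using det c by (simp add: fixes_root_mat2)
  hence fb: "fixes_root (mat2 a b c d) \<beta>" using hyperbolic_pair_stabilizer[OF h] M(1) Mk by blast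
  define X where "X = fix_basis_inv \<alpha> \<beta> ** mat2 a b c d ** fix_basis \<alpha> \<beta>"
  note * = conj_fix[OF ab det f, folded X_def]
  \<comment> \<open>The eigenvalue at \<alpha>, equal to half of the trace plus
    \<open>v\<close>.\<close>
  define t where "t = c * \<alpha> + d"
  have "2 * t = a + d + v" using al by (simp add: t_def)
  hence t: "t > 1" using tr v by simp
  have "X$2$2 = 1 / t" using *(2) t by (simp add: t_def field_simps)
  hence "X = mat2 t 0 0 (1 / t)" using *(1,4) fb by (simp add: t_def)
  hence "M = stab_mat \<alpha> \<beta> t" using conj_cancel_fix[OF ab, of "mat2 a b c d"] by (simp add: stab_mat_def X_def Mk)
  thus ?thesis using t that by blast
qed

lemma hyperbolic_pair_stab_mat:
  assumes h: "hyperbolic_pair \<alpha> \<beta>" shows "\<exists>t>1. stab_mat \<alpha> \<beta> t \<in> hecke_group p"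
proof -
  have ab: "\<alpha> \<noteq> \<beta>" using h by (simp add: hyperbolic_pair_def)
  obtain t u where tu: "fix_basis \<alpha> \<beta> ** mat2 t 0 0 u ** fix_basis_inv \<alpha> \<beta> \<in> hecke_group p" "\<bar>t\<bar> \<noteq> 1"
    using hyperbolic_pair_diag(2)[OF h] by blast
  have "t * u = 1" using discrete_groupD(2)[OF hyperbolic_pair_diag(1)[OF h], of "mat2 t 0 0 u"] tu(1) by simp
  hence t0: "t \<noteq> 0" and "u = 1 / t" by (auto simp: eq_divide_eq mult.commute)
  hence E: "stab_mat \<alpha> \<beta> t \<in> hecke_group p" using tu(1) by (simp add: stab_mat_def)
  have E': "stab_mat \<alpha> \<beta> \<bar>t\<bar> \<in> hecke_group p"
    using hecke_uminus[OF E] E stab_mat_uminus by (cases "t \<ge> 0") auto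
  show ?thesis
  proof (cases "\<bar>t\<bar> > 1")
    case True thus ?thesis using E' by blast
  next
    case False
    hence "1 / \<bar>t\<bar> > 1" using t0 tu(2) by simp
    moreover have "stab_mat \<alpha> \<beta> (1 / \<bar>t\<bar>) \<in> hecke_group p" using stab_mat_inverse[OF ab _ E'] t0 by simp
    ultimately show ?thesis by blast
  qed
qed

text \<open>By discreteness only finitely many eigenvalues lie between 1 and a given one
  \<open>K\<close>, so there is a least one.\<close>

lemma hyperbolic_pair_generator:
  assumes h: "hyperbolic_pair \<alpha> \<beta>"
  obtains \<tau> where "\<tau> > 1" "stab_mat \<alpha> \<beta> \<tau> \<in> hecke_group p"
    "\<And>t. t > 1 \<Longrightarrow> stab_mat \<alpha> \<beta> t \<in> hecke_group p \<Longrightarrow> \<tau> \<le> t"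
proof -
  have ab: "\<alpha> \<noteq> \<beta>" using h by (simp add: hyperbolic_pair_def)
  obtain K where K: "K > 1" "stab_mat \<alpha> \<beta> K \<in> hecke_group p" using hyperbolic_pair_stab_mat[OF h] by blast
  let ?H = "{t. t > 1 \<and> t \<le> K \<and> stab_mat \<alpha> \<beta> t \<in> hecke_group p}"
  let ?f = "\<lambda>t. mat2 t 0 0 (1 / t)"
  have "?f ` ?H \<subseteq> {X \<in> {X. fix_basis \<alpha> \<beta> ** X ** fix_basis_inv \<alpha> \<beta> \<in> hecke_group p}. bounded_entries K X}"
  proof safe
    fix t assume t: "1 < t" "t \<le> K" "stab_mat \<alpha> \<beta> t \<in> hecke_group p"
    show "fix_basis \<alpha> \<beta> ** mat2 t 0 0 (1 / t) ** fix_basis_inv \<alpha> \<beta> \<in> hecke_group p" using t by (simp add: stab_mat_def)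
    have "1 / t \<le> 1" using t by simp
    hence "1 / t \<le> K" using K by linarith
    thus "bounded_entries K (mat2 t 0 0 (1 / t))" using t K by (simp add: bounded_entries_def forall_2)
  qed
  hence "finite (?f ` ?H)" using discrete_groupD(4)[OF hyperbolic_pair_diag(1)[OF h]] finite_subset by blast
  hence fin: "finite ?H" by (rule finite_imageD) (auto simp: inj_on_def)
  have ne: "K \<in> ?H" using K by auto
  show ?thesis
  proof (rule that[of "Min ?H"])
    have "Min ?H \<in> ?H" using fin ne Min_in by blast
    thus "Min ?H > 1" "stab_mat \<alpha> \<beta> (Min ?H) \<in> hecke_group p" by auto
    fix t assume t: "t > 1" "stab_mat \<alpha> \<beta> t \<in> hecke_group p"
    show "Min ?H \<le> t"
    proof (cases "t \<le> K")
      case True thus ?thesis using t fin by (intro Min_le) auto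
    next
      case False
      moreover have "Min ?H \<le> K" using fin ne by (intro Min_le)
      ultimately show ?thesis by linarith
    qed
  qed
qed

text \<open>The least eigenvalue \<tau> > 1 yields the matrix: minimality makes it primitive, and
  every other candidate is a power of it.\<close>

lemma M_of_unique:
  assumes h: "hyperbolic_pair \<alpha> \<beta>"
  shows "\<exists>!M. M \<in> hecke_group p \<and> hyperbolic M \<and> primitive p M \<and> trace M > 0 \<and> \<alpha> = alpha_mat M"
proof -
  have ab: "\<alpha> \<noteq> \<beta>" using h by (simp add: hyperbolic_pair_def)
  obtain \<tau> where \<tau>: "\<tau> > 1" "stab_mat \<alpha> \<beta> \<tau> \<in> hecke_group p"
    and min: "\<And>t. t > 1 \<Longrightarrow> stab_mat \<alpha> \<beta> t \<in> hecke_group p \<Longrightarrow> \<tau> \<le> t"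
    using hyperbolic_pair_generator[OF h] by blast
  have pw: "stab_mat \<alpha> \<beta> (\<tau> ^ n) \<in> hecke_group p" for n
  proof (induction n)
    case 0 thus ?case using stab_mat_1[OF ab] hecke_group.one by simp
  next
    case (Suc n) thus ?case using hecke_group.mult[OF \<tau>(2) Suc] by (simp add: stab_mat_mult ab)
  qed
  have gen: "\<exists>n. t = \<tau> ^ n" if t: "t > 1" "stab_mat \<alpha> \<beta> t \<in> hecke_group p" for t
  proof -
    \<comment> \<open>\<open>t\<close> is bracketed between consecutive powers of \<tau>; the
      quotient \<open>t / \<tau> ^ m\<close> lies in [1, \<tau>) and minimality makes it 1.\<close>
    define n where "n = (LEAST n. t < \<tau> ^ n)"
    have ex: "\<exists>n. t < \<tau> ^ n" using \<tau> real_arch_pow by blast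
    have n: "t < \<tau> ^ n" unfolding n_def using ex by (rule LeastI_ex)
    have "n \<noteq> 0" using n t by (cases n) auto
    then obtain m where m: "n = Suc m" by (cases n) auto
    have le: "\<tau> ^ m \<le> t" using not_less_Least[of m "\<lambda>n. t < \<tau> ^ n"] m by (simp add: n_def)
    have pos: "\<tau> ^ m > 0" using \<tau> by simp
    have "stab_mat \<alpha> \<beta> (t * (1 / \<tau> ^ m)) \<in> hecke_group p"
      using hecke_group.mult[OF t(2) stab_mat_inverse[OF ab _ pw, of m]] \<tau>(1) by (simp add: stab_mat_mult ab)
    moreover have "t * (1 / \<tau> ^ m) < \<tau>" using n m pos by (simp add: field_simps)
    ultimately have "\<not> t * (1 / \<tau> ^ m) > 1" using min by fastforce
    hence "t = \<tau> ^ m" using le pos by (simp add: field_simps)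
    thus ?thesis by blast
  qed
  have prim: "primitive p (stab_mat \<alpha> \<beta> \<tau>)"
    unfolding primitive_def
  proof (intro ballI allI impI)
    fix N n assume N: "N \<in> hecke_group p" and n: "2 \<le> (n::nat)"
    show "stab_mat \<alpha> \<beta> \<tau> \<noteq> matpow N n \<and> stab_mat \<alpha> \<beta> \<tau> \<noteq> - matpow N n"
    proof (rule ccontr)
      assume "\<not> ?thesis"
      hence eq: "stab_mat \<alpha> \<beta> \<tau> = matpow N n \<or> stab_mat \<alpha> \<beta> \<tau> = - matpow N n" by blast
      \<comment> \<open>A root commutes with its power, so it is diagonal in the same basis.\<close>
      hence "N ** stab_mat \<alpha> \<beta> \<tau> = stab_mat \<alpha> \<beta> \<tau> ** N"
        using matpow_commute by (auto simp: mult_uminus_mat)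
      then obtain w where w: "N = stab_mat \<alpha> \<beta> w" using commutes_stab_mat[OF ab \<tau>(1)] det_hecke[OF N] by blast
      have "\<tau> = w ^ n \<or> \<tau> = - (w ^ n)"
        using eq stab_mat_inj[OF ab] unfolding w matpow_stab_mat[OF ab] stab_mat_uminus by blast
      hence wn: "\<bar>w\<bar> ^ n = \<tau>" using \<tau>(1) by (auto simp: power_abs[symmetric])
      have w1: "\<bar>w\<bar> > 1"
      proof (rule ccontr)
        assume "\<not> \<bar>w\<bar> > 1"
        hence "\<bar>w\<bar> ^ n \<le> 1" by (intro power_le_one) auto
        thus False using wn \<tau> by simp
      qed
      have "stab_mat \<alpha> \<beta> \<bar>w\<bar> \<in> hecke_group p"
        using hecke_uminus[OF N] N stab_mat_uminus w by (cases "w \<ge> 0") auto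
      hence "\<tau> \<le> \<bar>w\<bar>" using min w1 by blast
      moreover have "\<bar>w\<bar> ^ 1 < \<bar>w\<bar> ^ n" using w1 n by (intro power_strict_increasing) auto
      ultimately show False using wn by simp
    qed
  qed
  show ?thesis
  proof (rule ex1I)
    show "stab_mat \<alpha> \<beta> \<tau> \<in> hecke_group p \<and> hyperbolic (stab_mat \<alpha> \<beta> \<tau>) \<and> primitive p (stab_mat \<alpha> \<beta> \<tau>) \<and>
      trace (stab_mat \<alpha> \<beta> \<tau>) > 0 \<and> \<alpha> = alpha_mat (stab_mat \<alpha> \<beta> \<tau>)"
      using \<tau> prim stab_mat_props[OF ab \<tau>(1)] by (simp add: hyperbolic_def)
    fix M assume M: "M \<in> hecke_group p \<and> hyperbolic M \<and> primitive p M \<and> trace M > 0 \<and> \<alpha> = alpha_mat M"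
    then obtain t where t: "t > 1" "M = stab_mat \<alpha> \<beta> t" using alpha_mat_stab_mat[OF h] by blast
    then obtain n where n: "t = \<tau> ^ n" using gen M by blast
    have "M = matpow (stab_mat \<alpha> \<beta> \<tau>) n" by (simp add: t n matpow_stab_mat ab)
    hence "\<not> n \<ge> 2" using M \<tau>(2) unfolding primitive_def by blast
    moreover have "n \<noteq> 0" using n t by (cases n) auto
    ultimately have "n = 1" by linarith
    thus "M = stab_mat \<alpha> \<beta> \<tau>" using t n by simp
  qed
qed

text \<open>\<open>M_of p \<gamma>\<close> is a \<open>stab_mat\<close> with eigenvalue
  \<open>t > 1\<close>, so the form has leading coefficient
  \<open>(t - 1/t) / (\<gamma> - \<delta>)\<close>, roots \<gamma>, \<delta> and discriminant
  \<open>(t - 1/t)^2\<close>. The positive square root puts \<gamma> first, so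
  \<open>alpha_of\<close> inverts \<open>Q_of\<close>.\<close>

lemma hyperbolic_form_props:
  assumes "hyperbolic_form p (A, B, C)"
  defines "\<alpha> \<equiv> alpha_of (A, B, C)" and "\<beta> \<equiv> (- B - sqrt (bqf_disc (A, B, C))) / (2 * A)"
  shows "A \<noteq> 0" "C \<noteq> 0" "bqf_disc (A, B, C) > 0" "Q_of p \<alpha> = (A, B, C)" "hecke_conj p \<alpha> = \<beta>"
proof -
  obtain \<gamma> where \<gamma>: "hyperbolic_fixed_point p \<gamma>" "(A, B, C) = Q_of p \<gamma>"
    using assms(1) unfolding hyperbolic_form_def by blast
  obtain \<delta> where h: "hyperbolic_pair \<gamma> \<delta>" using hyperbolic_pair_exists[OF \<gamma>(1)] by blast
  have ab: "\<gamma> \<noteq> \<delta>" using h by (simp add: hyperbolic_pair_def)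
  have M: "M_of p \<gamma> \<in> hecke_group p \<and> hyperbolic (M_of p \<gamma>) \<and> primitive p (M_of p \<gamma>) \<and>
      trace (M_of p \<gamma>) > 0 \<and> \<gamma> = alpha_mat (M_of p \<gamma>)"
    unfolding M_of_def using theI'[OF M_of_unique[OF h]] unfolding alpha_mat_def by blast
  then obtain t where t: "t > 1" "M_of p \<gamma> = stab_mat \<gamma> \<delta> t" using alpha_mat_stab_mat[OF h] by blast
  define v where "v = t - 1 / t"
  have v: "v > 0" using t(1) unfolding v_def by (simp add: less_trans[of _ 1])
  have A: "A = v / (\<gamma> - \<delta>)" and C: "C = A * (\<gamma> * \<delta>)" and B: "B = - A * (\<gamma> + \<delta>)"
  proof -
    have "(\<gamma> / t - \<delta> * t) - (\<gamma> * t - \<delta> / t) = - v * (\<gamma> + \<delta>)"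
      by (simp add: v_def algebra_simps add_divide_distrib)
    thus "A = v / (\<gamma> - \<delta>)" "C = A * (\<gamma> * \<delta>)" "B = - A * (\<gamma> + \<delta>)"
      using \<gamma>(2) by (simp_all add: Q_of_def Let_def t stab_mat_mat2 v_def[symmetric] diff_divide_distrib[symmetric])
  qed
  show A0: "A \<noteq> 0" using v ab by (simp add: A)
  have "(M_of p \<gamma>)$1$2 \<noteq> 0"
    using M hyperbolic_upper_right[of "(M_of p \<gamma>)$1$1" "(M_of p \<gamma>)$1$2" "(M_of p \<gamma>)$2$1" "(M_of p \<gamma>)$2$2"]
    unfolding mat2_collapse hyperbolic_def trace_def sum_2 by blast
  thus "C \<noteq> 0" using \<gamma>(2) by (simp add: Q_of_def Let_def)
  have Av: "A * (\<gamma> - \<delta>) = v" using ab by (simp add: A)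
  have "bqf_disc (A, B, C) = (A * (\<gamma> - \<delta>))\<^sup>2"
    by (simp add: bqf_disc_def B C power2_eq_square algebra_simps)
  hence disc: "bqf_disc (A, B, C) = v\<^sup>2" using Av by simp
  thus "bqf_disc (A, B, C) > 0" using v by simp
  have sq: "sqrt (bqf_disc (A, B, C)) = A * (\<gamma> - \<delta>)" using disc v Av by simp
  have "\<alpha> = \<gamma>" unfolding \<alpha>_def alpha_of_def prod.case sq using A0 by (simp add: B algebra_simps)
  moreover have "\<beta> = \<delta>" unfolding \<beta>_def sq using A0 by (simp add: B algebra_simps)
  ultimately show "Q_of p \<alpha> = (A, B, C)" "hecke_conj p \<alpha> = \<beta>"
    using \<gamma>(2) hecke_conj_hyperbolic_pair[OF h] by auto
qed

end

subsection \<open>Simple forms and the action of \<open>U\<close>\<close>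

definition conj_root :: "bqf \<Rightarrow> real" where
  "conj_root Q = (case Q of (A, B, C) \<Rightarrow> (- B - sqrt (bqf_disc Q)) / (2 * A))"

lemma bqf_act_mult: "bqf_act (bqf_act Q M) N = bqf_act Q (M ** N)"
  by (cases Q, rule mat2_cases[of M], rule mat2_cases[of N])
     (simp add: bqf_act_def Let_def power2_eq_square algebra_simps)

lemma bqf_act_one: "bqf_act Q (mat 1) = Q"
  by (cases Q) (simp add: bqf_act_def Let_def mat2_one)

lemma bqf_act_uminus: "bqf_act (- Q) M = - bqf_act Q M"
  by (cases Q) (simp add: bqf_act_def Let_def algebra_simps)

lemma bqf_act_minus_mat: "bqf_act Q (- M) = bqf_act Q M"
  by (cases Q) (simp add: bqf_act_def Let_def)

lemma bqf_disc_act: "det M = 1 \<Longrightarrow> bqf_disc (bqf_act Q M) = bqf_disc Q"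
proof -
  assume d: "det M = 1"
  obtain a b c e where M: "M = mat2 a b c e" by (rule mat2_cases)
  obtain A B C where Q: "Q = (A, B, C)" by (cases Q)
  have "bqf_disc (bqf_act Q M) = (a * e - b * c)\<^sup>2 * bqf_disc Q"
    by (simp add: Q M bqf_act_def Let_def bqf_disc_def power2_eq_square algebra_simps)
  thus ?thesis using d by (simp add: M)
qed

text \<open>Sum and difference determine the roots together with their order, because
  \<open>A * (x - y)\<close> has to be the nonnegative square root.\<close>

lemma roots_eqI:
  assumes "A \<noteq> 0" "A * (x - y) = sqrt (bqf_disc (A, B, C))" "A * (x + y) = - B"
  shows "alpha_of (A, B, C) = x" "conj_root (A, B, C) = y"
proof -
  have "- B + sqrt (bqf_disc (A, B, C)) = 2 * A * x" "- B - sqrt (bqf_disc (A, B, C)) = 2 * A * y"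
    unfolding assms(2,3)[symmetric] by (simp_all add: algebra_simps)
  thus "alpha_of (A, B, C) = x" "conj_root (A, B, C) = y"
    using assms(1) by (simp_all add: alpha_of_def conj_root_def)
qed

lemma roots_props:
  assumes "A \<noteq> 0" "bqf_disc (A, B, C) \<ge> 0"
  defines "x \<equiv> alpha_of (A, B, C)" and "y \<equiv> conj_root (A, B, C)"
  shows "A * (x - y) = sqrt (bqf_disc (A, B, C))" "A * (x + y) = - B" "A * (x * y) = C"
proof -
  define r where "r = sqrt (bqf_disc (A, B, C))"
  have x: "x = (- B + r) / (2 * A)" and y: "y = (- B - r) / (2 * A)"
    by (simp_all add: x_def y_def r_def alpha_of_def conj_root_def)
  have rr: "r * r = B * B - 4 * A * C"
    using assms(2) by (simp add: r_def bqf_disc_def power2_eq_square)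
  show "A * (x - y) = sqrt (bqf_disc (A, B, C))" "A * (x + y) = - B"
    unfolding r_def[symmetric] x y using assms(1) by (simp_all add: field_simps)
  have "x * y = (B * B - r * r) / (4 * A * A)" unfolding x y by (simp add: algebra_simps)
  thus "A * (x * y) = C" using assms(1) by (simp add: rr)
qed

text \<open>Negation changes the sign of the denominator but not of the square root. This exchange
  is the source of the sign by which the orbit sums cancel.\<close>

lemma alpha_of_uminus: "alpha_of (- Q) = conj_root Q" "conj_root (- Q) = alpha_of Q"
proof -
  obtain A B C where Q: "Q = (A, B, C)" by (cases Q)
  have d: "bqf_disc (- A, - B, - C) = bqf_disc (A, B, C)" by (simp add: bqf_disc_def)
  have e: "(B + r) / - (2 * A) = (- B - r) / (2 * A)" "(B - r) / - (2 * A) = (- B + r) / (2 * A)" for r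
    by (simp_all add: minus_divide_left[symmetric] minus_divide_right[symmetric] diff_divide_distrib add_divide_distrib)
  show "alpha_of (- Q) = conj_root Q" "conj_root (- Q) = alpha_of Q"
    using e[of "sqrt (bqf_disc (A, B, C))"] by (simp_all add: Q alpha_of_def conj_root_def d add.commute)
qed

text \<open>The discriminant is invariant, and its square root \<open>A * (x - y)\<close> is
  reproduced by the new leading coefficient and \<open>1 / (\<lambda> - x)\<close>,
  \<open>1 / (\<lambda> - y)\<close>. So the order of the roots is carried over along with the
  pair.\<close>

lemma roots_act_U:
  assumes A: "A \<noteq> 0" and D: "bqf_disc (A, B, C) \<ge> 0"
    and A': "fst (bqf_act (A, B, C) (hecke_U p)) \<noteq> 0"
  shows "alpha_of (bqf_act (A, B, C) (hecke_U p)) = moebius (matrix_inv (hecke_U p)) (alpha_of (A, B, C))"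
    "conj_root (bqf_act (A, B, C) (hecke_U p)) = moebius (matrix_inv (hecke_U p)) (conj_root (A, B, C))"
proof -
  define l where "l = hecke_lambda p"
  define x where "x = alpha_of (A, B, C)"
  define y where "y = conj_root (A, B, C)"
  note r = roots_props[OF A D, folded x_def y_def]
  define A1 where "A1 = A * l\<^sup>2 + B * l + C"
  have act: "bqf_act (A, B, C) (hecke_U p) = (A1, - (2 * A * l) - B, A)"
    by (simp add: bqf_act_def Let_def hecke_U_mat2 l_def A1_def)
  have BC: "B = - (A * (x + y))" "C = A * (x * y)" using r by simp_all
  \<comment> \<open>The new leading coefficient is the value of the form at (\<lambda>, 1); its
    nonvanishing keeps both roots off the pole of \<open>U^-1\<close>.\<close>
  have A1: "A1 = A * ((l - x) * (l - y))" by (simp add: A1_def BC power2_eq_square algebra_simps)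
  have nz: "l - x \<noteq> 0" "l - y \<noteq> 0" using A' by (auto simp: act A1)
  have "det (hecke_U p) = 1" by (simp add: hecke_U_mat2)
  hence d: "bqf_disc (A1, - (2 * A * l) - B, A) = bqf_disc (A, B, C)"
    using bqf_disc_act[of "hecke_U p" "(A, B, C)"] by (simp add: act)
  have m: "- 1 / (z - l) = 1 / (l - z)" for z by (metis minus_diff_eq minus_divide_divide minus_minus)
  have *: "A * (X * Y) * (1 / X - 1 / Y) = A * (Y - X)" "A * (X * Y) * (1 / X + 1 / Y) = A * (Y + X)"
    if "X \<noteq> 0" "Y \<noteq> 0" for X Y using that by (simp_all add: field_simps)
  have e1: "A1 * (1 / (l - x) - 1 / (l - y)) = A * (x - y)" unfolding A1 *(1)[OF nz] by simp
  have e2: "A1 * (1 / (l - x) + 1 / (l - y)) = - (- (2 * A * l) - B)"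
    unfolding A1 *(2)[OF nz] BC by (simp add: algebra_simps)
  show "alpha_of (bqf_act (A, B, C) (hecke_U p)) = moebius (matrix_inv (hecke_U p)) (alpha_of (A, B, C))"
    "conj_root (bqf_act (A, B, C) (hecke_U p)) = moebius (matrix_inv (hecke_U p)) (conj_root (A, B, C))"
    using roots_eqI[of A1 "1 / (l - x)" "1 / (l - y)" "- (2 * A * l) - B" A] A' e1 e2 r(1)
    unfolding act moebius_inv_hecke_U l_def[symmetric] x_def[symmetric] y_def[symmetric] m d
    by simp_all
qed

lemma hecke_R_swap: "odd k \<Longrightarrow> hecke_R k s b a = - hecke_R k s a b"
proof -
  assume k: "odd k"
  have "complex_of_real (b - a) ^ k = - (complex_of_real (a - b) ^ k)"
    using k by (metis minus_diff_eq of_real_minus power_minus_odd)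
  thus ?thesis by (simp add: hecke_R_def mult.commute)
qed

section \<open>Linearity of evaluation and of \<open>rho\<close>\<close>

lemma R_eval_0: "R_eval k 0 s = 0"
  by (simp add: R_eval_def)

lemma R_eval_sum: "R_eval k (\<Sum>i\<in>I. X i) s = (\<Sum>i\<in>I. R_eval k (X i) s)"
  by (induction I rule: infinite_finite_induct) (simp_all add: R_eval_0 R_eval_add)

lemma R_eval_uminus: "R_eval k (- X) s = - R_eval k X s"
  using R_eval_add[of k X "- X" s] by (simp add: R_eval_0 add_eq_0_iff)

lemma rho_0: "rho p 0 = 0"
  by (simp add: rho_def)

lemma rho_sum: "rho p (\<Sum>i\<in>I. X i) = (\<Sum>i\<in>I. rho p (X i))"
  by (induction I rule: infinite_finite_induct) (simp_all add: rho_0 rho_add)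

lemma rho_uminus: "rho p (- X) = - rho p X"
  using rho_add[of p X "- X"] by (simp add: rho_0 add_eq_0_iff)

lemma rho_pow_sum: "(rho p ^^ j) (\<Sum>i\<in>I. X i) = (\<Sum>i\<in>I. (rho p ^^ j) (X i))"
  by (induction j) (simp_all add: rho_sum)

lemma rho_pow_uminus: "(rho p ^^ j) (- X) = - (rho p ^^ j) X"
  by (induction j) (simp_all add: rho_uminus)

definition simples :: "bqf set \<Rightarrow> bqf set" where
  "simples \<A> = {Q \<in> \<A>. bqf_simple Q}"

abbreviation U_act :: "nat \<Rightarrow> bqf \<Rightarrow> bqf" where
  "U_act p Q \<equiv> bqf_act Q (hecke_U p)"

section \<open>Permuting the simple forms of a class equal to its negative\<close>

locale symmetric_class =
  fixes p :: nat and \<A> :: "bqf set"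
  assumes p3: "p \<ge> 3" and hyp: "hyperbolic_class p \<A>" and neg: "\<A> = uminus ` \<A>"
begin

lemma uminus_mem: "Q \<in> \<A> \<Longrightarrow> - Q \<in> \<A>"
  using neg by blast

lemma act_mem: "Q \<in> \<A> \<Longrightarrow> M \<in> hecke_group p \<Longrightarrow> bqf_act Q M \<in> \<A>"
proof -
  assume Q: "Q \<in> \<A>" and M: "M \<in> hecke_group p"
  obtain Q0 where Q0: "\<A> = bqf_class p Q0" using hyp by (auto simp: hyperbolic_class_def)
  then obtain N where N: "N \<in> hecke_group p" "Q = bqf_act Q0 N" using Q by (auto simp: bqf_class_def)
  have "bqf_act Q M = bqf_act Q0 (N ** M)" by (simp add: N bqf_act_mult)
  thus ?thesis using hecke_group.mult[OF N(1) M] by (auto simp: Q0 bqf_class_def)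
qed

lemma form_props:
  assumes "Q \<in> \<A>"
  shows "fst Q \<noteq> 0" "snd (snd Q) \<noteq> 0" "bqf_disc Q > 0" "Q_of p (alpha_of Q) = Q"
    "hecke_conj p (alpha_of Q) = conj_root Q"
proof -
  obtain A B C where Q: "Q = (A, B, C)" by (cases Q)
  have h: "hyperbolic_form p (A, B, C)" using assms hyp by (simp add: hyperbolic_class_def Q)
  show "fst Q \<noteq> 0" "snd (snd Q) \<noteq> 0" "bqf_disc Q > 0" "Q_of p (alpha_of Q) = Q"
    "hecke_conj p (alpha_of Q) = conj_root Q"
    using hyperbolic_form_props[OF p3 h] by (simp_all add: Q conj_root_def)
qed

lemma alpha_of_inj: "inj_on alpha_of (simples \<A>)"
  by (rule inj_onI) (metis (no_types, lifting) form_props(4) mem_Collect_eq simples_def)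

text \<open>Moves sums from roots to forms, where \<open>U\<close> acts; \<open>Q_of p\<close>
  inverts \<open>alpha_of\<close> on the class. The three arguments of \<open>g\<close> cover the
  summands of both \<open>q_star\<close> and \<open>R_remainder\<close>.\<close>

lemma sum_Z_set:
  "(\<Sum>\<alpha>\<in>Z_set \<A>. g \<alpha> (Q_of p \<alpha>) (hecke_conj p \<alpha>)) = (\<Sum>Q\<in>simples \<A>. g (alpha_of Q) Q (conj_root Q))"
proof -
  have "(\<Sum>\<alpha>\<in>Z_set \<A>. g \<alpha> (Q_of p \<alpha>) (hecke_conj p \<alpha>)) =
      (\<Sum>Q\<in>simples \<A>. g (alpha_of Q) (Q_of p (alpha_of Q)) (hecke_conj p (alpha_of Q)))"
    unfolding Z_set_def simples_def[symmetric] by (subst sum.reindex[OF alpha_of_inj]) simp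
  also have "\<dots> = (\<Sum>Q\<in>simples \<A>. g (alpha_of Q) Q (conj_root Q))"
    by (rule sum.cong) (auto simp: simples_def form_props)
  finally show ?thesis .
qed

lemma U_act_mem: "Q \<in> \<A> \<Longrightarrow> (U_act p ^^ j) Q \<in> \<A>"
  by (induction j) (auto intro: act_mem hecke_U_in)

lemma U_act_pow: "(U_act p ^^ j) Q = bqf_act Q (U_power p j)"
  by (induction j) (simp_all add: U_power_0[OF p3] bqf_act_one bqf_act_mult U_power_Suc[OF p3])

lemma U_act_period: "(U_act p ^^ p) Q = Q"
  by (simp add: U_act_pow U_power_p[OF p3] bqf_act_minus_mat bqf_act_one)

lemma U_act_inj: "inj (U_act p ^^ j)"
proof -
  have "inj (U_act p)"
  proof (rule injI)
    fix Q Q' assume "U_act p Q = U_act p Q'"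
    hence "(U_act p ^^ Suc (p - 1)) Q = (U_act p ^^ Suc (p - 1)) Q'" by (simp only: funpow_Suc_right o_apply)
    thus "Q = Q'" using p3 U_act_period by (simp del: funpow.simps)
  qed
  thus ?thesis by (rule inj_fn)
qed

text \<open>The link between consecutive forms of an orbit: where the leading coefficient changes
  sign, the new form has outer coefficients of opposite signs.\<close>

lemma U_act_last: "snd (snd (U_act p Q)) = fst Q"
  by (cases Q) (simp add: bqf_act_def Let_def hecke_U_mat2)

lemma U_act_pow_uminus: "(U_act p ^^ j) (- Q) = - (U_act p ^^ j) Q"
  by (induction j) (simp_all add: bqf_act_uminus)

text \<open>All forms of the orbit stay in the class, so their leading coefficients are nonzero and
  \<open>roots_act_U\<close> applies at each step.\<close>

lemma rho_pow_single:
  assumes "Q \<in> \<A>"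
  shows "(rho p ^^ j) (Poly_Mapping.single (alpha_of Q, conj_root Q) c) =
    Poly_Mapping.single (alpha_of ((U_act p ^^ j) Q), conj_root ((U_act p ^^ j) Q)) c"
proof (induction j)
  case (Suc j)
  let ?Q = "(U_act p ^^ j) Q"
  obtain A B C where Q: "?Q = (A, B, C)" by (cases ?Q)
  have m: "?Q \<in> \<A>" "(U_act p ^^ Suc j) Q \<in> \<A>" using U_act_mem[OF assms] by blast+
  have "A \<noteq> 0" "bqf_disc (A, B, C) \<ge> 0" using form_props[OF m(1)] by (simp_all add: Q)
  moreover have "fst (U_act p (A, B, C)) \<noteq> 0" using form_props(1)[OF m(2)] by (simp add: Q)
  ultimately show ?case using Suc by (simp add: rho_single Q roots_act_U)
qed simp

text \<open>The cyclic sequence of leading coefficients of the \<open>Q \<circ> U\<^sup>j\<close> turns negative for the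
  first time at \<open>j = flip_index Q\<close>, and there \<open>- (Q \<circ> U\<^sup>j)\<close> is simple.\<close>

definition flip_index :: "bqf \<Rightarrow> nat" where
  "flip_index Q = (LEAST j. fst ((U_act p ^^ j) Q) < 0)"

definition flip :: "bqf \<Rightarrow> bqf" where
  "flip Q = - (U_act p ^^ flip_index Q) Q"

lemma flip_index:
  assumes Q: "Q \<in> simples \<A>"
  shows "fst ((U_act p ^^ flip_index Q) Q) < 0" and "j < flip_index Q \<Longrightarrow> fst ((U_act p ^^ j) Q) > 0"
    and "flip_index Q > 0"
proof -
  have QA: "Q \<in> \<A>" and s: "bqf_simple Q" using Q by (auto simp: simples_def)
  \<comment> \<open>A full turn leads back to \<open>Q\<close>, so the leading coefficient at index
    \<open>p - 1\<close> is the negative last coefficient of \<open>Q\<close>. Hence the minimum in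
    \<open>flip_index\<close> is attained.\<close>
  have "snd (snd ((U_act p ^^ Suc (p - 1)) Q)) = fst ((U_act p ^^ (p - 1)) Q)"
    by (simp add: U_act_last)
  hence "fst ((U_act p ^^ (p - 1)) Q) = snd (snd Q)" using p3 U_act_period by (simp del: funpow.simps)
  hence "fst ((U_act p ^^ (p - 1)) Q) < 0" using s by (simp add: bqf_simple_def split: prod.splits)
  thus 1: "fst ((U_act p ^^ flip_index Q) Q) < 0" unfolding flip_index_def by (rule LeastI)
  have "fst Q > 0" using s by (simp add: bqf_simple_def split: prod.splits)
  thus "flip_index Q > 0" using 1 by (cases "flip_index Q") auto
  show "fst ((U_act p ^^ j) Q) > 0" if "j < flip_index Q"
    using not_less_Least[OF that[unfolded flip_index_def]] form_props(1)[OF U_act_mem[OF QA, of j]] by linarith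
qed

lemma flip_mem:
  assumes Q: "Q \<in> simples \<A>" shows "flip Q \<in> simples \<A>"
proof -
  have QA: "Q \<in> \<A>" using Q by (auto simp: simples_def)
  obtain i where i: "flip_index Q = Suc i" using flip_index(3)[OF Q] by (cases "flip_index Q") auto
  have "snd (snd ((U_act p ^^ flip_index Q) Q)) > 0"
    using flip_index(2)[OF Q, of i] by (simp add: i U_act_last)
  hence "bqf_simple (flip Q)" using flip_index(1)[OF Q]
    by (cases "(U_act p ^^ flip_index Q) Q") (simp add: flip_def bqf_simple_def)
  thus ?thesis using uminus_mem[OF U_act_mem[OF QA]] by (simp add: simples_def flip_def)
qed

text \<open>Equal images give \<open>Q = Q' \<circ> U^m\<close> for the difference \<open>m\<close>
  of the indices. For \<open>m > 0\<close> the last coefficient of \<open>Q\<close> would be a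
  leading coefficient on the orbit of \<open>Q'\<close> before its flip, hence positive, against
  simplicity.\<close>

lemma flip_inj_aux:
  assumes Q: "Q \<in> simples \<A>" "Q' \<in> simples \<A>" and eq: "flip Q = flip Q'"
    and le: "flip_index Q \<le> flip_index Q'"
  shows "Q = Q'"
proof -
  define m where "m = flip_index Q' - flip_index Q"
  have "(U_act p ^^ flip_index Q) Q = (U_act p ^^ (flip_index Q + m)) Q'"
    using eq le by (simp add: flip_def m_def)
  hence m: "Q = (U_act p ^^ m) Q'"
    using U_act_inj[of "flip_index Q"] unfolding funpow_add o_apply by (simp add: inj_eq)
  have "m = 0"
  proof (rule ccontr)
    assume "m \<noteq> 0"
    then obtain i where i: "m = Suc i" by (cases m) auto
    have "i < flip_index Q'" using i m_def by linarith
    hence "fst ((U_act p ^^ i) Q') > 0" by (rule flip_index(2)[OF Q(2)])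
    moreover have "snd (snd Q) < 0" using Q(1) by (simp add: simples_def bqf_simple_def split: prod.splits)
    ultimately show False using m by (simp add: i U_act_last)
  qed
  thus ?thesis using m by simp
qed

lemma flip_bij:
  assumes "finite (simples \<A>)" shows "bij_betw flip (simples \<A>) (simples \<A>)"
proof -
  have inj: "inj_on flip (simples \<A>)"
    by (rule inj_onI) (metis flip_inj_aux nat_le_linear)
  moreover have "flip ` simples \<A> = simples \<A>"
    by (rule endo_inj_surj[OF assms _ inj]) (use flip_mem in auto)
  ultimately show ?thesis by (simp add: bij_betw_def)
qed

text \<open>The orbit sum is unchanged by \<open>U\<close> and odd under negation, so
  \<open>flip\<close> reverses its sign. As \<open>flip\<close> permutes the simple forms, the total
  equals its own negative.\<close>

lemma orbit_sum_cancel: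
  fixes \<phi> :: "bqf \<Rightarrow> complex"
  assumes \<phi>: "\<And>Q. \<phi> (- Q) = - \<phi> Q"
  shows "(\<Sum>Q\<in>simples \<A>. \<Sum>j<p. \<phi> ((U_act p ^^ j) Q)) = 0"
\<comment> \<open>A sum over an infinite set is 0 by convention, so the content lies in the finite
  case.\<close>
proof (cases "finite (simples \<A>)")
  case True
  define \<Psi> where "\<Psi> Q = (\<Sum>j<p. \<phi> ((U_act p ^^ j) Q))" for Q
  have inv: "\<Psi> (U_act p Q) = \<Psi> Q" for Q
  proof -
    have "\<Psi> (U_act p Q) = (\<Sum>j<p. \<phi> ((U_act p ^^ Suc j) Q))"
      unfolding \<Psi>_def by (simp only: funpow_Suc_right o_apply)
    also have "\<dots> + \<phi> ((U_act p ^^ 0) Q) = (\<Sum>j<Suc p. \<phi> ((U_act p ^^ j) Q))"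
      by (simp only: sum.lessThan_Suc_shift add.commute)
    also have "\<dots> = \<Psi> Q + \<phi> ((U_act p ^^ p) Q)" by (simp add: \<Psi>_def)
    finally show ?thesis by (simp add: U_act_period)
  qed
  have inv': "\<Psi> ((U_act p ^^ j) Q) = \<Psi> Q" for j Q by (induction j) (simp_all add: inv)
  have "\<Psi> (- Q) = - \<Psi> Q" for Q by (simp add: \<Psi>_def U_act_pow_uminus \<phi> sum_negf)
  hence fl: "\<Psi> (flip Q) = - \<Psi> Q" for Q by (simp add: flip_def inv')
  have "(\<Sum>Q\<in>simples \<A>. \<Psi> Q) = (\<Sum>Q\<in>simples \<A>. \<Psi> (flip Q))"
    by (rule sum.reindex_bij_betw[OF flip_bij[OF True], symmetric])
  also have "\<dots> = - (\<Sum>Q\<in>simples \<A>. \<Psi> Q)" by (simp add: fl sum_negf)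
  finally show ?thesis unfolding \<Psi>_def by simp
qed simp

text \<open>Factor the form over its roots and eliminate the leading coefficient by
  \<open>A * (x - y) = sqrt D\<close>.\<close>

lemma bqf_eval_factor:
  assumes "Q \<in> \<A>" and D: "bqf_disc Q = D"
  shows "1 / bqf_eval Q z 1 ^ k = of_real (D powr (- (real k / 2))) *
    (of_real (alpha_of Q - conj_root Q) ^ k / ((z - of_real (alpha_of Q)) ^ k * (z - of_real (conj_root Q)) ^ k))"
proof -
  obtain A B C where Q: "Q = (A, B, C)" by (cases Q)
  define x y where "x = alpha_of Q" and "y = conj_root Q"
  have A: "A \<noteq> 0" and D0: "D > 0" using form_props[OF assms(1)] D by (simp_all add: Q)
  have r: "A * (x - y) = sqrt D" "A * (x + y) = - B" "A * (x * y) = C"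
    using roots_props[OF A, of B C] D D0 by (simp_all add: Q x_def y_def)
  have xy: "x - y \<noteq> 0" using r(1) D0 by auto
  have "D powr (- (real k / 2)) = inverse (sqrt D ^ k)"
  proof -
    have "D powr (real k / 2) = (D powr (1 / 2)) powr real k" by (simp add: powr_powr)
    also have "\<dots> = sqrt D ^ k" using D0 by (simp add: powr_half_sqrt powr_realpow)
    finally show ?thesis by (simp add: powr_minus)
  qed
  hence pw: "D powr (- (real k / 2)) * (x - y) ^ k = inverse (A ^ k)"
    using xy A by (simp add: r(1)[symmetric] power_mult_distrib)
  have BC: "B = - (A * (x + y))" "C = A * (x * y)" using r by simp_all
  have "bqf_eval Q z 1 = of_real A * ((z - of_real x) * (z - of_real y))"
    by (simp add: Q bqf_eval_def BC power2_eq_square algebra_simps)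
  hence "1 / bqf_eval Q z 1 ^ k = of_real (inverse (A ^ k)) / ((z - of_real x) ^ k * (z - of_real y) ^ k)"
    by (simp add: power_mult_distrib divide_inverse)
  also have "\<dots> = of_real (D powr (- (real k / 2))) * (of_real (x - y) ^ k / ((z - of_real x) ^ k * (z - of_real y) ^ k))"
    unfolding pw[symmetric] by (simp only: of_real_mult of_real_power times_divide_eq_right)
  finally show ?thesis by (simp add: x_def y_def)
qed

text \<open>The map from \<open>[A, B, C]\<close> to \<open>[- C, B, - A]\<close>, the negative of
  the action of \<open>T\<close>, permutes the simple forms. Its sign survives the odd power
  \<open>k\<close>, which yields the period relation under \<open>T\<close>.\<close>

lemma sum_forms_reflect:
  assumes k: "odd k" and z: "z \<noteq> 0"
  shows "(\<Sum>Q\<in>simples \<A>. 1 / bqf_eval Q (- 1 / z) 1 ^ k) =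
     - (z ^ (2 * k)) * (\<Sum>Q\<in>simples \<A>. 1 / bqf_eval Q z 1 ^ k)"
proof -
  define f where "f Q = - bqf_act Q hecke_T" for Q
  have f: "f (A, B, C) = (- C, B, - A)" for A B C
    by (simp add: f_def bqf_act_def Let_def hecke_T_mat2)
  have mem: "f Q \<in> simples \<A>" if "Q \<in> simples \<A>" for Q
    using that uminus_mem[OF act_mem[OF _ hecke_group.T]]
    by (cases Q) (auto simp: simples_def f_def[symmetric] f bqf_simple_def)
  have ff: "f (f Q) = Q" for Q by (cases Q) (simp add: f)
  have bij: "bij_betw f (simples \<A>) (simples \<A>)"
    by (rule bij_betwI[of _ _ _ f]) (use mem ff in auto)
  have ev: "1 / bqf_eval Q (- 1 / z) 1 ^ k = - (z ^ (2 * k)) * (1 / bqf_eval (f Q) z 1 ^ k)" for Q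
  proof -
    obtain A B C where Q: "Q = (A, B, C)" by (cases Q)
    have "bqf_eval Q (- 1 / z) 1 = - (bqf_eval (f Q) z 1 / z\<^sup>2)"
      using z by (simp add: Q f bqf_eval_def power2_eq_square field_simps)
    hence "bqf_eval Q (- 1 / z) 1 ^ k = - (bqf_eval (f Q) z 1 ^ k / z ^ (2 * k))"
      using k by (simp add: power_divide power_mult)
    thus ?thesis by simp
  qed
  have "(\<Sum>Q\<in>simples \<A>. 1 / bqf_eval Q (- 1 / z) 1 ^ k) =
     - (z ^ (2 * k)) * (\<Sum>Q\<in>simples \<A>. 1 / bqf_eval (f Q) z 1 ^ k)"
    by (simp only: ev sum_distrib_left)
  also have "(\<Sum>Q\<in>simples \<A>. 1 / bqf_eval (f Q) z 1 ^ k) = (\<Sum>Q\<in>simples \<A>. 1 / bqf_eval Q z 1 ^ k)"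
    by (rule sum.reindex_bij_betw[OF bij])
  finally show ?thesis .
qed

end

theorem R_remainder_eq:
  assumes "\<And>l. l \<in> {1..L} \<Longrightarrow> symmetric_class p (\<A> l)"
  shows "R_remainder p k L d D \<A> = - (\<Sum>l=1..L. \<Sum>Q\<in>simples (\<A> l).
    Poly_Mapping.single (alpha_of Q, conj_root Q) (d l * of_real (D l powr (- (real k / 2)))))"
  unfolding R_remainder_def
  by (intro arg_cong[of _ _ uminus] sum.cong refl
      symmetric_class.sum_Z_set[OF assms, of _ "\<lambda>a Q b. Poly_Mapping.single (a, b) _"])

text \<open>Weights depend only on the class, so \<open>\<rho>^j\<close> merely replaces
  \<open>Q\<close> by \<open>Q \<circ> U^j\<close>. Negating a form swaps its roots and so, for odd
  \<open>k\<close>, reverses the sign of \<open>R(s; a, b)\<close>; each class then cancels by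
  \<open>orbit_sum_cancel\<close>.\<close>

theorem rho_orbit_sum_eq_0:
  assumes sc: "\<And>l. l \<in> {1..L} \<Longrightarrow> symmetric_class p (\<A> l)" and k: "odd k"
  shows "R_eval k (\<Sum>j<p. (rho p ^^ j) (R_remainder p k L d D \<A>)) s = 0"
proof -
  let ?c = "\<lambda>l. d l * of_real (D l powr (- (real k / 2)))"
  let ?\<phi> = "\<lambda>Q. hecke_R k s (alpha_of Q) (conj_root Q)"
  have r: "R_eval k ((rho p ^^ j) (Poly_Mapping.single (alpha_of Q, conj_root Q) c)) s =
      c * ?\<phi> ((U_act p ^^ j) Q)" if "l \<in> {1..L}" "Q \<in> simples (\<A> l)" for j l Q c
    using symmetric_class.rho_pow_single[OF sc[OF that(1)], of Q] that(2)
    by (simp add: simples_def R_eval_single)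
  have eq: "R_remainder p k L d D \<A> = - (\<Sum>l=1..L. \<Sum>Q\<in>simples (\<A> l).
      Poly_Mapping.single (alpha_of Q, conj_root Q) (?c l))"
    by (rule R_remainder_eq) (rule sc)
  have "R_eval k (\<Sum>j<p. (rho p ^^ j) (R_remainder p k L d D \<A>)) s =
     - (\<Sum>j<p. \<Sum>l=1..L. \<Sum>Q\<in>simples (\<A> l). ?c l * ?\<phi> ((U_act p ^^ j) Q))"
    unfolding eq R_eval_sum rho_pow_uminus rho_pow_sum R_eval_uminus sum_negf
    by (intro arg_cong[of _ _ uminus] sum.cong refl r)
  also have "(\<Sum>j<p. \<Sum>l=1..L. \<Sum>Q\<in>simples (\<A> l). ?c l * ?\<phi> ((U_act p ^^ j) Q)) =
     (\<Sum>l=1..L. \<Sum>j<p. \<Sum>Q\<in>simples (\<A> l). ?c l * ?\<phi> ((U_act p ^^ j) Q))"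
    by (rule sum.swap)
  also have "\<dots> = (\<Sum>l=1..L. ?c l * (\<Sum>Q\<in>simples (\<A> l). \<Sum>j<p. ?\<phi> ((U_act p ^^ j) Q)))"
    unfolding sum_distrib_left by (intro sum.cong refl sum.swap)
  also have "\<dots> = 0"
  proof (rule sum.neutral, rule ballI)
    fix l assume l: "l \<in> {1..L}"
    have "?\<phi> (- Q) = - ?\<phi> Q" for Q by (simp add: alpha_of_uminus hecke_R_swap[OF k, of s "conj_root Q"])
    thus "?c l * (\<Sum>Q\<in>simples (\<A> l). \<Sum>j<p. ?\<phi> ((U_act p ^^ j) Q)) = 0"
      using symmetric_class.orbit_sum_cancel[OF sc[OF l], of ?\<phi>] by simp
  qed
  finally show ?thesis by simp
qed

subsection \<open>Mellin integrals\<close>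

lemma set_integrable_lborel_iff:
  fixes f :: "real \<Rightarrow> 'a::euclidean_space"
  assumes [measurable]: "f \<in> borel_measurable borel" "A \<in> sets borel"
  shows "set_integrable lborel A f \<longleftrightarrow> f absolutely_integrable_on A"
  unfolding set_integrable_def by (rule integrable_completion[symmetric]) measurable

lemma set_integrable_powr_ge_1:
  assumes "e < -1" shows "set_integrable lborel {1..} (\<lambda>y::real. y powr e)"
proof -
  have "(\<lambda>y::real. y powr e) integrable_on {1..}"
    using has_integral_powr_to_inf[OF assms, of 1] by (auto simp: integrable_on_def)
  hence "(\<lambda>y::real. y powr e) absolutely_integrable_on {1..}"
    by (intro nonnegative_absolutely_integrable_1) auto
  thus ?thesis by (subst set_integrable_lborel_iff) auto
qed

lemma set_integrable_powr_less_1: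
  assumes "e > -1" shows "set_integrable lborel {0<..<1} (\<lambda>y::real. y powr e)"
proof -
  have "(\<lambda>y::real. y powr e) integrable_on {0<..1}"
    by (rule integrable_on_powr_from_0') (use assms in auto)
  hence "(\<lambda>y::real. y powr e) absolutely_integrable_on {0<..1}"
    by (intro nonnegative_absolutely_integrable_1) auto
  hence "set_integrable lborel {0<..1} (\<lambda>y::real. y powr e)" by (subst set_integrable_lborel_iff) auto
  thus ?thesis by (rule set_integrable_subset) auto
qed

lemma norm_of_real_powr: "y > 0 \<Longrightarrow> norm (complex_of_real y powr s / of_real y) = y powr (Re s - 1)"
  by (simp add: norm_divide norm_powr_real_powr powr_diff)

lemma set_borel_measurable_continuous_mult:
  fixes g h :: "real \<Rightarrow> complex"
  assumes "continuous_on A g" "A \<in> sets borel" and [measurable]: "h \<in> borel_measurable borel"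
  shows "(\<lambda>y. indicator A y *\<^sub>R (g y * h y)) \<in> borel_measurable borel"
proof -
  have [measurable]: "(\<lambda>y. indicator A y *\<^sub>R g y) \<in> borel_measurable borel"
    using assms by (intro borel_measurable_continuous_on_indicator) auto
  have "(\<lambda>y. (indicator A y *\<^sub>R g y) * h y) \<in> borel_measurable borel" by measurable
  thus ?thesis by (simp add: mult.commute)
qed

section \<open>Mellin integrals over the half-line from 1\<close>

definition mellin_integrand :: "(real \<Rightarrow> complex) \<Rightarrow> complex \<Rightarrow> real \<Rightarrow> complex" where
  "mellin_integrand g s y = g y * of_real y powr s / of_real y"

lemma mellin_integrand_eq: "mellin_integrand g s = (\<lambda>y. g y * (of_real y powr s / of_real y))"
  by (simp add: mellin_integrand_def fun_eq_iff)

lemma mellin_integrand_measurable: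
  assumes "continuous_on A g" "A \<in> sets borel"
  shows "(\<lambda>y. indicator A y *\<^sub>R mellin_integrand g s y) \<in> borel_measurable borel"
  unfolding mellin_integrand_eq by (intro set_borel_measurable_continuous_mult assms) measurable

lemma mellin_integrand_integrable_tail:
  assumes c: "continuous_on {1..} g" and b: "\<And>y. y \<ge> 1 \<Longrightarrow> norm (g y) \<le> C * y powr (- c)"
    and s: "Re s < c"
  shows "set_integrable lborel {1..} (mellin_integrand g s)"
  unfolding set_integrable_def
proof (rule Bochner_Integration.integrable_bound)
  show "integrable lborel (\<lambda>y. indicator {1..} y *\<^sub>R (C * y powr (Re s - c - 1)))"
    using set_integrable_mult_right[of C, OF set_integrable_powr_ge_1[of "Re s - c - 1"]] s
    unfolding set_integrable_def by simp
  show "(\<lambda>y. indicator {1..} y *\<^sub>R mellin_integrand g s y) \<in> borel_measurable lborel"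
    using mellin_integrand_measurable[OF c] by simp
  show "AE y in lborel. norm (indicator {1..} y *\<^sub>R mellin_integrand g s y) \<le>
      norm (indicator {1..} y *\<^sub>R (C * y powr (Re s - c - 1)))"
  proof (rule AE_I2)
    fix y :: real
    have "norm (mellin_integrand g s y) \<le> C * y powr (Re s - c - 1)" if y: "y \<ge> 1"
    proof -
      have "norm (mellin_integrand g s y) = norm (g y) * y powr (Re s - 1)"
        using y by (simp only: mellin_integrand_eq norm_mult norm_of_real_powr)
      also have "\<dots> \<le> (C * y powr (- c)) * y powr (Re s - 1)" using b[OF y] by (intro mult_right_mono) auto
      also have "\<dots> = C * y powr (Re s - c - 1)" by (simp add: powr_add[symmetric] algebra_simps)
      finally show ?thesis .
    qed
    thus "norm (indicator {1..} y *\<^sub>R mellin_integrand g s y) \<le> norm (indicator {1..} y *\<^sub>R (C * y powr (Re s - c - 1)))"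
      by (cases "y \<ge> 1") (auto simp: indicator_def intro: order_trans[OF _ abs_ge_self])
  qed
qed

definition mellin_tail :: "(real \<Rightarrow> complex) \<Rightarrow> complex \<Rightarrow> complex" where
  "mellin_tail g s = set_lebesgue_integral lborel {1..} (mellin_integrand g s)"

lemma mellin_tail_truncated_holomorphic:
  assumes c: "continuous_on {1..} g"
  shows "(\<lambda>s. integral (cbox 1 b) (mellin_integrand g s)) holomorphic_on {s. Re s < c}"
proof (rule leibniz_rule_holomorphic)
  fix s :: complex and y :: real assume y: "y \<in> cbox 1 b"
  show "((\<lambda>s. mellin_integrand g s y) has_field_derivative g y * (of_real y powr s * Ln (of_real y)) / of_real y)
      (at s within {s. Re s < c})"
  proof -
    have y1: "1 \<le> y" using y by simp
    hence "complex_of_real y \<noteq> 0" by simp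
    hence "((\<lambda>s. complex_of_real y powr s) has_field_derivative Ln (of_real y) * of_real y powr s)
        (at s within {s. Re s < c})"
      by (intro has_field_derivative_at_within[OF has_field_derivative_powr_right])
    thus ?thesis unfolding mellin_integrand_def using y1 by (auto intro!: derivative_eq_intros)
  qed
next
  fix s :: complex
  have "continuous_on (cbox 1 b) (mellin_integrand g s)"
    unfolding mellin_integrand_def
    by (intro continuous_intros continuous_on_subset[OF c]) (auto simp: complex_nonpos_Reals_iff)
  thus "mellin_integrand g s integrable_on cbox 1 b" by (rule integrable_continuous)
next
  have "continuous_on ({s. Re s < c} \<times> cbox 1 b)
     (\<lambda>x. g (snd x) * (of_real (snd x) powr fst x * Ln (of_real (snd x))) / of_real (snd x))"
    by (intro continuous_intros continuous_on_compose2[OF c]) (auto simp: complex_nonpos_Reals_iff)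
  thus "continuous_on ({s. Re s < c} \<times> cbox 1 b)
     (\<lambda>(s, y). g y * (of_real y powr s * Ln (of_real y)) / of_real y)"
    by (simp add: case_prod_unfold)
qed (rule convex_halfspace_Re_lt)

text \<open>The truncations to [1, n + 1] are holomorphic by differentiation under the integral, and
  they converge uniformly on small discs.\<close>

lemma mellin_tail_holomorphic:
  assumes c: "continuous_on {1..} g" and b: "\<And>y. y \<ge> 1 \<Longrightarrow> norm (g y) \<le> C * y powr (- c)"
  shows "mellin_tail g holomorphic_on {s. Re s < c}"
proof (rule holomorphic_uniform_sequence)
  show "open {s. Re s < c}" by (rule open_halfspace_Re_lt)
  show "(\<lambda>s. integral (cbox 1 (real (Suc n))) (mellin_integrand g s)) holomorphic_on {s. Re s < c}" for n
    by (rule mellin_tail_truncated_holomorphic[OF c])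
  fix s0 :: complex assume "s0 \<in> {s. Re s < c}"
  hence s0: "Re s0 < c" by simp
  \<comment> \<open>Half the distance to the line \<open>Re s = c\<close>: on the disc of radius
    \<open>d\<close> the exponent keeps a margin \<open>d\<close>, which makes the part beyond
    \<open>B\<close> at most \<open>C * B powr (- d) / d\<close>.\<close>
  define d where "d = (c - Re s0) / 2"
  have d: "d > 0" using s0 by (simp add: d_def)
  have C: "C \<ge> 0" using order_trans[OF norm_ge_zero b[of 1]] by simp
  have re: "Re s \<le> c - d" if "s \<in> cball s0 d" for s
  proof -
    have "\<bar>Re s - Re s0\<bar> \<le> norm (s - s0)" using abs_Re_le_cmod[of "s - s0"] by simp
    also have "\<dots> \<le> d" using that by (simp add: dist_norm norm_minus_commute)
    finally have "Re s - Re s0 \<le> d" by linarith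
    thus ?thesis by (simp add: d_def field_simps)
  qed
  have tail: "norm (mellin_tail g s - integral (cbox 1 B) (mellin_integrand g s)) \<le> C * B powr (- d) / d"
    if s: "s \<in> cball s0 d" and B: "B \<ge> 1" for s B
  proof -
    have int: "set_integrable lborel {1..} (mellin_integrand g s)"
      by (rule mellin_integrand_integrable_tail[OF c b]) (use re[OF s] d in auto)
    have i1: "set_integrable lborel {1..B} (mellin_integrand g s)" by (rule set_integrable_subset[OF int]) auto
    have i2: "set_integrable lborel {B<..} (mellin_integrand g s)" by (rule set_integrable_subset[OF int]) (use B in auto)
    have un: "{1..} = {1..B} \<union> {B<..}" using B by auto
    have "mellin_tail g s = set_lebesgue_integral lborel {1..B} (mellin_integrand g s) + set_lebesgue_integral lborel {B<..} (mellin_integrand g s)"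
      unfolding mellin_tail_def un by (rule set_integral_Un[OF _ i1 i2]) auto
    also have "set_lebesgue_integral lborel {1..B} (mellin_integrand g s) = integral (cbox 1 B) (mellin_integrand g s)"
      using set_borel_integral_eq_integral(2)[OF i1] by simp
    finally have "norm (mellin_tail g s - integral (cbox 1 B) (mellin_integrand g s)) = norm (set_lebesgue_integral lborel {B<..} (mellin_integrand g s))"
      by simp
    also have "\<dots> \<le> (LINT y:{B<..}|lborel. norm (mellin_integrand g s y))"
      by (rule set_integral_norm_bound[OF i2])
    also have "\<dots> \<le> (LINT y:{B<..}|lborel. C * y powr (- d - 1))"
    proof (rule set_integral_mono)
      show "set_integrable lborel {B<..} (\<lambda>y. norm (mellin_integrand g s y))" by (rule set_integrable_norm[OF i2])
      have "set_integrable lborel {1..} (\<lambda>y. C * y powr (- d - 1))"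
        using set_integrable_powr_ge_1[of "- d - 1"] d by auto
      thus "set_integrable lborel {B<..} (\<lambda>y. C * y powr (- d - 1))"
        by (rule set_integrable_subset) (use B in auto)
      fix y assume y: "y \<in> {B<..}"
      have y1: "y \<ge> 1" using y B by auto
      have "norm (mellin_integrand g s y) = norm (g y) * y powr (Re s - 1)"
        using y1 by (simp only: mellin_integrand_eq norm_mult norm_of_real_powr)
      also have "\<dots> \<le> (C * y powr (- c)) * y powr (c - d - 1)"
        using b[OF y1] y1 re[OF s] C by (intro mult_mono powr_mono) auto
      also have "\<dots> = C * y powr (- d - 1)" unfolding mult.assoc powr_add[symmetric] by simp
      finally show "norm (mellin_integrand g s y) \<le> C * y powr (- d - 1)" .
    qed
    also have "\<dots> = C * (LINT y:{B<..}|lborel. y powr (- d - 1))" by simp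
    also have "(LINT y:{B<..}|lborel. y powr (- d - 1)) = B powr (- d) / d"
    proof -
      have "set_integrable lborel {1..} (\<lambda>y::real. y powr (- d - 1))" using set_integrable_powr_ge_1[of "- d - 1"] d by auto
      hence i: "set_integrable lborel {B<..} (\<lambda>y::real. y powr (- d - 1))" by (rule set_integrable_subset) (use B in auto)
      have "((\<lambda>y. y powr (- d - 1)) has_integral B powr (- d) / d) {B..}"
        using has_integral_powr_to_inf[of "- d - 1" B] d B by simp
      hence "((\<lambda>y. y powr (- d - 1)) has_integral B powr (- d) / d) {B<..}"
        by (rule has_integral_spike_set_eq[THEN iffD1, rotated 2]) (auto intro: negligible_subset[of "{B}"])
      thus ?thesis using set_borel_integral_eq_integral(2)[OF i] by (simp add: integral_unique)
    qed
    finally show ?thesis by simp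
  qed
  have "uniform_limit (cball s0 d) (\<lambda>n s. integral (cbox 1 (real (Suc n))) (mellin_integrand g s)) (mellin_tail g) sequentially"
  proof (rule uniform_limitI)
    fix e :: real assume e: "e > 0"
    have "((\<lambda>n. real (Suc n) powr (- d)) \<longlongrightarrow> 0) sequentially"
      by (rule tendsto_neg_powr[OF _ filterlim_compose[OF filterlim_real_sequentially filterlim_Suc]]) (use d in simp)
    hence "((\<lambda>n. C * real (Suc n) powr (- d) / d) \<longlongrightarrow> C * 0 / d) sequentially"
      by (intro tendsto_intros) (use d in auto)
    hence "eventually (\<lambda>n. C * real (Suc n) powr (- d) / d < e) sequentially"
      using e by (intro order_tendstoD(2)[where a = e and y = "C * 0 / d"]) auto
    thus "\<forall>\<^sub>F n in sequentially. \<forall>s\<in>cball s0 d. dist (integral (cbox 1 (real (Suc n))) (mellin_integrand g s)) (mellin_tail g s) < e"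
    proof eventually_elim
      case (elim n)
      show ?case
      proof
        fix s assume s: "s \<in> cball s0 d"
        show "dist (integral (cbox 1 (real (Suc n))) (mellin_integrand g s)) (mellin_tail g s) < e"
          using tail[OF s, of "real (Suc n)"] elim by (simp add: dist_norm norm_minus_commute)
      qed
    qed
  qed
  moreover have "cball s0 d \<subseteq> {s. Re s < c}" using re d by force
  ultimately show "\<exists>d>0. cball s0 d \<subseteq> {s. Re s < c} \<and>
      uniform_limit (cball s0 d) (\<lambda>n s. integral (cbox 1 (real (Suc n))) (mellin_integrand g s)) (mellin_tail g) sequentially"
    using d by blast
qed

section \<open>The inversion \<open>y \<mapsto> 1 / y\<close> and integrals over (0, 1)\<close>

lemma of_real_inverse_powr:
  assumes "y > 0" shows "complex_of_real (1 / y) powr w = of_real y powr (- w)"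
proof -
  have "Ln (complex_of_real (1 / y)) = - Ln (of_real y)"
    using assms by (subst (1 2) Ln_of_real) (auto simp: ln_div)
  thus ?thesis using assms by (simp add: powr_def)
qed

lemma mellin_tail_inversion:
  assumes c: "continuous_on {1..} g"
  shows "(LINT y:{0<..<1}|lborel. g (1 / y) * of_real y powr (- w) / of_real y) = mellin_tail g w"
proof -
  \<comment> \<open>The cutoff makes the integrand Borel on the whole line, as
    \<open>integral_inversion\<close> requires; leaving out the point 1 alters a null set and makes
    the image the open interval (0, 1).\<close>
  define f where "f y = indicator {1<..} y *\<^sub>R mellin_integrand g w y" for y
  have m: "f \<in> borel_measurable borel"
    unfolding f_def by (rule mellin_integrand_measurable[OF continuous_on_subset[OF c]]) auto
  have "mellin_tail g w = set_lebesgue_integral lborel {0<..} f"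
    unfolding mellin_tail_def set_lebesgue_integral_def
  proof (rule integral_cong_AE)
    show "(\<lambda>y. indicator {1..} y *\<^sub>R mellin_integrand g w y) \<in> borel_measurable lborel"
      using mellin_integrand_measurable[OF c] by simp
    show "(\<lambda>y. indicator {0<..} y *\<^sub>R f y) \<in> borel_measurable lborel"
      using m by measurable
    show "AE y in lborel. indicator {1..} y *\<^sub>R mellin_integrand g w y = indicator {0<..} y *\<^sub>R f y"
      using AE_lborel_singleton[of "1::real"] by eventually_elim (auto simp: f_def indicator_def)
  qed
  also have "\<dots> = set_lebesgue_integral lborel {0<..} (\<lambda>y. f (1 / y) /\<^sub>R y\<^sup>2)"
    by (rule integral_inversion[OF m])
  also have "\<dots> = (LINT y:{0<..<1}|lborel. g (1 / y) * of_real y powr (- w) / of_real y)"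
    unfolding set_lebesgue_integral_def
  proof (rule Bochner_Integration.integral_cong[OF refl])
    fix y :: real
    show "indicator {0<..} y *\<^sub>R (f (1 / y) /\<^sub>R y\<^sup>2) =
        indicator {0<..<1} y *\<^sub>R (g (1 / y) * of_real y powr (- w) / of_real y)"
    proof (cases "y > 0")
      case True
      have "mellin_integrand g w (1 / y) /\<^sub>R y\<^sup>2 = g (1 / y) * of_real y powr (- w) / of_real y"
        unfolding mellin_integrand_def of_real_inverse_powr[OF True] using True
        by (simp add: scaleR_conv_of_real power2_eq_square field_simps)
      thus ?thesis using True by (auto simp: f_def indicator_def field_simps)
    qed (auto simp: indicator_def)
  qed
  finally show ?thesis by simp
qed

lemma mellin_integrand_integrable_bounded:
  assumes c: "continuous_on {0<..<1} g" and b: "\<And>y. 0 < y \<Longrightarrow> y < 1 \<Longrightarrow> norm (g y) \<le> C" and s: "Re s > 0"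
  shows "set_integrable lborel {0<..<1} (mellin_integrand g s)"
  unfolding set_integrable_def
proof (rule Bochner_Integration.integrable_bound)
  show "integrable lborel (\<lambda>y. indicator {0<..<1} y *\<^sub>R (C * y powr (Re s - 1)))"
    using set_integrable_mult_right[of C, OF set_integrable_powr_less_1[of "Re s - 1"]] s
    unfolding set_integrable_def by simp
  show "(\<lambda>y. indicator {0<..<1} y *\<^sub>R mellin_integrand g s y) \<in> borel_measurable lborel"
    using mellin_integrand_measurable[OF c] by simp
  show "AE y in lborel. norm (indicator {0<..<1} y *\<^sub>R mellin_integrand g s y) \<le>
      norm (indicator {0<..<1} y *\<^sub>R (C * y powr (Re s - 1)))"
  proof (rule AE_I2)
    fix y :: real
    have "norm (mellin_integrand g s y) \<le> C * y powr (Re s - 1)" if y: "0 < y" "y < 1"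
      unfolding mellin_integrand_eq norm_mult norm_of_real_powr[OF y(1)] using b[OF y] by (intro mult_right_mono) auto
    thus "norm (indicator {0<..<1} y *\<^sub>R mellin_integrand g s y) \<le> norm (indicator {0<..<1} y *\<^sub>R (C * y powr (Re s - 1)))"
      by (cases "0 < y \<and> y < 1") (auto simp: indicator_def intro: order_trans[OF _ abs_ge_self])
  qed
qed

lemma powr_integral_0_1:
  assumes w: "Re w > 0"
  shows "set_integrable lborel {0<..<1} (\<lambda>y. complex_of_real y powr w / of_real y)"
    and "(LINT y:{0<..<1}|lborel. complex_of_real y powr w / of_real y) = 1 / w"
proof -
  show i: "set_integrable lborel {0<..<1} (\<lambda>y. complex_of_real y powr w / of_real y)"
    using mellin_integrand_integrable_bounded[of "\<lambda>_. 1" 1 w] w by (simp add: mellin_integrand_eq)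
  have w0: "w \<noteq> 0" using w by auto
  have "((\<lambda>y. complex_of_real y powr w / of_real y) has_integral
      complex_of_real 1 powr w / w - complex_of_real 0 powr w / w) {0..1}"
  proof (rule fundamental_theorem_of_calculus_interior)
    \<comment> \<open>The antiderivative extends continuously by 0 to \<open>y = 0\<close> because
      \<open>Re w > 0\<close>.\<close>
    show "continuous_on {0..1} (\<lambda>y. complex_of_real y powr w / w)"
      using w w0 by (intro continuous_intros) auto
    fix y :: real assume y: "y \<in> {0<..<1}"
    have n: "complex_of_real y \<notin> \<real>\<^sub>\<le>\<^sub>0" using y by (simp add: complex_nonpos_Reals_iff)
    have "((\<lambda>z. z powr w / w) has_field_derivative (w * of_real y powr (w - 1)) / w) (at (complex_of_real y))"
      using n by (intro derivative_eq_intros refl has_field_derivative_powr DERIV_cdivide)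
    moreover have "(w * of_real y powr (w - 1)) / w = complex_of_real y powr w / of_real y"
      using w0 y by (simp add: powr_diff)
    ultimately have "((\<lambda>z. z powr w / w) has_field_derivative complex_of_real y powr w / of_real y) (at (complex_of_real y))"
      by simp
    thus "((\<lambda>y. complex_of_real y powr w / w) has_vector_derivative complex_of_real y powr w / of_real y) (at y)"
      by (rule has_vector_derivative_real_field)
  qed simp
  hence "((\<lambda>y. complex_of_real y powr w / of_real y) has_integral 1 / w) {0..1}" by simp
  hence "((\<lambda>y. complex_of_real y powr w / of_real y) has_integral 1 / w) {0<..<1}"
    by (rule has_integral_spike_set_eq[THEN iffD1, rotated 2]) (auto intro: negligible_subset[of "{0, 1}"])
  thus "(LINT y:{0<..<1}|lborel. complex_of_real y powr w / of_real y) = 1 / w"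
    using set_borel_integral_eq_integral(2)[OF i] by (simp add: integral_unique)
qed

text \<open>The first bound controls the Mellin integral at 0, the second at infinity; together they
  give convergence in the strip \<open>0 < Re s < 2 * k\<close>.\<close>

definition decaying :: "nat \<Rightarrow> (real \<Rightarrow> complex) \<Rightarrow> bool" where
  "decaying k t \<longleftrightarrow> continuous_on {0<..} t \<and>
     (\<exists>C. \<forall>y>0. norm (t y) \<le> C \<and> norm (t y) \<le> C * y powr (- real (2 * k)))"

lemma decaying_zero: "decaying k (\<lambda>_. 0)"
  by (auto simp: decaying_def intro!: exI[of _ 0])

lemma decaying_add:
  assumes "decaying k t" "decaying k u" shows "decaying k (\<lambda>y. t y + u y)"
proof -
  obtain C where C: "\<forall>y>0. norm (t y) \<le> C \<and> norm (t y) \<le> C * y powr (- real (2 * k))"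
    using assms(1) unfolding decaying_def by blast
  obtain E where E: "\<forall>y>0. norm (u y) \<le> E \<and> norm (u y) \<le> E * y powr (- real (2 * k))"
    using assms(2) unfolding decaying_def by blast
  have "\<forall>y>0. norm (t y + u y) \<le> C + E \<and> norm (t y + u y) \<le> (C + E) * y powr (- real (2 * k))"
    using C E norm_triangle_mono[of "t _" _ "u _"] by (simp add: distrib_right)
  thus ?thesis using assms unfolding decaying_def by (auto intro!: continuous_intros)
qed

lemma decaying_cmult:
  assumes "decaying k t" shows "decaying k (\<lambda>y. c * t y)"
proof -
  obtain C where C: "\<forall>y>0. norm (t y) \<le> C \<and> norm (t y) \<le> C * y powr (- real (2 * k))"
    using assms(1) unfolding decaying_def by blast
  have "\<forall>y>0. norm (c * t y) \<le> norm c * C \<and> norm (c * t y) \<le> norm c * C * y powr (- real (2 * k))"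
    using C by (simp add: norm_mult mult.assoc mult_left_mono del: of_nat_mult)
  thus ?thesis using assms unfolding decaying_def by (auto intro!: continuous_intros simp del: of_nat_mult)
qed

lemma decaying_sum: "(\<And>i. i \<in> I \<Longrightarrow> decaying k (t i)) \<Longrightarrow> decaying k (\<lambda>y. \<Sum>i\<in>I. t i y)"
  by (induction I rule: infinite_finite_induct) (auto simp: decaying_zero intro: decaying_add)

text \<open>Real and imaginary part show that the norm of \<open>\<i> * y - a\<close> is at least
  |a| and at least \<open>y\<close>. Each estimate, taken for both factors, yields one
  bound.\<close>

lemma decaying_linear_factors:
  assumes "a \<noteq> 0" "b \<noteq> 0"
  shows "decaying k (\<lambda>y. 1 / ((\<i> * of_real y - of_real a) ^ k * (\<i> * of_real y - of_real b) ^ k))"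
proof -
  have n1: "norm (\<i> * of_real y - of_real c) \<ge> \<bar>c\<bar>" for y c :: real
    using abs_Re_le_cmod[of "\<i> * of_real y - of_real c"] by simp
  have n2: "norm (\<i> * of_real y - of_real c) \<ge> y" for y c :: real
    using abs_Im_le_cmod[of "\<i> * of_real y - of_real c"] by simp
  have nz: "\<i> * of_real y - of_real c \<noteq> 0" if "c \<noteq> 0" for y c :: real
    using n1[of c y] that by auto
  define C where "C = 1 + 1 / (\<bar>a\<bar> ^ k * \<bar>b\<bar> ^ k)"
  have C: "C \<ge> 1" using assms by (simp add: C_def)
  have "norm (1 / ((\<i> * of_real y - of_real a) ^ k * (\<i> * of_real y - of_real b) ^ k)) \<le> C \<and>
     norm (1 / ((\<i> * of_real y - of_real a) ^ k * (\<i> * of_real y - of_real b) ^ k)) \<le> C * y powr (- real (2 * k))"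
    if y: "y > 0" for y
  proof
    let ?n = "norm (\<i> * of_real y - of_real a) ^ k * norm (\<i> * of_real y - of_real b) ^ k"
    have eq: "norm (1 / ((\<i> * of_real y - of_real a) ^ k * (\<i> * of_real y - of_real b) ^ k)) = 1 / ?n"
      by (simp add: norm_divide norm_mult norm_power)
    have "\<bar>a\<bar> ^ k * \<bar>b\<bar> ^ k \<le> ?n" by (intro mult_mono power_mono n1) auto
    hence "1 / ?n \<le> 1 / (\<bar>a\<bar> ^ k * \<bar>b\<bar> ^ k)" using assms by (intro divide_left_mono) (auto simp: nz)
    thus "norm (1 / ((\<i> * of_real y - of_real a) ^ k * (\<i> * of_real y - of_real b) ^ k)) \<le> C"
      unfolding eq C_def by linarith
    have "y ^ k * y ^ k \<le> ?n" using y by (intro mult_mono power_mono n2) auto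
    hence "1 / ?n \<le> 1 / (y ^ k * y ^ k)" using assms y by (intro divide_left_mono) (auto simp: nz)
    also have "1 / (y ^ k * y ^ k) = y powr (- real (2 * k))"
      using y by (simp add: powr_minus powr_realpow[symmetric] powr_add[symmetric] inverse_eq_divide)
    also have "\<dots> = 1 * y powr (- real (2 * k))" by simp
    also have "\<dots> \<le> C * y powr (- real (2 * k))" using C by (intro mult_right_mono) auto
    finally show "norm (1 / ((\<i> * of_real y - of_real a) ^ k * (\<i> * of_real y - of_real b) ^ k)) \<le> C * y powr (- real (2 * k))"
      unfolding eq .
  qed
  moreover have "continuous_on {0<..} (\<lambda>y::real. 1 / ((\<i> * of_real y - of_real a) ^ k * (\<i> * of_real y - of_real b) ^ k))"
    by (intro continuous_intros) (use assms nz in auto)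
  ultimately show ?thesis unfolding decaying_def by blast
qed

lemma decaying_tail:
  assumes "decaying k t"
  obtains C where "continuous_on {1..} t" "\<And>y. y \<ge> 1 \<Longrightarrow> norm (t y) \<le> C * y powr (- real (2 * k))"
proof -
  obtain C where C: "\<forall>y>0. norm (t y) \<le> C \<and> norm (t y) \<le> C * y powr (- real (2 * k))"
    using assms unfolding decaying_def by blast
  have "continuous_on {1..} t"
    using assms unfolding decaying_def by (auto intro: continuous_on_subset)
  thus ?thesis using that[of C] C by simp
qed

lemma decaying_integrable:
  assumes t: "decaying k t" and s: "0 < Re s" "Re s < 2 * real k"
  shows "set_integrable lborel {1..} (mellin_integrand t s)" "set_integrable lborel {0<..<1} (mellin_integrand t s)"
    "set_integrable lborel {0<..} (mellin_integrand t s)"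
proof -
  show 1: "set_integrable lborel {1..} (mellin_integrand t s)"
    using decaying_tail[OF t] mellin_integrand_integrable_tail[of t _ "real (2 * k)" s] s by (metis of_nat_mult of_nat_numeral)
  obtain C where C: "\<forall>y>0. norm (t y) \<le> C \<and> norm (t y) \<le> C * y powr (- real (2 * k))"
    using t unfolding decaying_def by blast
  show 2: "set_integrable lborel {0<..<1} (mellin_integrand t s)"
    by (rule mellin_integrand_integrable_bounded[of t C])
       (use t C s in \<open>auto simp: decaying_def intro: continuous_on_subset\<close>)
  have "{0::real<..} = {0<..<1} \<union> {1..}" by auto
  thus "set_integrable lborel {0<..} (mellin_integrand t s)" using set_integrable_Un[OF 2 1] by simp
qed

lemma of_real_powr_minus_nat:
  "y > 0 \<Longrightarrow> complex_of_real y powr (s - of_nat n) = of_real y powr s / of_real y ^ n"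
  by (simp add: powr_diff powr_nat')

text \<open>The symmetry folds (0, 1) onto the half-line from 1 and turns \<open>s\<close> into
  \<open>2k - s\<close>.\<close>

lemma decaying_symmetric_integral:
  assumes t: "decaying k t" and s: "0 < Re s" "Re s < 2 * real k"
    and sym: "\<And>y. y > 0 \<Longrightarrow> t (1 / y) = of_real y ^ (2 * k) * t y"
  shows "set_lebesgue_integral lborel {0<..} (mellin_integrand t s) = mellin_tail t s + mellin_tail t (of_nat (2 * k) - s)"
proof -
  note i = decaying_integrable[OF t s]
  have un: "{0::real<..} = {0<..<1} \<union> {1..}" by auto
  have "set_lebesgue_integral lborel {0<..} (mellin_integrand t s) =
      set_lebesgue_integral lborel {0<..<1} (mellin_integrand t s) + mellin_tail t s"
    unfolding mellin_tail_def un by (rule set_integral_Un[OF _ i(2) i(1)]) auto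
  also have "set_lebesgue_integral lborel {0<..<1} (mellin_integrand t s) =
      (LINT y:{0<..<1}|lborel. t (1 / y) * of_real y powr (- (of_nat (2 * k) - s)) / of_real y)"
  proof (rule set_lebesgue_integral_cong)
    show "\<forall>y. y \<in> {0<..<1} \<longrightarrow> mellin_integrand t s y = t (1 / y) * of_real y powr (- (of_nat (2 * k) - s)) / of_real y"
    proof safe
      fix y :: real assume "y \<in> {0<..<1}"
      hence y: "y > 0" by simp
      show "mellin_integrand t s y = t (1 / y) * of_real y powr (- (of_nat (2 * k) - s)) / of_real y"
        unfolding minus_diff_eq of_real_powr_minus_nat[OF y] sym[OF y] mellin_integrand_def using y by simp
    qed
  qed auto
  also have "\<dots> = mellin_tail t (of_nat (2 * k) - s)"
    by (rule mellin_tail_inversion) (use t in \<open>auto simp: decaying_def intro: continuous_on_subset\<close>)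
  finally show ?thesis by simp
qed

section \<open>Decay of Fourier series, and rational functions with a pole only at 0\<close>

lemma power_le_fact_exp: "x \<ge> 0 \<Longrightarrow> x ^ n \<le> fact n * exp (x::real)"
proof -
  assume x: "x \<ge> 0"
  have s: "(\<lambda>n. x ^ n /\<^sub>R fact n) sums exp x" by (rule exp_converges)
  have "(\<Sum>i\<in>{n}. x ^ i /\<^sub>R fact i) \<le> suminf (\<lambda>i. x ^ i /\<^sub>R fact i)"
    by (rule sum_le_suminf) (use s x in \<open>auto simp: sums_iff\<close>)
  thus ?thesis using s by (simp add: sums_iff field_simps)
qed

text \<open>On the imaginary axis this is a power series in \<open>exp (- \<kappa> * y)\<close>
  without constant term, so it is of the size of its first term.\<close>

lemma fourier_series_decay:
  fixes a :: "nat \<Rightarrow> complex"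
  assumes l: "l > 0" and a0: "a 0 = 0"
    and F: "\<And>z. Im z > 0 \<Longrightarrow> (\<lambda>n. a n * exp (2 * of_real pi * \<i> * of_nat n * z / of_real l)) sums F z"
  shows "\<exists>C. \<forall>y\<ge>1. norm (F (\<i> * of_real y)) \<le> C * exp (- (2 * pi / l) * y)"
proof -
  define \<kappa> where "\<kappa> = 2 * pi / l"
  have \<kappa>: "\<kappa> > 0" using l by (simp add: \<kappa>_def)
  have sm: "(\<lambda>n. a n * of_real (exp (- \<kappa> * y)) ^ n) sums F (\<i> * of_real y)" if "y > 0" for y
  proof -
    have "exp (2 * of_real pi * \<i> * of_nat n * (\<i> * of_real y) / of_real l) =
        complex_of_real (exp (- \<kappa> * y)) ^ n" for n
    proof -
      have "2 * of_real pi * \<i> * of_nat n * (\<i> * of_real y) / of_real l = of_nat n * complex_of_real (- \<kappa> * y)"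
        by (simp add: \<kappa>_def field_simps)
      thus ?thesis by (simp only: exp_of_nat_mult exp_of_real)
    qed
    thus ?thesis using F[of "\<i> * of_real y"] that by simp
  qed
  \<comment> \<open>The variable at \<open>y = 1/2\<close>: convergence there bounds
    \<open>a n * r ^ n\<close>.\<close>
  define r where "r = exp (- \<kappa> / 2)"
  have r: "0 < r" "r < 1" using \<kappa> by (auto simp: r_def)
  have "(\<lambda>n. a n * of_real r ^ n) \<longlonglongrightarrow> 0"
    using sm[of "1/2"] by (simp add: r_def sums_iff summable_LIMSEQ_zero)
  hence "Bseq (\<lambda>n. a n * of_real r ^ n)" by (intro convergent_imp_Bseq convergentI)
  then obtain B where B: "B > 0" "\<And>n. norm (a n * of_real r ^ n) \<le> B" by (auto elim: BseqE)
  have "norm (F (\<i> * of_real y)) \<le> (B / (1 - r) * exp (\<kappa> / 2)) * exp (- \<kappa> * y)" if y: "y \<ge> 1" for y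
  proof -
    \<comment> \<open>The variable at \<open>y - 1/2\<close>: splitting
      \<open>exp (- \<kappa> * y) = r * x\<close> leaves a geometric series in \<open>x\<close>, and
      \<open>x \<le> r < 1\<close> makes it uniform for \<open>y \<ge> 1\<close>.\<close>
    define x where "x = exp (- \<kappa> * (y - 1 / 2))"
    have "\<kappa> * (1 / 2) \<le> \<kappa> * (y - 1 / 2)" using \<kappa> y by (intro mult_left_mono) auto
    hence x: "0 < x" "x \<le> r" by (auto simp: x_def r_def)
    have rx: "exp (- \<kappa> * y) = r * x" by (simp add: r_def x_def exp_add[symmetric] algebra_simps)
    have t: "norm (a (Suc n) * of_real (exp (- \<kappa> * y)) ^ Suc n) \<le> B * x * x ^ n" for n
    proof -
      have "norm (a (Suc n) * of_real (exp (- \<kappa> * y)) ^ Suc n) = norm (a (Suc n) * of_real r ^ Suc n) * x ^ Suc n"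
        unfolding rx using x r by (simp add: norm_mult norm_power power_mult_distrib)
      also have "\<dots> \<le> B * x ^ Suc n" using x by (intro mult_right_mono B(2)) auto
      finally show ?thesis by (simp add: mult_ac)
    qed
    have "(\<lambda>n. a (Suc n) * of_real (exp (- \<kappa> * y)) ^ Suc n) sums F (\<i> * of_real y)"
      using sm[of y] y a0 by (subst sums_Suc_iff) auto
    hence Fs: "F (\<i> * of_real y) = suminf (\<lambda>n. a (Suc n) * of_real (exp (- \<kappa> * y)) ^ Suc n)" by (simp add: sums_iff)
    have g: "(\<lambda>n. B * x * x ^ n) sums (B * x * (1 / (1 - x)))"
      using x r by (intro sums_mult geometric_sums) auto
    have "norm (F (\<i> * of_real y)) \<le> suminf (\<lambda>n. B * x * x ^ n)"
      unfolding Fs by (rule norm_suminf_le[OF t]) (use g in \<open>auto simp: sums_iff\<close>)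
    also have "\<dots> = B * x / (1 - x)" using g by (simp add: sums_iff)
    also have "\<dots> \<le> B * x / (1 - r)" using x r B by (intro divide_left_mono) auto
    also have "x = exp (\<kappa> / 2) * exp (- \<kappa> * y)" by (simp add: x_def exp_add[symmetric] algebra_simps)
    finally show ?thesis by (simp add: mult_ac)
  qed
  thus ?thesis unfolding \<kappa>_def by blast
qed

lemma exp_decay_imp_powr_decay:
  assumes \<kappa>: "\<kappa> > 0" and b: "\<forall>y\<ge>1. norm (f y) \<le> C * exp (- \<kappa> * y)"
  shows "\<exists>C. \<forall>y\<ge>1. norm (f y :: complex) \<le> C * y powr (- c)"
proof -
  define N where "N = nat \<lceil>c\<rceil>"
  have N: "c \<le> real N" unfolding N_def by linarith
  have C: "C \<ge> 0"
  proof -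
    have "0 \<le> C * exp (- \<kappa> * 1)" using b norm_ge_zero order_trans by (metis order_refl)
    thus ?thesis by (simp add: zero_le_mult_iff)
  qed
  have "norm (f y) \<le> (C * (fact N / \<kappa> ^ N)) * y powr (- c)" if y: "y \<ge> 1" for y
  proof -
    have "(\<kappa> * y) ^ N \<le> fact N * exp (\<kappa> * y)" using \<kappa> y by (intro power_le_fact_exp) auto
    hence "exp (- \<kappa> * y) \<le> fact N / \<kappa> ^ N * (1 / y ^ N)"
      using \<kappa> y by (simp add: exp_minus field_simps power_mult_distrib)
    also have "1 / y ^ N = y powr (- real N)" using y by (simp add: powr_minus powr_realpow inverse_eq_divide)
    also have "fact N / \<kappa> ^ N * y powr (- real N) \<le> fact N / \<kappa> ^ N * y powr (- c)"
      using y N \<kappa> by (intro mult_left_mono powr_mono) auto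
    finally have "C * exp (- \<kappa> * y) \<le> C * (fact N / \<kappa> ^ N * y powr (- c))" using C by (intro mult_left_mono)
    thus ?thesis using b y by (metis mult.assoc order_trans)
  qed
  thus ?thesis by blast
qed

text \<open>In lowest terms every zero of the denominator is a pole, hence lies at 0; by the
  fundamental theorem of algebra the denominator is a constant times a power of
  \<open>z\<close>.\<close>

lemma rational_pole_only_0:
  assumes q0: "rational_function q0" "\<And>z. is_pole q0 z \<Longrightarrow> z = 0"
  shows "\<exists>g m. \<forall>y>0. c * q0 (\<i> * of_real y) = poly g (of_real y) / of_real y ^ m"
proof -
  obtain P N where PN: "N \<noteq> 0" "coprime P N" "q0 = (\<lambda>z. poly P z / poly N z)"
    using q0(1) unfolding rational_function_def by blast
  have root: "z = 0" if z: "poly N z = 0" for z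
  proof (rule q0(2), unfold PN(3), rule is_pole_divide)
    show "isCont (poly P) z" by simp
    show "poly P z \<noteq> 0"
    proof
      assume "poly P z = 0"
      hence "[:- z, 1:] dvd P" "[:- z, 1:] dvd N" using z by (simp_all add: poly_eq_0_iff_dvd)
      hence "[:- z, 1:] dvd 1" using PN(2) coprime_common_divisor by blast
      thus False using poly_eq_0_iff_dvd[of 1 z] by simp
    qed
    have "eventually (\<lambda>w. poly N w \<noteq> 0) (at z)"
    proof -
      have "finite {w. poly N w = 0}" using PN(1) by (rule poly_roots_finite)
      hence "\<not> z islimpt {w. poly N w = 0}" by (rule islimpt_finite)
      thus ?thesis by (simp add: islimpt_iff_eventually)
    qed
    moreover have "(poly N \<longlongrightarrow> 0) (at z)" using z isCont_def poly_isCont[of z N] by metis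
    ultimately show "filterlim (poly N) (at 0) (at z)" by (simp add: filterlim_at)
  qed
  define m where "m = order 0 N"
  obtain N' where N': "N = [:- 0, 1:] ^ m * N'" "\<not> [:- 0, 1:] dvd N'"
    using order_decomp[OF PN(1), of 0] unfolding m_def by blast
  have "poly N' z \<noteq> 0" for z
  proof
    assume z: "poly N' z = 0"
    hence "poly N z = 0" by (simp add: N')
    hence "z = 0" by (rule root)
    thus False using z N'(2) poly_eq_0_iff_dvd[of N' 0] by simp
  qed
  hence nr: "(\<Sum>i\<le>degree N'. coeff N' i * z ^ i) \<noteq> 0" for z by (simp add: poly_altdef[symmetric])
  have "degree N' = 0"
  proof (rule ccontr)
    assume d: "degree N' \<noteq> 0"
    hence "\<exists>i\<in>{1..degree N'}. coeff N' i \<noteq> 0" by (intro bexI[of _ "degree N'"]) auto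
    thus False using fundamental_theorem_of_algebra[of "coeff N'" "degree N'"] nr by blast
  qed
  then obtain b where b: "N' = [:b:]" by (auto elim: degree_eq_zeroE)
  define g where "g = smult (c / (b * \<i> ^ m)) (pcompose P [:0, \<i>:])"
  have "c * q0 (\<i> * of_real y) = poly g (of_real y) / of_real y ^ m" for y
    by (simp add: PN(3) N' b g_def poly_pcompose power_mult_distrib field_simps)
  thus ?thesis by blast
qed

text \<open>The hypothesis says that \<open>coeff g\<close> is invariant under \<open>n \<mapsto> 2m - 2k - n\<close>, and reindexing by this
  involution turns \<open>H (2k - s)\<close> into \<open>- H s\<close>.\<close>

lemma symmetric_polar_parts_cancel:
  fixes g :: "complex poly"
  assumes sym: "\<And>y::real. y > 0 \<Longrightarrow> poly g (of_real (1 / y)) / of_real (1 / y) ^ m =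
      of_real y ^ (2 * k) * (poly g (of_real y) / of_real y ^ m)"
  defines "H \<equiv> \<lambda>s. \<Sum>n\<le>degree g. coeff g n / (s + of_nat n - of_nat m)"
  shows "H s + H (of_nat (2 * k) - s) = 0"
proof -
  define N where "N = degree g"
  \<comment> \<open>Both sides of \<open>sym\<close> multiplied by \<open>y^(m + N)\<close>, where
    \<open>reflect_poly g\<close> stands for \<open>y^N g(1/y)\<close>. They agree for all positive
    \<open>y\<close>, hence as polynomials.\<close>
  define lhs where "lhs = monom 1 (2 * m) * reflect_poly g"
  define rhs where "rhs = monom 1 (2 * k + N) * g"
  have "poly lhs (of_real y) = poly rhs (of_real y)" if y: "y > 0" for y
  proof -
    define z where "z = complex_of_real y"
    have z: "z \<noteq> 0" using y by (simp add: z_def)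
    have "poly g (inverse z) * z ^ m = z ^ (2 * k) * poly g z / z ^ m"
      using sym[OF y] by (simp add: z_def[symmetric] inverse_eq_divide power_one_over)
    hence "poly g (inverse z) * z ^ (2 * m) = z ^ (2 * k) * poly g z"
      using z by (simp add: field_simps) (simp add: mult_2_right power_add mult_ac)
    thus ?thesis using z
      by (simp add: lhs_def rhs_def poly_monom poly_reflect_poly_nz z_def[symmetric] N_def power_add mult_ac)
  qed
  hence "of_real ` {0::real<..} \<subseteq> {z. poly (lhs - rhs) z = 0}" by auto
  moreover have "infinite (complex_of_real ` {0<..})"
    by (subst finite_image_iff) (auto simp: inj_on_def infinite_Ioi)
  ultimately have "lhs - rhs = 0" using poly_roots_finite finite_subset by blast
  hence eq: "coeff lhs i = coeff rhs i" for i by simp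
  \<comment> \<open>The inequality makes the truncated subtraction exact, so that the reindexing is
    an involution.\<close>
  have inv: "2 * k + n \<le> 2 * m \<and> coeff g (2 * m - 2 * k - n) = coeff g n" if n: "coeff g n \<noteq> 0" for n
  proof -
    have r: "coeff rhs (2 * k + N + n) = coeff g n" by (simp add: rhs_def coeff_monom_mult)
    hence "coeff lhs (2 * k + N + n) \<noteq> 0" using n eq by simp
    hence *: "2 * m \<le> 2 * k + N + n" "coeff (reflect_poly g) (2 * k + N + n - 2 * m) \<noteq> 0"
      by (auto simp: lhs_def coeff_monom_mult split: if_splits)
    hence le: "2 * k + N + n - 2 * m \<le> N" by (auto simp: coeff_reflect_poly N_def split: if_splits)
    have "coeff g n = coeff (reflect_poly g) (2 * k + N + n - 2 * m)"
      using r eq[of "2 * k + N + n"] *(1) by (simp add: lhs_def coeff_monom_mult)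
    also have "\<dots> = coeff g (N - (2 * k + N + n - 2 * m))" using le by (simp add: coeff_reflect_poly N_def)
    also have "N - (2 * k + N + n - 2 * m) = 2 * m - 2 * k - n" using *(1) le by linarith
    finally show ?thesis using *(1) le by auto
  qed
  define S where "S = {n. coeff g n \<noteq> 0}"
  have S: "S \<subseteq> {..degree g}" by (auto simp: S_def le_degree)
  have H: "H s = (\<Sum>n\<in>S. coeff g n / (s + of_nat n - of_nat m))" for s
    unfolding H_def by (rule sum.mono_neutral_right) (use S in \<open>auto simp: S_def\<close>)
  have "H (of_nat (2 * k) - s) = (\<Sum>n\<in>S. - (coeff g n / (s + of_nat n - of_nat m)))"
    unfolding H
  proof (rule sum.reindex_bij_witness[of _ "\<lambda>n. 2 * m - 2 * k - n" "\<lambda>n. 2 * m - 2 * k - n"])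
    fix n assume "n \<in> S"
    hence n: "coeff g n \<noteq> 0" by (simp add: S_def)
    show "2 * m - 2 * k - (2 * m - 2 * k - n) = n" "2 * m - 2 * k - (2 * m - 2 * k - n) = n"
      using inv[OF n] by auto
    show "2 * m - 2 * k - n \<in> S" "2 * m - 2 * k - n \<in> S" using inv[OF n] n by (auto simp: S_def)
    have "of_nat (2 * m - 2 * k - n) = (of_nat (2 * m) - of_nat (2 * k) - of_nat n :: complex)"
      using inv[OF n] by (simp add: of_nat_diff)
    hence "s + of_nat (2 * m - 2 * k - n) - of_nat m = - (of_nat (2 * k) - s + of_nat n - of_nat m)"
      by simp
    thus "- (coeff g (2 * m - 2 * k - n) / (s + of_nat (2 * m - 2 * k - n) - of_nat m)) =
        coeff g n / (of_nat (2 * k) - s + of_nat n - of_nat m)"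
      using inv[OF n] by (metis minus_divide_right minus_minus)
  qed
  thus ?thesis by (simp add: H sum_negf)
qed

subsection \<open>The remainder term\<close>

text \<open>The data of an automorphic integral on the imaginary axis: \<open>f\<close>, \<open>t\<close> and \<open>poly g y / y\<^sup>m\<close> stand
  for the values of \<open>F\<close>, \<open>q\<^sup>*\<close> and \<open>c\<^sub>0 q\<^sub>0\<close> at \<open>\<i>y\<close>.\<close>

locale ray_integral =
  fixes k m :: nat and f t :: "real \<Rightarrow> complex" and g :: "complex poly"
  assumes f_cont: "continuous_on {0<..} f"
    and f_decay: "\<And>c. \<exists>C. \<forall>y\<ge>1. norm (f y) \<le> C * y powr (- c)"
    and t_decay: "decaying k t"
    and t_sym: "\<And>y. y > 0 \<Longrightarrow> t (1 / y) = of_real y ^ (2 * k) * t y"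
    and f_eq: "\<And>y. y > 0 \<Longrightarrow>
      f (1 / y) = - (of_real y ^ (2 * k) * (f y + t y + poly g (of_real y) / of_real y ^ m))"
begin

abbreviation w :: complex where "w \<equiv> of_nat (2 * k)"

text \<open>Adding \<open>t\<close> removes it from the transformation law: by \<open>t_sym\<close>,
  \<open>h (1 / y)\<close> equals \<open>- y^(2k) (f y + poly g y / y^m)\<close>.\<close>

definition h :: "real \<Rightarrow> complex" where "h y = f y + t y"

text \<open>The integral of \<open>poly g y / y^m\<close> times \<open>y^s\<close> over (0, 1)
  against \<open>dy / y\<close>, convergent for \<open>Re s > m\<close> and continued to the whole
  plane.\<close>

definition H :: "complex \<Rightarrow> complex" where
  "H s = (\<Sum>n\<le>degree g. coeff g n / (s + of_nat n - of_nat m))"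

lemma f_cont_1: "continuous_on {1..} f"
  by (rule continuous_on_subset[OF f_cont]) auto

lemma f_tail: "set_integrable lborel {1..} (mellin_integrand f s)"
proof -
  obtain C where C: "\<forall>y\<ge>1. norm (f y) \<le> C * y powr (- (Re s + 1))" using f_decay by blast
  show ?thesis by (rule mellin_integrand_integrable_tail[OF f_cont_1, of C "Re s + 1"]) (use C in auto)
qed

lemma mellin_tail_f_analytic: "mellin_tail f analytic_on A"
proof -
  have "mellin_tail f analytic_on {s}" for s
  proof -
    obtain C where C: "\<forall>y\<ge>1. norm (f y) \<le> C * y powr (- (Re s + 1))" using f_decay by blast
    have "mellin_tail f holomorphic_on {z. Re z < Re s + 1}" by (rule mellin_tail_holomorphic[OF f_cont_1]) (use C in auto)
    thus ?thesis by (subst analytic_at) (auto intro!: exI[of _ "{z. Re z < Re s + 1}"] open_halfspace_Re_lt)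
  qed
  thus ?thesis using analytic_on_analytic_at by blast
qed

lemma t_tail: "Re s < 2 * real k \<Longrightarrow> set_integrable lborel {1..} (mellin_integrand t s)"
proof -
  assume s: "Re s < 2 * real k"
  obtain C where C: "continuous_on {1..} t" "\<And>y. y \<ge> 1 \<Longrightarrow> norm (t y) \<le> C * y powr (- real (2 * k))"
    using decaying_tail[OF t_decay] by blast
  show ?thesis by (rule mellin_integrand_integrable_tail[OF C(1)]) (use C(2) s in auto)
qed

lemma mellin_tail_t_holomorphic: "mellin_tail t holomorphic_on {s. Re s < 2 * real k}"
proof -
  obtain C where "continuous_on {1..} t" "\<And>y. y \<ge> 1 \<Longrightarrow> norm (t y) \<le> C * y powr (- real (2 * k))"
    using decaying_tail[OF t_decay] by blast
  hence "mellin_tail t holomorphic_on {s. Re s < real (2 * k)}" by (rule mellin_tail_holomorphic)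
  thus ?thesis by simp
qed

lemma h_cont: "continuous_on {1..} h"
  using f_cont_1 decaying_tail[OF t_decay] unfolding h_def by (metis continuous_on_add)

lemma mellin_tail_h: "Re s < 2 * real k \<Longrightarrow> mellin_tail h s = mellin_tail f s + mellin_tail t s"
proof -
  assume s: "Re s < 2 * real k"
  have "mellin_integrand h s = (\<lambda>y. mellin_integrand f s y + mellin_integrand t s y)"
    by (simp add: fun_eq_iff mellin_integrand_def h_def algebra_simps add_divide_distrib)
  thus ?thesis unfolding mellin_tail_def using set_integral_add(2)[OF f_tail[of s] t_tail[OF s]] by simp
qed

text \<open>Applying \<open>f_eq\<close> at \<open>y\<close> and at \<open>1 / y\<close> must return
  \<open>f y\<close>. As \<open>t\<close> is consistent with this by \<open>t_sym\<close>, the polar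
  part has to be so by itself.\<close>

lemma r_sym:
  assumes y: "y > 0"
  shows "poly g (of_real (1 / y)) / of_real (1 / y) ^ m = of_real y ^ (2 * k) * (poly g (of_real y) / of_real y ^ m)"
proof -
  define r where "r x = poly g (complex_of_real x) / of_real x ^ m" for x :: real
  define Y where "Y = complex_of_real y ^ (2 * k)"
  have Y: "Y \<noteq> 0" using y by (simp add: Y_def)
  have 1: "f (1 / y) = - (Y * (f y + t y + r y))" using f_eq[OF y] by (simp add: Y_def r_def)
  have "f (1 / (1 / y)) = - (of_real (1 / y) ^ (2 * k) * (f (1 / y) + t (1 / y) + r (1 / y)))"
    using f_eq[of "1 / y"] y by (simp add: r_def)
  hence "f y = - ((f (1 / y) + t (1 / y) + r (1 / y)) / Y)" by (simp add: Y_def power_divide)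
  hence "f y * Y = - (f (1 / y) + t (1 / y) + r (1 / y))" using Y by (simp add: field_simps)
  moreover have "t (1 / y) = Y * t y" using t_sym[OF y] by (simp add: Y_def)
  ultimately have "r (1 / y) = Y * r y" using 1 by (simp add: algebra_simps)
  thus ?thesis by (simp add: r_def Y_def)
qed

lemma H_cancel: "H s + H (w - s) = 0"
  unfolding H_def by (rule symmetric_polar_parts_cancel[OF r_sym])

text \<open>On (0, 1) the transformation law expresses \<open>f y\<close> by
  \<open>h (1 / y)\<close> and the polar part. Inversion turns the former into a tail at
  \<open>2k - s\<close>; the latter integrates to \<open>H s\<close>.\<close>

lemma integral_decomposition:
  assumes i: "set_integrable lborel {0<..} (mellin_integrand f s)" and s: "Re s > real m"
  shows "set_lebesgue_integral lborel {0<..} (mellin_integrand f s) = mellin_tail f s - mellin_tail h (w - s) - H s"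
proof -
  have i1: "set_integrable lborel {0<..<1} (mellin_integrand f s)" by (rule set_integrable_subset[OF i]) auto
  let ?a = "\<lambda>n. s + of_nat n - of_nat m"
  let ?r = "\<lambda>y. \<Sum>n\<le>degree g. coeff g n * (complex_of_real y powr ?a n / of_real y)"
  have a: "Re (?a n) > 0" for n using s by simp
  have pi: "set_integrable lborel {0<..<1} (\<lambda>y. coeff g n * (complex_of_real y powr ?a n / of_real y))" for n
    using powr_integral_0_1(1)[OF a] by (intro set_integrable_mult_right) auto
  have ri: "set_integrable lborel {0<..<1} ?r"
    using pi unfolding set_integrable_def scaleR_sum_right by (intro Bochner_Integration.integrable_sum)
  have r: "set_lebesgue_integral lborel {0<..<1} ?r = H s"
  proof -
    have "set_lebesgue_integral lborel {0<..<1} ?r =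
        (\<Sum>n\<le>degree g. LINT y:{0<..<1}|lborel. coeff g n * (complex_of_real y powr ?a n / of_real y))"
      using pi unfolding set_integrable_def set_lebesgue_integral_def scaleR_sum_right
      by (intro Bochner_Integration.integral_sum)
    also have "\<dots> = H s" unfolding H_def
      by (intro sum.cong refl) (subst set_integral_mult_right, subst powr_integral_0_1(2)[OF a], simp)
    finally show ?thesis .
  qed
  have eq: "h (1 / y) * of_real y powr (- (w - s)) / of_real y = - mellin_integrand f s y - ?r y" if y: "0 < y" for y
  proof -
    define Y where "Y = complex_of_real y ^ (2 * k)"
    define p where "p = complex_of_real y powr s / of_real y"
    have Y: "Y \<noteq> 0" using y by (simp add: Y_def)
    define r where "r = poly g (complex_of_real y) / of_real y ^ m"
    have "h (1 / y) = - (Y * (f y + r))"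
      using f_eq[OF y] t_sym[OF y] by (simp add: h_def Y_def r_def algebra_simps)
    moreover have "of_real y powr (- (w - s)) / of_real y = p / Y"
      unfolding minus_diff_eq of_real_powr_minus_nat[OF y] by (simp add: p_def Y_def)
    ultimately have 1: "h (1 / y) * of_real y powr (- (w - s)) / of_real y = - (f y * p) - r * p"
      using Y by (simp only: times_divide_eq_right[symmetric]) (simp add: field_simps)
    have "of_real y powr ?a n / of_real y = of_real y ^ n / of_real y ^ m * p" for n
    proof -
      have "of_real y powr ?a n = of_real y powr (s + of_nat n) / complex_of_real y ^ m"
        by (rule of_real_powr_minus_nat[OF y])
      also have "complex_of_real y powr (s + of_nat n) = of_real y powr s * of_real y ^ n"
        using y by (simp add: powr_add powr_nat')
      finally show ?thesis by (simp add: p_def)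
    qed
    hence "?r y = r * p"
      by (simp add: r_def poly_altdef sum_distrib_right sum_divide_distrib mult.assoc)
    thus ?thesis using 1 by (simp add: mellin_integrand_eq p_def)
  qed
  have "mellin_tail h (w - s) = (LINT y:{0<..<1}|lborel. h (1 / y) * of_real y powr (- (w - s)) / of_real y)"
    by (rule mellin_tail_inversion[OF h_cont, symmetric])
  also have "\<dots> = (LINT y:{0<..<1}|lborel. - mellin_integrand f s y - ?r y)"
    by (rule set_lebesgue_integral_cong) (use eq in auto)
  also have "\<dots> = (LINT y:{0<..<1}|lborel. - mellin_integrand f s y) - set_lebesgue_integral lborel {0<..<1} ?r"
    by (rule set_integral_diff(2)[OF _ ri]) (use i1 in \<open>simp add: set_integrable_def\<close>)
  also have "\<dots> = - set_lebesgue_integral lborel {0<..<1} (mellin_integrand f s) - H s"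
    by (simp only: r set_integral_uminus[OF i1])
  finally have low: "set_lebesgue_integral lborel {0<..<1} (mellin_integrand f s) = - mellin_tail h (w - s) - H s" by simp
  have un: "{0::real<..} = {0<..<1} \<union> {1..}" by auto
  have "set_lebesgue_integral lborel {0<..} (mellin_integrand f s) =
      set_lebesgue_integral lborel {0<..<1} (mellin_integrand f s) + mellin_tail f s"
    unfolding mellin_tail_def un by (rule set_integral_Un[OF _ i1 f_tail]) auto
  thus ?thesis using low by simp
qed

text \<open>The formula holds for large \<open>Re s\<close> and spreads by the identity theorem for
  meromorphic functions. The half-plane \<open>Re s > 0\<close> is where the tail of
  \<open>t\<close> at \<open>2k - s\<close> is known to be holomorphic.\<close>

lemma continuation:
  assumes \<Phi>: "\<Phi> meromorphic_on UNIV"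
    and \<sigma>: "\<And>s. Re s > \<sigma> \<Longrightarrow> set_integrable lborel {0<..} (mellin_integrand f s) \<and>
        \<Phi> s = set_lebesgue_integral lborel {0<..} (mellin_integrand f s)"
    and s: "Re s > 0"
  shows "eventually (\<lambda>z. \<Phi> z = mellin_tail f z - mellin_tail f (w - z) - mellin_tail t (w - z) - H z) (at s)"
proof -
  define A where "A = {s::complex. Re s > 0}"
  have A: "open A" "connected A"
    unfolding A_def by (auto intro: open_halfspace_Re_gt convex_connected convex_halfspace_Re_gt)
  define \<delta> where "\<delta> z = \<Phi> z - (mellin_tail f z - mellin_tail f (w - z) - mellin_tail t (w - z) - H z)" for z
  have "(\<lambda>z. mellin_tail t (w - z)) holomorphic_on A"
    by (rule holomorphic_on_compose_gen[OF _ mellin_tail_t_holomorphic, unfolded o_def])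
       (auto simp: A_def intro!: holomorphic_intros)
  hence t: "(\<lambda>z. mellin_tail t (w - z)) meromorphic_on A"
    using A(1) by (intro analytic_on_imp_meromorphic_on) (simp add: analytic_on_open)
  have "mellin_tail f holomorphic_on UNIV" using mellin_tail_f_analytic[of UNIV] by (rule analytic_imp_holomorphic)
  hence "(\<lambda>z. mellin_tail f (w - z)) holomorphic_on A"
    by (rule holomorphic_on_compose_gen[of "\<lambda>z. w - z", unfolded o_def, rotated])
       (auto intro!: holomorphic_intros)
  hence f': "(\<lambda>z. mellin_tail f (w - z)) meromorphic_on A"
    using A(1) by (intro analytic_on_imp_meromorphic_on) (simp add: analytic_on_open)
  have f: "mellin_tail f meromorphic_on A" by (rule analytic_on_imp_meromorphic_on[OF mellin_tail_f_analytic])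
  have H: "H meromorphic_on A" unfolding H_def by (intro meromorphic_intros)
  have "\<delta> meromorphic_on A"
    unfolding \<delta>_def by (intro meromorphic_intros t f f' H meromorphic_on_subset[OF \<Phi>]) auto
  hence "eventually (\<lambda>z. \<delta> z = 0) (cosparse A) \<or> eventually (\<lambda>z. \<delta> z \<noteq> 0) (cosparse A)"
    using A by (rule meromorphic_imp_constant_or_avoid)
  moreover have "\<not> eventually (\<lambda>z. \<delta> z \<noteq> 0) (cosparse A)"
  proof
    assume ev: "eventually (\<lambda>z. \<delta> z \<noteq> 0) (cosparse A)"
    \<comment> \<open>To the right of \<open>M\<close> the integral represents \<open>\<Phi>\<close>
      and the polar integrals converge, so the difference vanishes near \<open>x\<close>.\<close>
    define M where "M = max 0 (max \<sigma> (real m))"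
    define x where "x = complex_of_real (M + 1)"
    have "x \<in> A" by (simp add: x_def A_def M_def)
    hence "eventually (\<lambda>z. \<delta> z \<noteq> 0) (at x)" using ev A(1) by (simp add: eventually_cosparse_open_eq)
    moreover have "eventually (\<lambda>z. z \<in> {z. Re z > M}) (at x)"
      by (rule eventually_at_in_open') (auto simp: x_def open_halfspace_Re_gt)
    ultimately have "eventually (\<lambda>z. False) (at x)"
    proof eventually_elim
      case (elim z)
      hence z: "Re z > \<sigma>" "Re z > real m" "Re z > 0" by (auto simp: M_def)
      have "mellin_tail h (w - z) = mellin_tail f (w - z) + mellin_tail t (w - z)" using z by (intro mellin_tail_h) simp
      hence "\<delta> z = 0" using \<sigma>[OF z(1)] integral_decomposition[OF _ z(2)] by (simp add: \<delta>_def)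
      thus ?case using elim by simp
    qed
    thus False by simp
  qed
  ultimately have "eventually (\<lambda>z. \<delta> z = 0) (at s)"
    using A s by (auto simp: eventually_cosparse_open_eq A_def)
  thus ?thesis by eventually_elim (simp add: \<delta>_def)
qed

text \<open>In the strip both \<open>s\<close> and \<open>2k - s\<close> have positive real part.
  Adding the two continuation formulas cancels the tails of \<open>f\<close> and, by
  \<open>H_cancel\<close>, the polar parts; the tails of \<open>t\<close> recombine to a full Mellin
  integral.\<close>

theorem remainder_integral:
  assumes \<Phi>: "\<Phi> nicely_meromorphic_on UNIV"
    and \<sigma>: "\<And>s. Re s > \<sigma> \<Longrightarrow> set_integrable lborel {0<..} (mellin_integrand f s) \<and>
        \<Phi> s = set_lebesgue_integral lborel {0<..} (mellin_integrand f s)"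
    and R: "remainder_term k \<Phi> R"
    and s: "0 < Re s" "Re s < 2 * real k"
  shows "R s = - set_lebesgue_integral lborel {0<..} (mellin_integrand t s)"
proof -
  define G where "G z = - (mellin_tail t z + mellin_tail t (w - z))" for z
  define A where "A = {z. 0 < Re z} \<inter> {z. Re z < 2 * real k}"
  have A: "open A" unfolding A_def by (intro open_Int open_halfspace_Re_lt open_halfspace_Re_gt)
  have sA: "s \<in> A" using s by (simp add: A_def)
  have m: "\<Phi> meromorphic_on UNIV" using \<Phi> by (simp add: nicely_meromorphic_on_def)
  have "(\<lambda>z. mellin_tail t (w - z)) holomorphic_on A"
    by (rule holomorphic_on_compose_gen[OF _ mellin_tail_t_holomorphic, unfolded o_def])
       (auto simp: A_def intro!: holomorphic_intros)
  moreover have "mellin_tail t holomorphic_on A" by (rule holomorphic_on_subset[OF mellin_tail_t_holomorphic]) (auto simp: A_def)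
  ultimately have "G holomorphic_on A" unfolding G_def by (intro holomorphic_intros)
  hence "isCont G s" using A sA holomorphic_on_imp_continuous_on continuous_on_eq_continuous_at by blast
  hence G: "(G \<longlongrightarrow> G s) (at s)" by (simp add: isCont_def)
  have lim: "filterlim (\<lambda>z. w - z) (at (w - s)) (at s)"
    by (rule filterlim_atI) (auto intro!: tendsto_intros simp: eventually_at_filter)
  \<comment> \<open>\<open>remainder_term\<close> relates \<open>R\<close> to \<open>\<Phi>\<close>
    only off the poles of \<open>\<Phi>\<close>; these are isolated, so the relation holds on a
    punctured neighbourhood of \<open>s\<close>.\<close>
  have np: "eventually (\<lambda>z. \<not> is_pole \<Phi> z) (at x)" for x
    by (intro eventually_not_pole meromorphic_on_isolated_singularity meromorphic_on_subset[OF m]) auto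
  have ws: "Re (w - s) > 0" using s by simp
  have cont: "eventually (\<lambda>z. \<Phi> z = mellin_tail f z - mellin_tail f (w - z) - mellin_tail t (w - z) - H z) (at x)"
    if "Re x > 0" for x
    by (rule continuation[OF m _ that]) (rule \<sigma>)
  have "eventually (\<lambda>z. R z = G z) (at s)"
    using cont[OF s(1)] eventually_compose_filterlim[OF cont[OF ws] lim]
      np[of s] eventually_compose_filterlim[OF np lim]
  proof eventually_elim
    case (elim z)
    have "R z = \<Phi> (w - z) + \<Phi> z" using R elim(3,4) by (simp add: remainder_term_def)
    also have "\<dots> = G z - (H z + H (w - z))" unfolding elim(1,2) by (simp add: G_def)
    finally show ?case using H_cancel by simp
  qed
  hence RG: "(R \<longlongrightarrow> G s) (at s)" using G by (simp add: filterlim_cong)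
  have "R nicely_meromorphic_on UNIV" using R by (simp add: remainder_term_def)
  moreover have "\<not> is_pole R s"
    using RG not_tendsto_and_filterlim_at_infinity[of "at s" R "G s"] by (auto simp: is_pole_def)
  \<comment> \<open>Off its poles a nicely meromorphic function is continuous, which carries the
    equality from the punctured neighbourhood to \<open>s\<close> itself.\<close>
  ultimately have "(R \<longlongrightarrow> R s) (at s)" by (auto simp: nicely_meromorphic_on_def)
  hence "R s = G s" using RG by (intro tendsto_unique[of "at s"]) auto
  also have "\<dots> = - set_lebesgue_integral lborel {0<..} (mellin_integrand t s)"
    by (simp add: G_def decaying_symmetric_integral[OF t_decay s t_sym])
  finally show ?thesis .
qed

end

section \<open>The period function on the imaginary axis\<close>

definition pair_kernel :: "nat \<Rightarrow> bqf \<Rightarrow> real \<Rightarrow> complex" where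
  "pair_kernel k Q y = of_real (alpha_of Q - conj_root Q) ^ k *
     (1 / ((\<i> * of_real y - of_real (alpha_of Q)) ^ k * (\<i> * of_real y - of_real (conj_root Q)) ^ k))"

context
  fixes p k L :: nat and d :: "nat \<Rightarrow> complex" and D :: "nat \<Rightarrow> real" and \<A> :: "nat \<Rightarrow> bqf set"
  assumes sc: "\<And>l. l \<in> {1..L} \<Longrightarrow> symmetric_class p (\<A> l)"
begin

lemma q_star_eq: "q_star p k L d \<A> z = (\<Sum>l=1..L. d l * (\<Sum>Q\<in>simples (\<A> l). 1 / bqf_eval Q z 1 ^ k))"
  unfolding q_star_def
  by (intro sum.cong refl arg_cong2[where f = "(*)"]
      symmetric_class.sum_Z_set[OF sc, of _ "\<lambda>a Q b. 1 / bqf_eval Q z 1 ^ k"])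

lemma q_star_reflect:
  assumes "odd k" "z \<noteq> 0"
  shows "q_star p k L d \<A> (- 1 / z) = - (z ^ (2 * k)) * q_star p k L d \<A> z"
proof -
  have "q_star p k L d \<A> (- 1 / z) =
      (\<Sum>l=1..L. d l * (- (z ^ (2 * k)) * (\<Sum>Q\<in>simples (\<A> l). 1 / bqf_eval Q z 1 ^ k)))"
    unfolding q_star_eq
    by (intro sum.cong refl arg_cong2[where f = "(*)"] symmetric_class.sum_forms_reflect[OF sc] assms)
  thus ?thesis unfolding q_star_eq sum_distrib_left by (simp only: mult.left_commute)
qed

context
  assumes disc: "\<And>l Q. l \<in> {1..L} \<Longrightarrow> Q \<in> \<A> l \<Longrightarrow> bqf_disc Q = D l"
begin

lemma q_star_ray:
  "q_star p k L d \<A> (\<i> * of_real y) =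
     (\<Sum>l=1..L. \<Sum>Q\<in>simples (\<A> l). d l * of_real (D l powr (- (real k / 2))) * pair_kernel k Q y)"
proof -
  have "1 / bqf_eval Q (\<i> * of_real y) 1 ^ k = of_real (D l powr (- (real k / 2))) * pair_kernel k Q y"
    if "l \<in> {1..L}" "Q \<in> simples (\<A> l)" for l Q
    using symmetric_class.bqf_eval_factor[OF sc[OF that(1)], of Q "D l" "\<i> * of_real y" k] disc that
    by (simp add: simples_def pair_kernel_def)
  thus ?thesis unfolding q_star_eq sum_distrib_left mult.assoc by (intro sum.cong refl) auto
qed

text \<open>The product of the roots is \<open>C / A\<close>, and \<open>C\<close> is nonzero for
  hyperbolic forms, so neither root is 0.\<close>

lemma decaying_pair_kernel:
  assumes "l \<in> {1..L}" "Q \<in> simples (\<A> l)"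
  shows "decaying k (pair_kernel k Q)"
proof -
  have Q: "Q \<in> \<A> l" using assms(2) by (simp add: simples_def)
  obtain A B C where ABC: "Q = (A, B, C)" by (cases Q)
  note fp = symmetric_class.form_props[OF sc[OF assms(1)] Q]
  have "A * (alpha_of Q * conj_root Q) = C" using roots_props(3)[of A B C] fp(1,3) by (simp add: ABC)
  hence "alpha_of Q \<noteq> 0" "conj_root Q \<noteq> 0" using fp(2) by (auto simp: ABC)
  thus ?thesis unfolding pair_kernel_def by (intro decaying_cmult decaying_linear_factors)
qed

lemma decaying_q_star: "decaying k (\<lambda>y. q_star p k L d \<A> (\<i> * of_real y))"
  unfolding q_star_ray by (intro decaying_sum decaying_cmult) (rule decaying_pair_kernel)

text \<open>Each summand is integrable in the strip, so the sums pass under the integral, where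
  \<open>q_star_ray\<close> collects them into \<open>q_star\<close>.\<close>

lemma R_eval_R_remainder:
  assumes s: "0 < Re s" "Re s < 2 * real k"
  shows "R_eval k (R_remainder p k L d D \<A>) s =
     - set_lebesgue_integral lborel {0<..} (mellin_integrand (\<lambda>y. q_star p k L d \<A> (\<i> * of_real y)) s)"
proof -
  let ?c = "\<lambda>l. d l * of_real (D l powr (- (real k / 2)))"
  have R: "hecke_R k s (alpha_of Q) (conj_root Q) = set_lebesgue_integral lborel {0<..} (mellin_integrand (pair_kernel k Q) s)" for Q
    unfolding hecke_R_def set_integral_mult_right[symmetric]
    by (rule set_lebesgue_integral_cong) (auto simp: mellin_integrand_def pair_kernel_def)
  have i: "set_integrable lborel {0<..} (\<lambda>y. ?c l * mellin_integrand (pair_kernel k Q) s y)"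
    if "l \<in> {1..L}" "Q \<in> simples (\<A> l)" for l Q
    using decaying_integrable(3)[OF decaying_pair_kernel[OF that] s] by (intro set_integrable_mult_right) auto
  have eq: "R_remainder p k L d D \<A> = - (\<Sum>l=1..L. \<Sum>Q\<in>simples (\<A> l).
      Poly_Mapping.single (alpha_of Q, conj_root Q) (?c l))"
    by (rule R_remainder_eq) (rule sc)
  have "R_eval k (R_remainder p k L d D \<A>) s =
      - (\<Sum>l=1..L. \<Sum>Q\<in>simples (\<A> l). LINT y:{0<..}|lborel. ?c l * mellin_integrand (pair_kernel k Q) s y)"
    unfolding eq R_eval_uminus R_eval_sum R_eval_single R set_integral_mult_right ..
  also have "(\<Sum>l=1..L. \<Sum>Q\<in>simples (\<A> l). LINT y:{0<..}|lborel. ?c l * mellin_integrand (pair_kernel k Q) s y) =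
      (\<Sum>l=1..L. LINT y:{0<..}|lborel. \<Sum>Q\<in>simples (\<A> l). ?c l * mellin_integrand (pair_kernel k Q) s y)"
    using i unfolding set_integrable_def set_lebesgue_integral_def scaleR_sum_right
    by (intro sum.cong refl Bochner_Integration.integral_sum[symmetric])
  also have "\<dots> = (LINT y:{0<..}|lborel. \<Sum>l=1..L. \<Sum>Q\<in>simples (\<A> l). ?c l * mellin_integrand (pair_kernel k Q) s y)"
    using i unfolding set_integrable_def set_lebesgue_integral_def scaleR_sum_right
    by (intro Bochner_Integration.integral_sum[symmetric] Bochner_Integration.integrable_sum)
  also have "(\<lambda>y. \<Sum>l=1..L. \<Sum>Q\<in>simples (\<A> l). ?c l * mellin_integrand (pair_kernel k Q) s y) =
      mellin_integrand (\<lambda>y. q_star p k L d \<A> (\<i> * of_real y)) s"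
    unfolding q_star_ray mellin_integrand_eq sum_distrib_right by (simp only: mult.assoc)
  finally show ?thesis .
qed

end

end


theorem theorem2:
  fixes p k L :: nat
    and F q q0 \<Phi> R :: "complex \<Rightarrow> complex"
    and a d :: "nat \<Rightarrow> complex"
    and c0 :: complex
    and D :: "nat \<Rightarrow> real"
    and \<A> :: "nat \<Rightarrow> bqf set"
  assumes p: "p \<ge> 3"
    and k: "odd k"
    and F: "entire_automorphic_integral p k F a q"
    and a0: "a 0 = 0"
    and symm: "hecke_symmetric p q"
    and q: "\<And>z. Im z > 0 \<Longrightarrow> q z = q_star p k L d \<A> z + c0 * q0 z"
    and hyp: "\<And>l. l \<in> {1..L} \<Longrightarrow> hyperbolic_class p (\<A> l)"
    and neg: "\<And>l. l \<in> {1..L} \<Longrightarrow> \<A> l = uminus ` \<A> l"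
    and disc: "\<And>l Q. l \<in> {1..L} \<Longrightarrow> Q \<in> \<A> l \<Longrightarrow> bqf_disc Q = D l"
    and q0: "rational_function q0" "\<And>z. is_pole q0 z \<Longrightarrow> z = 0"
    and \<Phi>: "mellin_continuation F \<Phi>"
    and R: "remainder_term k \<Phi> R"
  shows "(\<forall>s. 0 < Re s \<and> Re s < 2 * real k \<longrightarrow>
            R s = R_eval k (R_remainder p k L d D \<A>) s) \<and>
         (\<forall>s. 0 < Re s \<and> Re s < 2 * real k \<longrightarrow>
            R_eval k (\<Sum>j<p. (rho p ^^ j) (R_remainder p k L d D \<A>)) s = 0)"
proof (intro conjI allI impI)
  have sc: "symmetric_class p (\<A> l)" if "l \<in> {1..L}" for l
    using that p hyp neg by unfold_locales auto
  fix s :: complex assume s: "0 < Re s \<and> Re s < 2 * real k"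
  show "R_eval k (\<Sum>j<p. (rho p ^^ j) (R_remainder p k L d D \<A>)) s = 0"
    by (rule rho_orbit_sum_eq_0[OF _ k]) (rule sc)
  have l: "hecke_lambda p > 0" using hecke_lambda_ge_1[OF p] by simp
  have hol: "F holomorphic_on {z. Im z > 0}"
    and four: "\<And>z. Im z > 0 \<Longrightarrow>
        (\<lambda>n. a n * exp (2 * of_real pi * \<i> * of_nat n * z / of_real (hecke_lambda p))) sums F z"
    and feq: "\<And>z. Im z > 0 \<Longrightarrow> F (- 1 / z) / z ^ (2 * k) = F z + q z"
    using F unfolding entire_automorphic_integral_def by auto
  obtain g m where g: "\<And>y. y > 0 \<Longrightarrow> c0 * q0 (\<i> * of_real y) = poly g (of_real y) / of_real y ^ m"
    using rational_pole_only_0[OF q0] by blast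
  define f where "f y = F (\<i> * of_real y)" for y :: real
  define t where "t y = q_star p k L d \<A> (\<i> * of_real y)" for y :: real
  \<comment> \<open>For odd \<open>k\<close> the factor \<open>\<i> ^ (2 * k)\<close> is -1; this is
    the origin of the minus sign in \<open>f_eq\<close>.\<close>
  have i2k: "(\<i> * of_real y) ^ (2 * k) = - (of_real y ^ (2 * k))" for y :: real
    using k by (simp add: power_mult_distrib power_mult)
  have inv: "- 1 / (\<i> * of_real y) = \<i> * of_real (1 / y)" for y :: real
    by (cases "y = 0") (simp_all add: field_simps)
  have refl: "q_star p k L d \<A> (- 1 / z) = - (z ^ (2 * k)) * q_star p k L d \<A> z" if "z \<noteq> 0" for z
    by (rule q_star_reflect[OF _ k that]) (rule sc)
  have "ray_integral k m f t g"
  proof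
    show "continuous_on {0<..} f" unfolding f_def
      by (intro continuous_on_compose2[OF holomorphic_on_imp_continuous_on[OF hol]] continuous_intros) auto
    show "\<exists>C. \<forall>y\<ge>1. norm (f y) \<le> C * y powr (- c)" for c
    proof -
      obtain C where "\<forall>y\<ge>1. norm (f y) \<le> C * exp (- (2 * pi / hecke_lambda p) * y)"
        using fourier_series_decay[of "hecke_lambda p" a F] l a0 four unfolding f_def by blast
      thus ?thesis by (rule exp_decay_imp_powr_decay[rotated]) (use l in simp)
    qed
    show "decaying k t" unfolding t_def by (rule decaying_q_star) (use sc disc in auto)
    show "t (1 / y) = of_real y ^ (2 * k) * t y" if "y > 0" for y
      using refl[of "\<i> * of_real y"] that unfolding t_def inv i2k by simp
    show "f (1 / y) = - (of_real y ^ (2 * k) * (f y + t y + poly g (of_real y) / of_real y ^ m))"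
      if y: "y > 0" for y
    proof -
      have "f (1 / y) / - (of_real y ^ (2 * k)) = f y + (t y + poly g (of_real y) / of_real y ^ m)"
        using feq[of "\<i> * of_real y"] q[of "\<i> * of_real y"] y g[OF y]
        unfolding inv i2k by (simp add: f_def t_def)
      moreover have "of_real y ^ (2 * k) \<noteq> (0 :: complex)" using y by simp
      moreover have "x = - (Y * Z)" if "x / - Y = Z" "Y \<noteq> 0" for x Y Z :: complex
        using that by auto
      ultimately show ?thesis unfolding add.assoc by blast
    qed
  qed
  moreover obtain \<sigma> where "\<And>s. Re s > \<sigma> \<Longrightarrow> set_integrable lborel {0<..} (mellin_integrand f s) \<and>
      \<Phi> s = set_lebesgue_integral lborel {0<..} (mellin_integrand f s)"
    using \<Phi> unfolding mellin_continuation_def mellin_integrand_def f_def by blast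
  moreover have "\<Phi> nicely_meromorphic_on UNIV" using \<Phi> by (simp add: mellin_continuation_def)
  ultimately have "R s = - set_lebesgue_integral lborel {0<..} (mellin_integrand t s)"
    using ray_integral.remainder_integral R s by blast
  also have "\<dots> = R_eval k (R_remainder p k L d D \<A>) s"
    unfolding t_def by (rule R_eval_R_remainder[symmetric]) (use sc disc s in auto)
  finally show "R s = R_eval k (R_remainder p k L d D \<A>) s" .
qed

end
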